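(* Let $\omega$ be a pure, split, $\alpha$-invariant and translation invariant state on $\mathcal A$. Suppose that the graded $W^*$-$(G,\mathfrak p)$-dynamical system $(\pi_\omega(\mathcal A_R)'',\mathrm{Ad}_{\hat\Gamma_\omega},\hat\alpha_\omega)$ is equivalent to $(\mathcal R_{0,\mathcal K},\mathrm{Ad}_{\Gamma_{\mathcal K}},\mathrm{Ad}_{V_g})\in\mathcal S_0$ via a $*$-isomorphism $\iota:\pi_\omega(\mathcal A_R)''\to\mathcal R_{0,\mathcal K}=\mathcal B(\mathcal K\otimes\mathbb C^2)$. Let $\rho=\iota\circ\hat\beta_{S_1}|_{\pi_\omega(\mathcal A_R)''}\circ\iota^{-1}$ be the $*$-endomorphism of $\mathcal R_{0,\mathcal K}$ induced by translation, so that $\iota\circ\pi_\omega\circ\beta_{S_1}(A)=\rho\circ\iota\circ\pi_\omega(A)$ for $A\in\mathcal A_R$. Then there are isometries $\{B_\mu\}_{\mu\in\mathcal P}$ on $\mathcal K\otimes\mathbb C^2$ with $B_\nu^*B_\mu=\delta_{\mu,\nu}1$, $$\rho\circ\iota\circ\pi_\omega(A)=\sum_{\mu\in\mathcal P}\mathrm{Ad}_{B_\mu\Gamma_{\mathcal K}^{|\mu|}}\circ\iota\circ\pi_\omega(A)=\sum_{\mu\in\mathcal P}\mathrm{Ad}_{\Gamma_{\mathcal K}^{|\mu|}B_\mu}\circ\iota\circ\pi_\omega(A),\qquad A\in\mathcal A_R,$$ and $$\iota\circ\pi_\omega\big(E^{(0)}_{\mu_0,\nu_0}E^{(1)}_{\mu_1,\nu_1}\cdots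 E^{(N)}_{\mu_N,\nu_N}\big)=(-1)^{\sum_{k=1}^N(|\mu_k|+|\nu_k|)\sum_{j=0}^{k-1}|\nu_j|}B_{\mu_0}\cdots B_{\mu_N}B_{\nu_N}^*\cdots B_{\nu_0}^*$$ for all $N\in\mathbb N\cup\{0\}$ and $\mu_0,\dots,\mu_N,\nu_0,\dots,\nu_N\in\mathcal P$. The operators $B_\mu$ have homogeneous parity: there is a $\sigma_0\in\{0,1\}$, independent of $\mu$, with $\mathrm{Ad}_{\Gamma_{\mathcal K}}(B_\mu)=(-1)^{|\mu|+\sigma_0}B_\mu$. Furthermore, with $T_{\mathbf B}(x)=\sum_{\mu\in\mathcal P}B_\mu xB_\mu^*$, $$\sigma\text{-weak-}\lim_{N\to\infty}T_{\mathbf B}^N\circ\iota(x)=\langle\Omega_\omega,x\Omega_\omega\rangle\,1_{\mathcal K\otimes\mathbb C^2},\qquad x\in\pi_\omega(\mathcal A_R)'',$$ and for each $g\in G$ there is $c_g\in\mathbb T$ such that for all $\nu\in\mathcal P$ $$\sum_{\mu\in\mathcal P}\langle\psi_\mu,\boldsymbol\Gamma(U_g)\psi_\nu\rangle B_\mu=c_gV_gB_\nu V_g^*.$$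
   Context: **CAR algebra and symmetry.** Fix $d\in\mathbb N$, a finite group $G$ and a homomorphism $\mathfrak p:G\to\mathbb Z_2=\{0,1\}$ (additive). $\mathcal A$ is the CAR algebra over $l^2(\mathbb Z)\otimes\mathbb C^d$, generated by $a(f)$ (antilinear in $f$), $\{a(f_1),a(f_2)\}=0$, $\{a(f_1),a(f_2)^*\}=\langle f_1,f_2\rangle$. For $X\subset\mathbb Z$, $\mathcal A_X\subset\mathcal A$ is the CAR algebra over $l^2(X)\otimes\mathbb C^d$; $\mathcal A_R=\mathcal A_{\mathbb Z_{\ge0}}$. For a unitary/anti-unitary $w$, $\beta_w$ is the linear/anti-linear $*$-automorphism with $\beta_w(a(f))=a(wf)$; $\Theta=\beta_{-1}$ is the parity; $\beta_{S_x}$ ($x\in\mathbb Z$) is translation by $x$, $S_x$ being the shift by $x$ on $l^2(\mathbb Z)$ tensored with $1_{\mathbb C^d}$. A projective unitary/anti-unitary representation of $G$ relative to $\mathfrak p$ is a family $V_g$, unitary if $\mathfrak p(g)=0$, anti-unitary if $\mathfrak p(g)=1$, with $V_gV_h=\upsilon(g,h)V_{gh}$, $\upsilon(g,h)\in U(1)$, $\upsilon(e,g)=\upsilon(g,e)=1$. Fix such a representation $U$ on $\mathbb C^d$ and let $\alpha_g=\beta_{\bigoplus_{\mathbb Z}U_g}$; $\alpha$ is taken to be an action of $G$, $\alpha_g\alpha_h=\alpha_{gh}$. A state $\varphi$ is $\alpha$-invariant if for all $A$: $\varphi(\alpha_g(A))=\varphi(A)$ when $\mathfrak p(g)=0$,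 and $\varphi(\alpha_g(A^* ))=\varphi(A)$ when $\mathfrak p(g)=1$; translation invariant if $\varphi\circ\beta_{S_x}=\varphi$ for all $x$ (then it is $\Theta$-invariant). A pure $\Theta$-invariant state $\varphi$ is split if $\pi_{\varphi|_{\mathcal A_R}}(\mathcal A_R)''$ is type I. $(\mathcal H_\varphi,\pi_\varphi,\Omega_\varphi)$ is the GNS triple; $\hat\Gamma_\varphi\pi_\varphi(A)\Omega_\varphi=\pi_\varphi(\Theta(A))\Omega_\varphi$; $\hat\alpha_\varphi$ is the extension of $\alpha|_{\mathcal A_R}$ to $\pi_\varphi(\mathcal A_R)''$. For translation invariant $\omega$, $\hat\beta_{S_1}$ is the automorphism of $\pi_\omega(\mathcal A)''$ with $\hat\beta_{S_1}\circ\pi_\omega=\pi_\omega\circ\beta_{S_1}$; it maps $\pi_\omega(\mathcal A_R)''$ into itself. **Fock basis.** $\boldsymbol\Gamma(U_g)$ is the (unitary/anti-unitary) second quantization of $U_g$ on the fermionic Fock space $\mathcal F(\mathbb C^d)$. $\mathcal P$ is the power set of $\{1,\dots,d\}$ and $|\mu|=\#\mu$ mod 2. $\{\psi_\mu\}_{\mu\in\mathcal P}$ is the standard orthonormal basis of $\mathcal F(\mathbb C^d)$: $\psi_\emptyset$ is the vacuum and, for $\mu=\{\mu_1<\dots<\mu_l\}$, $\psi_\mu\propto a^*(e_{\mu_1})\cdots a^*(e_{\mu_l})\psi_\emptyset$, normalized. $E^{(0)}_{\mu,\nu}$ are the matrix units of $\mathcal A_{\{0\}}\simeq\mathcal B(\mathcal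 F(\mathbb C^d))$ for this basis, and $E^{(x)}_{\mu,\nu}=\beta_{S_x}(E^{(0)}_{\mu,\nu})$. **Graded systems.** A graded $W^*$-$(G,\mathfrak p)$-dynamical system $(\mathcal M,\theta,\hat\alpha)$ is a von Neumann algebra $\mathcal M$ with an involutive automorphism $\theta$ and an action $\hat\alpha$ of $G$ commuting with $\theta$, $\hat\alpha_g$ being a linear (resp. anti-linear) $*$-automorphism if $\mathfrak p(g)=0$ (resp. $1$). Two systems are equivalent via $\iota$ if $\iota$ is a $*$-isomorphism intertwining gradings and actions. For a Hilbert space $\mathcal K$ let $\Gamma_{\mathcal K}=1_{\mathcal K}\otimes\sigma_z$ on $\mathcal K\otimes\mathbb C^2$ ($\sigma_z$ the Pauli matrix) and $\mathcal R_{0,\mathcal K}=\mathcal B(\mathcal K)\otimes M_2$. $\mathcal S_0$ is the set of systems $(\mathcal R_{0,\mathcal K},\mathrm{Ad}_{\Gamma_{\mathcal K}},\mathrm{Ad}_{V_g})$ with $V$ a projective unitary/anti-unitary representation of $G$ on $\mathcal K\otimes\mathbb C^2$ relative to $\mathfrak p$ such that $\mathrm{Ad}_{V_g}(\Gamma_{\mathcal K})=(-1)^{\mathfrak q(g)}\Gamma_{\mathcal K}$ for some homomorphism $\mathfrak q:G\to\mathbb Z_2$. For an operator $Y$, $\mathrm{Ad}_Y(x)=YxY^*$. *)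

theory Defs
  imports
    "HOL-Analysis.Analysis"
    "HOL-Algebra.Elementary_Groups"
begin

section \<open>Complex Hilbert spaces and C*-algebras\<close>

class cvector = real_vector +
  fixes scaleC :: "complex \<Rightarrow> 'a \<Rightarrow> 'a" (infixr \<open>*\<^sub>C\<close> 75)
  assumes scaleC_add_right: "c *\<^sub>C (x + y) = c *\<^sub>C x + c *\<^sub>C y"
    and scaleC_add_left: "(b + c) *\<^sub>C x = b *\<^sub>C x + c *\<^sub>C x"
    and scaleC_scaleC: "b *\<^sub>C (c *\<^sub>C x) = (b * c) *\<^sub>C x"
    and scaleR_eq_scaleC: "r *\<^sub>R x = complex_of_real r *\<^sub>C x"

text \<open>
  The inner product is linear in its second argument.  The zero space is excluded, so that the
  bounded operators form a unital normed algebra with \<open>0 \<noteq> 1\<close>.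
\<close>

class chilbert = cvector + real_inner + complete_space +
  fixes cinner :: "'a \<Rightarrow> 'a \<Rightarrow> complex"
  assumes cinner_commute: "cinner x y = cnj (cinner y x)"
    and cinner_add_right: "cinner x (y + z) = cinner x y + cinner x z"
    and cinner_scaleC_right: "cinner x (c *\<^sub>C y) = c * cinner x y"
    and Re_cinner: "Re (cinner x y) = inner x y"
    and chilbert_nontrivial: "\<exists>x. x \<noteq> 0"

class cstar_algebra = cvector + real_normed_algebra_1 + complete_space +
  fixes star :: "'a \<Rightarrow> 'a" (\<open>_\<^sup>\<dagger>\<close> [1000] 999)
  assumes scaleC_mult_left: "(c *\<^sub>C x) * y = c *\<^sub>C (x * y)"
    and scaleC_mult_right: "x * (c *\<^sub>C y) = c *\<^sub>C (x * y)"
    and star_star: "(x\<^sup>\<dagger>)\<^sup>\<dagger> = x"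
    and star_add: "(x + y)\<^sup>\<dagger> = x\<^sup>\<dagger> + y\<^sup>\<dagger>"
    and star_mult: "(x * y)\<^sup>\<dagger> = y\<^sup>\<dagger> * x\<^sup>\<dagger>"
    and star_scaleC: "(c *\<^sub>C x)\<^sup>\<dagger> = cnj c *\<^sub>C x\<^sup>\<dagger>"
    and cstar_identity: "norm (x\<^sup>\<dagger> * x) = (norm x)\<^sup>2"

instance chilbert \<subseteq> banach ..

instance cstar_algebra \<subseteq> banach ..

lemma scaleC_zero_right [simp]: "c *\<^sub>C (0::'a::cvector) = 0"
  using scaleC_add_right[of c "0::'a" 0] by simp

lemma scaleC_zero_left [simp]: "0 *\<^sub>C (x::'a::cvector) = 0"
  using scaleR_eq_scaleC[of 0 x] by simp

lemma scaleC_one [simp]: "1 *\<^sub>C (x::'a::cvector) = x"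
  using scaleR_eq_scaleC[of 1 x] by simp

lemma scaleC_minus_right: "c *\<^sub>C (- x) = - (c *\<^sub>C (x::'a::cvector))"
  using scaleC_add_right[of c x "-x"] by (simp add: eq_neg_iff_add_eq_0 add.commute)

lemma scaleC_diff_right: "c *\<^sub>C (x - y) = c *\<^sub>C x - c *\<^sub>C (y::'a::cvector)"
  using scaleC_add_right[of c x "-y"] by (simp add: scaleC_minus_right)

lemma scaleC_scaleR: "c *\<^sub>C (r *\<^sub>R x) = r *\<^sub>R (c *\<^sub>C (x::'a::cvector))"
  by (simp add: scaleR_eq_scaleC scaleC_scaleC mult.commute)

lemma cinner_add_left: "cinner (x + y) z = cinner x z + cinner y (z::'a::chilbert)"
  by (metis cinner_add_right cinner_commute complex_cnj_add)

lemma cinner_scaleC_left: "cinner (c *\<^sub>C x) y = cnj c * cinner x (y::'a::chilbert)"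
  by (metis cinner_commute cinner_scaleC_right complex_cnj_mult)

lemma inner_scaleC_ii: "inner x (\<i> *\<^sub>C y) = - Im (cinner x (y::'a::chilbert))"
  by (simp flip: Re_cinner add: cinner_scaleC_right)

lemma cinner_eq: "cinner x (y::'a::chilbert) = Complex (inner x y) (- inner x (\<i> *\<^sub>C y))"
  by (simp add: complex_eq_iff Re_cinner inner_scaleC_ii)

lemma cinner_self: "cinner x (x::'a::chilbert) = of_real ((norm x)\<^sup>2)"
proof -
  have "Im (cinner x x) = 0" using arg_cong[OF cinner_commute[of x x], of Im] by simp
  then show ?thesis by (simp add: complex_eq_iff Re_cinner power2_norm_eq_inner)
qed

lemma norm_scaleC: "norm (c *\<^sub>C x) = cmod c * norm (x::'a::chilbert)"
proof -
  have "of_real ((norm (c *\<^sub>C x))\<^sup>2) = c * cnj c * of_real ((norm x)\<^sup>2)"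
    unfolding cinner_self[symmetric] by (simp add: cinner_scaleC_left cinner_scaleC_right)
  also have "\<dots> = complex_of_real ((cmod c * norm x)\<^sup>2)"
    by (simp add: complex_norm_square[symmetric] power_mult_distrib)
  finally have "(norm (c *\<^sub>C x))\<^sup>2 = (cmod c * norm x)\<^sup>2" using of_real_eq_iff by blast
  then show ?thesis by simp
qed

instantiation complex :: chilbert
begin
definition "scaleC_complex (c::complex) (x::complex) = c * x"
definition "cinner_complex (x::complex) (y::complex) = cnj x * y"
instance
proof
  show "\<exists>x. x \<noteq> (0::complex)" by (rule exI[of _ 1]) simp
qed (auto simp: scaleC_complex_def cinner_complex_def algebra_simps scaleR_conv_of_real inner_complex_def)
end

instantiation vec :: (chilbert, finite) chilbert
begin
definition "scaleC_vec c (v::('a,'b) vec) = (\<chi> i. c *\<^sub>C (v $ i))"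
definition "cinner_vec (v::('a,'b) vec) w = (\<Sum>i\<in>UNIV. cinner (v $ i) (w $ i))"
instance
proof
  fix x y z :: "('a,'b) vec" and b c :: complex and r :: real
  show "c *\<^sub>C (x + y) = c *\<^sub>C x + c *\<^sub>C y" by (simp add: scaleC_vec_def vec_eq_iff scaleC_add_right)
  show "(b + c) *\<^sub>C x = b *\<^sub>C x + c *\<^sub>C x" by (simp add: scaleC_vec_def vec_eq_iff scaleC_add_left)
  show "b *\<^sub>C (c *\<^sub>C x) = (b * c) *\<^sub>C x" by (simp add: scaleC_vec_def vec_eq_iff scaleC_scaleC)
  show "r *\<^sub>R x = complex_of_real r *\<^sub>C x" by (simp add: scaleC_vec_def vec_eq_iff scaleR_eq_scaleC)
  show "cinner x y = cnj (cinner y x)" by (simp add: cinner_vec_def cinner_commute[symmetric])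
  show "cinner x (y + z) = cinner x y + cinner x z"
    by (simp add: cinner_vec_def cinner_add_right sum.distrib)
  show "cinner x (c *\<^sub>C y) = c * cinner x y"
    by (simp add: cinner_vec_def scaleC_vec_def cinner_scaleC_right sum_distrib_left)
  show "Re (cinner x y) = inner x y" by (simp add: cinner_vec_def inner_vec_def Re_cinner)
  obtain e :: 'a where "e \<noteq> 0" using chilbert_nontrivial by blast
  then have "(\<chi> i. e) \<noteq> (0::('a,'b) vec)" by (simp add: vec_eq_iff)
  then show "\<exists>x. x \<noteq> (0::('a,'b) vec)" by blast
qed
end

instantiation prod :: (chilbert, chilbert) chilbert
begin
definition "scaleC_prod c (x::'a \<times> 'b) = (c *\<^sub>C fst x, c *\<^sub>C snd x)"
definition "cinner_prod (x::'a \<times> 'b) y = cinner (fst x) (fst y) + cinner (snd x) (snd y)"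
instance
proof
  fix x y z :: "'a \<times> 'b" and b c :: complex and r :: real
  show "c *\<^sub>C (x + y) = c *\<^sub>C x + c *\<^sub>C y" by (simp add: scaleC_prod_def prod_eq_iff scaleC_add_right)
  show "(b + c) *\<^sub>C x = b *\<^sub>C x + c *\<^sub>C x" by (simp add: scaleC_prod_def prod_eq_iff scaleC_add_left)
  show "b *\<^sub>C (c *\<^sub>C x) = (b * c) *\<^sub>C x" by (simp add: scaleC_prod_def prod_eq_iff scaleC_scaleC)
  show "r *\<^sub>R x = complex_of_real r *\<^sub>C x" by (simp add: scaleC_prod_def prod_eq_iff scaleR_eq_scaleC)
  show "cinner x y = cnj (cinner y x)" by (simp add: cinner_prod_def cinner_commute[symmetric])
  show "cinner x (y + z) = cinner x y + cinner x z" by (simp add: cinner_prod_def cinner_add_right)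
  show "cinner x (c *\<^sub>C y) = c * cinner x y"
    by (simp add: cinner_prod_def scaleC_prod_def cinner_scaleC_right distrib_left)
  show "Re (cinner x y) = inner x y" by (simp add: cinner_prod_def inner_prod_def Re_cinner)
  obtain e :: 'a where "e \<noteq> 0" using chilbert_nontrivial by blast
  then have "(e, 0) \<noteq> (0::'a \<times> 'b)" by (simp add: prod_eq_iff)
  then show "\<exists>x. x \<noteq> (0::'a \<times> 'b)" by blast
qed
end

lemma riesz_real:
  fixes f :: "'a::{real_inner,complete_space} \<Rightarrow> real"
  assumes "bounded_linear f"
  obtains z where "\<And>x. f x = inner z x"
proof -
  interpret f: bounded_linear f by fact
  define J where "J x = (norm x)\<^sup>2 - 2 * f x" for x
  obtain K where K: "\<And>x. norm (f x) \<le> norm x * K" using f.bounded by blast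
  have lower: "- K\<^sup>2 \<le> J x" for x
  proof -
    have "f x \<le> norm x * K" using K[of x] by simp
    moreover have "0 \<le> (norm x - K)\<^sup>2" by simp
    ultimately show ?thesis unfolding J_def by (simp add: power2_eq_square algebra_simps)
  qed
  define m where "m = Inf (range J)"
  have bdd: "bdd_below (range J)" using lower by (auto intro!: bdd_belowI)
  have mle: "m \<le> J x" for x unfolding m_def by (rule cInf_lower[OF _ bdd]) simp
  have "\<exists>x. J x < m + 1 / Suc n" for n
    using cInf_lessD[of "range J" "m + 1 / Suc n"] unfolding m_def by auto
  then obtain X where X: "\<And>n. J (X n) < m + 1 / Suc n" by metis
  have par: "(norm (x - y))\<^sup>2 \<le> 2 * (J x - m) + 2 * (J y - m)" for x y
  proof -
    have "(norm (x + y))\<^sup>2 + (norm (x - y))\<^sup>2 = 2 * (norm x)\<^sup>2 + 2 * (norm y)\<^sup>2"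
      by (simp add: power2_norm_eq_inner inner_add_left inner_add_right inner_diff_left inner_diff_right)
    moreover have "4 * J ((1/2) *\<^sub>R (x + y)) = (norm (x + y))\<^sup>2 - 4 * (f x + f y)"
      unfolding J_def f.scaleR f.add norm_scaleR by (simp add: power_mult_distrib power2_eq_square add_divide_distrib)
    moreover have "J x = (norm x)\<^sup>2 - 2 * f x" "J y = (norm y)\<^sup>2 - 2 * f y" by (simp_all add: J_def)
    ultimately show ?thesis using mle[of "(1/2) *\<^sub>R (x + y)"] by argo
  qed
  have "Cauchy X"
  proof (rule metric_CauchyI)
    fix e :: real assume e: "0 < e"
    obtain N where N: "4 / e\<^sup>2 < real (Suc N)" using reals_Archimedean2 less_trans
      by (metis lessI of_nat_less_iff)
    show "\<exists>M. \<forall>m\<ge>M. \<forall>n\<ge>M. dist (X m) (X n) < e"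
    proof (intro exI allI impI)
      fix k n assume kn: "k \<ge> N" "n \<ge> N"
      have b: "J (X i) - m < 1 / real (Suc N)" if "i \<ge> N" for i
      proof -
        have "1 / real (Suc i) \<le> 1 / real (Suc N)" using that by (simp add: frac_le)
        then show ?thesis using X[of i] by linarith
      qed
      have "(norm (X k - X n))\<^sup>2 < 4 * (1 / real (Suc N))"
        using par[of "X k" "X n"] b[OF kn(1)] b[OF kn(2)] by argo
      also have "\<dots> < e\<^sup>2" using N e by (simp add: field_simps)
      finally show "dist (X k) (X n) < e" using e by (simp add: dist_norm power_less_imp_less_base)
    qed
  qed
  then obtain z where z: "X \<longlonglongrightarrow> z" using Cauchy_convergent convergent_def by metis
  have "(\<lambda>n. J (X n)) \<longlonglongrightarrow> J z" unfolding J_def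
    by (intro tendsto_intros z f.tendsto)
  moreover have "(\<lambda>n. m + 1 / real (Suc n)) \<longlonglongrightarrow> m + 0"
    by (intro tendsto_intros LIMSEQ_Suc[OF lim_1_over_n])
  ultimately have Jz: "J z \<le> m" using X LIMSEQ_le[of "\<lambda>n. J (X n)" "J z" "\<lambda>n. m + 1 / real (Suc n)" m]
    by (metis add.right_neutral less_imp_le)
  have "f x = inner z x" for x
  proof (rule ccontr)
    define c where "c = inner z x - f x"
    assume "f x \<noteq> inner z x"
    then have c: "c \<noteq> 0" by (simp add: c_def)
    have quad: "0 \<le> 2 * t * c + t\<^sup>2 * (norm x)\<^sup>2" for t
    proof -
      have "J (z + t *\<^sub>R x) = J z + 2 * t * c + t\<^sup>2 * (norm x)\<^sup>2"
        unfolding J_def c_def power2_norm_eq_inner f.scaleR f.add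
        by (simp add: inner_add_left inner_add_right inner_commute[of x z] power2_eq_square algebra_simps)
      then show ?thesis using mle[of "z + t *\<^sub>R x"] Jz by linarith
    qed
    define q where "q = 1 + (norm x)\<^sup>2"
    have q: "q > 0" "(norm x)\<^sup>2 < q" by (simp_all add: q_def add_pos_nonneg)
    have "2 * (- c / q) * c + (- c / q)\<^sup>2 * (norm x)\<^sup>2 < 0"
    proof -
      have "(- c / q)\<^sup>2 * (norm x)\<^sup>2 < (- c / q)\<^sup>2 * q" using q c by (intro mult_strict_left_mono) auto
      also have "\<dots> = c\<^sup>2 / q" using q by (simp add: power2_eq_square field_simps)
      finally have 1: "(- c / q)\<^sup>2 * (norm x)\<^sup>2 < c\<^sup>2 / q" .
      have "2 * (- c / q) * c = - 2 * (c\<^sup>2 / q)" by (simp add: power2_eq_square)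
      moreover have "0 < c\<^sup>2 / q" using q c by simp
      ultimately show ?thesis using 1 by linarith
    qed
    then show False using quad[of "- c / q"] by linarith
  qed
  then show ?thesis using that by blast
qed

typedef (overloaded) ('a::chilbert) bop =
  "{f :: 'a \<Rightarrow>\<^sub>L 'a. \<forall>c x. blinfun_apply f (c *\<^sub>C x) = c *\<^sub>C blinfun_apply f x}"
  by (rule exI[of _ 0]) simp

setup_lifting type_definition_bop

lift_definition bop_apply :: "'a::chilbert bop \<Rightarrow> 'a \<Rightarrow> 'a" (infixr \<open>\<cdot>\<close> 70) is blinfun_apply .

lemma bop_eqI: "(\<And>v. S \<cdot> v = T \<cdot> v) \<Longrightarrow> S = T"
  by transfer (auto intro: blinfun_eqI)

lemma bop_bounded_linear: "bounded_linear (bop_apply T)"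
  by transfer (rule blinfun.bounded_linear_right)

lemma bop_scaleC: "T \<cdot> (c *\<^sub>C v) = c *\<^sub>C (T \<cdot> v)"
  by transfer blast

lemma bop_exists:
  assumes "bounded_linear f" and "\<And>c v. f (c *\<^sub>C v) = c *\<^sub>C f v"
  shows "\<exists>T. bop_apply T = f"
  using assms by (intro exI[of _ "Abs_bop (Blinfun f)"])
    (simp add: bop_apply.rep_eq Abs_bop_inverse bounded_linear_Blinfun_apply)

lemma bop_adjoint_exists: "\<exists>S. \<forall>x y. cinner (S \<cdot> x) y = cinner x (T \<cdot> y)"
proof -
  interpret T: bounded_linear "bop_apply T" by (rule bop_bounded_linear)
  have "\<exists>z. \<forall>y. inner x (T \<cdot> y) = inner z y" for x
  proof -
    obtain z where "\<And>y. inner x (T \<cdot> y) = inner z y"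
      by (rule riesz_real[OF bounded_linear_inner_right_comp[OF T.bounded_linear_axioms, of x]]) blast
    then show ?thesis by blast
  qed
  then obtain S where S: "\<And>x y. inner (S x) y = inner x (T \<cdot> y)" by metis
  have cS: "cinner (S x) y = cinner x (T \<cdot> y)" for x y
    by (simp add: cinner_eq[of "S x"] cinner_eq[of x] S bop_scaleC)
  have eqI: "u = v" if "\<And>y. inner u y = inner v y" for u v :: 'a
    using that[of "u - v"] by (metis inner_diff_left inner_eq_zero_iff right_minus_eq)
  have add: "S (x + y) = S x + S y" for x y by (rule eqI) (simp add: S inner_add_left)
  have scR: "S (r *\<^sub>R x) = r *\<^sub>R S x" for r x by (rule eqI) (simp add: S)
  have scC: "S (c *\<^sub>C x) = c *\<^sub>C S x" for c x
  proof (rule eqI)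
    fix y show "inner (S (c *\<^sub>C x)) y = inner (c *\<^sub>C S x) y"
      by (simp flip: Re_cinner add: cS cinner_scaleC_left)
  qed
  obtain K where K: "\<And>x. norm (T \<cdot> x) \<le> norm x * K" using T.bounded by blast
  have "norm (S x) \<le> norm x * K" for x
  proof (cases "S x = 0")
    case True
    have "0 \<le> norm x * K" using K[of x] norm_ge_zero order_trans by blast
    then show ?thesis using True by simp
  next
    case False
    have "norm (S x) * norm (S x) = inner x (T \<cdot> S x)"
      by (metis S norm_eq_square power2_eq_square power2_norm_eq_inner)
    also have "\<dots> \<le> norm x * (norm (S x) * K)"
      by (meson K mult_left_mono norm_cauchy_schwarz norm_ge_zero order_trans)
    finally have "norm (S x) * norm (S x) \<le> norm (S x) * (norm x * K)" by (simp add: ac_simps)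
    then show ?thesis using False by simp
  qed
  then have "bounded_linear S" using add scR by (intro bounded_linear_intro) auto
  then obtain S' where "bop_apply S' = S" using bop_exists[of S] scC by blast
  then show ?thesis using cS by metis
qed

lemma bounded_linear_scaleC: "bounded_linear (\<lambda>v::'a::chilbert. c *\<^sub>C v)"
  by (rule bounded_linear_intro[of _ "cmod c"])
    (auto simp: scaleC_add_right scaleC_scaleR norm_scaleC)

instantiation bop :: (chilbert) real_normed_vector
begin

lift_definition zero_bop :: "'a bop" is 0 by simp
lift_definition plus_bop :: "'a bop \<Rightarrow> 'a bop \<Rightarrow> 'a bop" is "(+)"
  by (simp add: blinfun.add_left scaleC_add_right)
lift_definition minus_bop :: "'a bop \<Rightarrow> 'a bop \<Rightarrow> 'a bop" is "(-)"
  by (simp add: blinfun.diff_left scaleC_diff_right)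
lift_definition uminus_bop :: "'a bop \<Rightarrow> 'a bop" is uminus
  by (simp add: blinfun.minus_left scaleC_minus_right)
lift_definition scaleR_bop :: "real \<Rightarrow> 'a bop \<Rightarrow> 'a bop" is "scaleR"
  by (simp add: blinfun.scaleR_left scaleC_scaleR)
lift_definition norm_bop :: "'a bop \<Rightarrow> real" is norm .
lift_definition dist_bop :: "'a bop \<Rightarrow> 'a bop \<Rightarrow> real" is dist .
definition sgn_bop :: "'a bop \<Rightarrow> 'a bop" where "sgn_bop T = scaleR (inverse (norm T)) T"
definition uniformity_bop :: "('a bop \<times> 'a bop) filter" where
  "uniformity_bop = (INF e\<in>{0 <..}. principal {(x, y). dist x y < e})"
definition open_bop :: "'a bop set \<Rightarrow> bool" where
  "open_bop U = (\<forall>x\<in>U. eventually (\<lambda>(x', y). x' = x \<longrightarrow> y \<in> U) uniformity)"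

instance
proof
  fix R S T :: "'a bop" and r s :: real
  show "R + S + T = R + (S + T)" by transfer (rule add.assoc)
  show "R + S = S + R" by transfer (rule add.commute)
  show "0 + R = R" by transfer simp
  show "- R + R = 0" by transfer simp
  show "R - S = R + - S" by transfer simp
  show "scaleR r (S + T) = scaleR r S + scaleR r T" by transfer (rule scaleR_add_right)
  show "scaleR (r + s) T = scaleR r T + scaleR s T" by transfer (rule scaleR_add_left)
  show "scaleR r (scaleR s T) = scaleR (r * s) T" by transfer simp
  show "scaleR 1 T = T" by transfer simp
  show "dist S T = norm (S - T)" by transfer (rule dist_norm)
  show "sgn T = scaleR (inverse (norm T)) T" by (rule sgn_bop_def)
  show "uniformity = (INF e\<in>{0 <..}. principal {(x, y). dist (x::'a bop) y < e})"
    by (rule uniformity_bop_def)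
  show "open U = (\<forall>x\<in>U. \<forall>\<^sub>F (x', y) in uniformity. x' = x \<longrightarrow> y \<in> U)" for U :: "'a bop set"
    by (rule open_bop_def)
  show "norm T = 0 \<longleftrightarrow> T = 0" by transfer simp
  show "norm (S + T) \<le> norm S + norm T" by transfer (rule norm_triangle_ineq)
  show "norm (scaleR r T) = \<bar>r\<bar> * norm T" by transfer simp
qed

end

instantiation bop :: (chilbert) cvector
begin

lift_definition scaleC_bop :: "complex \<Rightarrow> 'a bop \<Rightarrow> 'a bop" is
  "\<lambda>c f. Blinfun (\<lambda>v. c *\<^sub>C blinfun_apply f v)"
  subgoal premises h for c f
    using h bounded_linear_compose[OF bounded_linear_scaleC[of c] blinfun.bounded_linear_right[of f]]
    by (simp add: bounded_linear_Blinfun_apply scaleC_scaleC mult.commute)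
  done

lemma scaleC_bop_apply: "(c *\<^sub>C T) \<cdot> v = c *\<^sub>C (T \<cdot> v)"
  by transfer (simp add: bounded_linear_Blinfun_apply
      bounded_linear_compose[OF bounded_linear_scaleC blinfun.bounded_linear_right])

lemma real_bop_apply:
  "0 \<cdot> v = 0" "(S + T) \<cdot> v = S \<cdot> v + T \<cdot> v" "(S - T) \<cdot> v = S \<cdot> v - T \<cdot> v"
  "(- T) \<cdot> v = - (T \<cdot> v)" "(r *\<^sub>R T) \<cdot> v = r *\<^sub>R (T \<cdot> v)"
  by (transfer; simp add: blinfun.add_left blinfun.diff_left blinfun.minus_left blinfun.scaleR_left)+

instance
  by intro_classes
    (rule bop_eqI; simp add: scaleC_bop_apply real_bop_apply scaleC_add_right scaleC_add_left
      scaleC_scaleC scaleR_eq_scaleC[symmetric])+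

end

lemma norm_bop_apply: "norm (T \<cdot> v) \<le> norm T * norm v"
  by transfer (rule norm_blinfun)

lemma norm_bop_bound: "0 \<le> b \<Longrightarrow> (\<And>v. norm (T \<cdot> v) \<le> b * norm v) \<Longrightarrow> norm T \<le> b"
  by transfer (rule norm_blinfun_bound)

instantiation bop :: (chilbert) real_normed_algebra_1
begin

lift_definition one_bop :: "'a bop" is id_blinfun by simp
lift_definition times_bop :: "'a bop \<Rightarrow> 'a bop \<Rightarrow> 'a bop" is "(o\<^sub>L)" by simp

lemma alg_bop_apply: "1 \<cdot> v = v" "(S * T) \<cdot> v = S \<cdot> T \<cdot> v"
  by (transfer; simp)+

instance
proof
  fix R S T :: "'a bop" and r :: real
  note [simp] = alg_bop_apply real_bop_apply
  have [simp]: "R \<cdot> (v + w) = R \<cdot> v + R \<cdot> w" for R :: "'a bop" and v w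
    by (rule linear_add[OF bounded_linear.linear[OF bop_bounded_linear]])
  have [simp]: "R \<cdot> (r *\<^sub>R v) = r *\<^sub>R (R \<cdot> v)" for R :: "'a bop" and r v
    by (rule linear_scale[OF bounded_linear.linear[OF bop_bounded_linear]])
  show "R * S * T = R * (S * T)" by (rule bop_eqI) simp
  show "1 * R = R" by (rule bop_eqI) simp
  show "R * 1 = R" by (rule bop_eqI) simp
  show "(R + S) * T = R * T + S * T" by (rule bop_eqI) simp
  show "R * (S + T) = R * S + R * T" by (rule bop_eqI) simp
  show "r *\<^sub>R S * T = r *\<^sub>R (S * T)" by (rule bop_eqI) simp
  show "S * r *\<^sub>R T = r *\<^sub>R (S * T)" by (rule bop_eqI) simp
  obtain e :: 'a where e: "e \<noteq> 0" using chilbert_nontrivial by blast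
  show "(0::'a bop) \<noteq> 1"
  proof
    assume "(0::'a bop) = 1"
    then have "(0::'a bop) \<cdot> e = 1 \<cdot> e" by (rule arg_cong)
    then show False using e by simp
  qed
  show "norm (S * T) \<le> norm S * norm T" by transfer (rule norm_blinfun_compose)
  have "norm (1::'a bop) \<le> 1" by transfer (rule norm_blinfun_id_le)
  moreover have "1 \<le> norm (1::'a bop)" using norm_bop_apply[of 1 e] e by simp
  ultimately show "norm (1::'a bop) = 1" by simp
qed

end

instance bop :: (chilbert) complete_space
proof
  fix X :: "nat \<Rightarrow> 'a bop"
  assume "Cauchy X"
  have dist: "dist (Rep_bop A) (Rep_bop B) = dist A B" for A B :: "'a bop"
    by (simp add: dist_bop.rep_eq)
  have "Cauchy (\<lambda>n. Rep_bop (X n))" using \<open>Cauchy X\<close> unfolding Cauchy_def dist .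
  then have "convergent (\<lambda>n. Rep_bop (X n))" by (rule Cauchy_convergent)
  then obtain L where L: "(\<lambda>n. Rep_bop (X n)) \<longlonglongrightarrow> L" unfolding convergent_def by blast
  have "blinfun_apply L (c *\<^sub>C x) = c *\<^sub>C blinfun_apply L x" for c x
  proof (rule LIMSEQ_unique)
    show "(\<lambda>n. blinfun_apply (Rep_bop (X n)) (c *\<^sub>C x)) \<longlonglongrightarrow> blinfun_apply L (c *\<^sub>C x)"
      by (intro tendsto_intros L)
    have "(\<lambda>n. c *\<^sub>C blinfun_apply (Rep_bop (X n)) x) \<longlonglongrightarrow> c *\<^sub>C blinfun_apply L x"
      by (intro bounded_linear.tendsto[OF bounded_linear_scaleC] tendsto_intros L)
    then show "(\<lambda>n. blinfun_apply (Rep_bop (X n)) (c *\<^sub>C x)) \<longlonglongrightarrow> c *\<^sub>C blinfun_apply L x"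
      by (simp add: bop_apply.rep_eq[symmetric] bop_scaleC)
  qed
  then have R: "Rep_bop (Abs_bop L) = L" by (intro Abs_bop_inverse) blast
  have "(\<lambda>n. dist (Rep_bop (X n)) L) \<longlonglongrightarrow> 0" using L by (rule tendsto_dist_iff[THEN iffD1])
  then have "(\<lambda>n. dist (X n) (Abs_bop L)) \<longlonglongrightarrow> 0" using R by (simp flip: dist)
  then have "X \<longlonglongrightarrow> Abs_bop L" by (rule tendsto_dist_iff[THEN iffD2])
  then show "convergent X" by (rule convergentI)
qed

lemma bop_cinner_eqI: "(\<And>x y. cinner x (S \<cdot> y) = cinner x (T \<cdot> y)) \<Longrightarrow> S = T"
proof (rule bop_eqI)
  fix v assume h: "\<And>x y. cinner x (S \<cdot> y) = cinner x (T \<cdot> y)"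
  have "inner (S \<cdot> v - T \<cdot> v) (S \<cdot> v) = inner (S \<cdot> v - T \<cdot> v) (T \<cdot> v)" by (metis Re_cinner h)
  then show "S \<cdot> v = T \<cdot> v" by (metis inner_diff_right inner_eq_zero_iff right_minus_eq)
qed

instantiation bop :: (chilbert) cstar_algebra
begin

definition star_bop :: "'a bop \<Rightarrow> 'a bop" where
  "star_bop T = (SOME S. \<forall>x y. cinner (S \<cdot> x) y = cinner x (T \<cdot> y))"

lemma cinner_star_left: "cinner (star T \<cdot> x) y = cinner x (T \<cdot> y)"
  using someI_ex[OF bop_adjoint_exists[of T]] unfolding star_bop_def by blast

lemma cinner_star_right: "cinner x (star T \<cdot> y) = cinner (T \<cdot> x) y"
  by (metis cinner_commute cinner_star_left)

instance
proof
  fix S T :: "'a bop" and c :: complex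
  note [simp] = alg_bop_apply real_bop_apply scaleC_bop_apply
  show "c *\<^sub>C S * T = c *\<^sub>C (S * T)" by (rule bop_eqI) simp
  show "S * c *\<^sub>C T = c *\<^sub>C (S * T)" by (rule bop_eqI) (simp add: bop_scaleC)
  show ss: "star (star T) = T" for T :: "'a bop"
    by (rule bop_cinner_eqI) (simp add: cinner_star_left cinner_star_right)
  show "star (S + T) = star S + star T"
    by (rule bop_cinner_eqI) (simp add: cinner_star_right cinner_add_right cinner_add_left)
  show "star (S * T) = star T * star S" by (rule bop_cinner_eqI) (simp add: cinner_star_right)
  show "star (c *\<^sub>C T) = cnj c *\<^sub>C star T"
    by (rule bop_cinner_eqI) (simp add: cinner_star_right cinner_scaleC_right cinner_scaleC_left)
  have low: "(norm T)\<^sup>2 \<le> norm (star T * T)" for T :: "'a bop"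
  proof -
    have "norm (T \<cdot> v) \<le> sqrt (norm (star T * T)) * norm v" for v
    proof (rule power2_le_imp_le)
      have "(norm (T \<cdot> v))\<^sup>2 = Re (cinner v ((star T * T) \<cdot> v))"
        by (simp add: cinner_star_right cinner_self)
      also have "\<dots> = inner v ((star T * T) \<cdot> v)" by (rule Re_cinner)
      also have "\<dots> \<le> norm v * norm ((star T * T) \<cdot> v)" by (rule norm_cauchy_schwarz)
      also have "\<dots> \<le> norm v * (norm (star T * T) * norm v)"
        by (intro mult_left_mono norm_bop_apply norm_ge_zero)
      also have "\<dots> = (sqrt (norm (star T * T)) * norm v)\<^sup>2"
        by (simp add: power_mult_distrib) (simp add: power2_eq_square)
      finally show "(norm (T \<cdot> v))\<^sup>2 \<le> (sqrt (norm (star T * T)) * norm v)\<^sup>2" .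
    qed simp
    then have "norm T \<le> sqrt (norm (star T * T))" by (intro norm_bop_bound) auto
    then have "(norm T)\<^sup>2 \<le> (sqrt (norm (star T * T)))\<^sup>2" by (intro power_mono) auto
    then show ?thesis by simp
  qed
  have le: "norm T \<le> norm (star T)" for T :: "'a bop"
  proof (cases "T = 0")
    case False
    have "norm T * norm T \<le> norm (star T) * norm T"
      using low[of T] norm_mult_ineq[of "star T" T] by (simp add: power2_eq_square)
    then show ?thesis using False by (simp add: mult_le_cancel_right)
  qed simp
  have "norm (star T * T) \<le> norm (star T) * norm T" by (rule norm_mult_ineq)
  also have "\<dots> \<le> norm T * norm T" using le[of "star T"] by (intro mult_right_mono) (simp_all add: ss)
  finally show "norm (star T * T) = (norm T)\<^sup>2" using low[of T] by (simp add: power2_eq_square)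
qed

end


lemma bounded_linear_cinner_scaleC: "bounded_linear (\<lambda>v::'a::chilbert. cinner y v *\<^sub>C (x::'a))"
proof (rule bounded_linear_intro[of _ "2 * norm y * norm x"])
  show "cinner y (v + w) *\<^sub>C x = cinner y v *\<^sub>C x + cinner y w *\<^sub>C x" for v w
    by (simp add: cinner_add_right scaleC_add_left)
  show "cinner y (r *\<^sub>R v) *\<^sub>C x = r *\<^sub>R (cinner y v *\<^sub>C x)" for r v
    by (simp add: scaleR_eq_scaleC cinner_scaleC_right scaleC_scaleC)
  show "norm (cinner y v *\<^sub>C x) \<le> norm v * (2 * norm y * norm x)" for v
  proof -
    have "\<bar>Re (cinner y v)\<bar> \<le> norm y * norm v"
      unfolding Re_cinner by (rule Cauchy_Schwarz_ineq2)
    moreover have "\<bar>Im (cinner y v)\<bar> \<le> norm y * norm v"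
      using Cauchy_Schwarz_ineq2[of y "\<i> *\<^sub>C v"] by (simp add: inner_scaleC_ii norm_scaleC)
    ultimately have "cmod (cinner y v) \<le> 2 * (norm y * norm v)"
      using cmod_le[of "cinner y v"] by linarith
    then have "cmod (cinner y v) * norm x \<le> 2 * (norm y * norm v) * norm x"
      by (rule mult_right_mono) simp
    then show ?thesis by (simp add: norm_scaleC ac_simps)
  qed
qed

lift_definition butterfly :: "'a::chilbert \<Rightarrow> 'a \<Rightarrow> 'a bop" is
  "\<lambda>x y. Blinfun (\<lambda>v. cinner y v *\<^sub>C x)"
  subgoal for x y
    using bounded_linear_cinner_scaleC[of y x]
    by (simp add: bounded_linear_Blinfun_apply cinner_scaleC_right scaleC_scaleC)
  done

lemma butterfly_apply: "butterfly x y \<cdot> v = cinner y v *\<^sub>C x"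
  by transfer (simp add: bounded_linear_Blinfun_apply bounded_linear_cinner_scaleC)

definition unitary_map :: "bool \<Rightarrow> ('a::chilbert \<Rightarrow> 'a) \<Rightarrow> bool" where
  "unitary_map antilin V \<longleftrightarrow> surj V \<and>
     (\<forall>x y. V (x + y) = V x + V y) \<and>
     (\<forall>c x. V (c *\<^sub>C x) = (if antilin then cnj c else c) *\<^sub>C V x) \<and>
     (\<forall>x y. cinner (V x) (V y) = (if antilin then cnj (cinner x y) else cinner x y))"

text \<open>
  For a unitary or anti-unitary \<open>V\<close> the adjoint is the inverse, so \<open>Ad_map V\<close> is
  \<open>T \<mapsto> V T V*\<close>; the result is complex-linear in both cases.
\<close>

definition Ad_map :: "('a::chilbert \<Rightarrow> 'a) \<Rightarrow> 'a bop \<Rightarrow> 'a bop" where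
  "Ad_map V T = Abs_bop (Blinfun (\<lambda>v. V (T \<cdot> inv_into UNIV V v)))"

lemma Ad_map_apply:
  assumes "unitary_map antilin V"
  shows "Ad_map V T \<cdot> v = V (T \<cdot> inv_into UNIV V v)"
proof -
  have surj: "surj V" and add: "V (x + y) = V x + V y"
    and scC: "V (c *\<^sub>C x) = (if antilin then cnj c else c) *\<^sub>C V x"
    and inn: "cinner (V x) (V y) = (if antilin then cnj (cinner x y) else cinner x y)" for x y c
    using assms by (auto simp: unitary_map_def)
  have nrm: "norm (V x) = norm x" for x
  proof -
    have "complex_of_real ((norm (V x))\<^sup>2) = of_real ((norm x)\<^sup>2)"
      using inn[of x x] by (simp add: cinner_self split: if_splits)
    then show ?thesis using of_real_eq_iff by (metis norm_ge_zero power2_eq_imp_eq)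
  qed
  have minus: "V (- x) = - V x" for x
    using scC[of "-1" x] scaleR_eq_scaleC[of "-1" x] scaleR_eq_scaleC[of "-1" "V x"]
    by (simp split: if_splits)
  have "inj V"
  proof (rule injI)
    fix x y assume "V x = V y"
    then have "V (x + - y) = 0" by (simp only: add minus) simp
    then show "x = y" using nrm[of "x + - y"] by simp
  qed
  then have inv: "inv_into UNIV V (V x) = x" "V (inv_into UNIV V x) = x" for x
    using surj by (auto simp: surj_f_inv_f)
  have iadd: "inv_into UNIV V (x + y) = inv_into UNIV V x + inv_into UNIV V y" for x y
    by (metis add inv)
  have iscC: "inv_into UNIV V (c *\<^sub>C x) = (if antilin then cnj c else c) *\<^sub>C inv_into UNIV V x" for c x
  proof -
    have "V ((if antilin then cnj c else c) *\<^sub>C inv_into UNIV V x) = c *\<^sub>C x"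
      by (simp add: scC inv(2))
    then show ?thesis using inv(1)[of "(if antilin then cnj c else c) *\<^sub>C inv_into UNIV V x"] by simp
  qed
  have inrm: "norm (inv_into UNIV V x) = norm x" for x using nrm[of "inv_into UNIV V x"] inv by simp
  let ?f = "\<lambda>v. V (T \<cdot> inv_into UNIV V v)"
  have Tadd: "T \<cdot> (x + y) = T \<cdot> x + T \<cdot> y" for x y
    by (rule linear_add[OF bounded_linear.linear[OF bop_bounded_linear]])
  have fC: "?f (c *\<^sub>C x) = c *\<^sub>C ?f x" for c x by (simp add: iscC bop_scaleC scC)
  have "bounded_linear ?f"
  proof (rule bounded_linear_intro[of _ "norm T"])
    show "?f (x + y) = ?f x + ?f y" for x y by (simp add: iadd Tadd add)
    show "?f (r *\<^sub>R x) = r *\<^sub>R ?f x" for r x unfolding scaleR_eq_scaleC by (rule fC)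
    show "norm (?f x) \<le> norm x * norm T" for x
      using norm_bop_apply[of T "inv_into UNIV V x"] by (simp add: nrm inrm mult.commute)
  qed
  then obtain S where S: "bop_apply S = ?f" using bop_exists[of ?f] fC by blast
  then have "Blinfun ?f = Rep_bop S" by (metis blinfun_apply_inverse bop_apply.rep_eq)
  then have "Ad_map V T = S" unfolding Ad_map_def by (simp add: Rep_bop_inverse)
  then show ?thesis using S by simp
qed

section \<open>Operator algebras\<close>

definition star_hom :: "bool \<Rightarrow> 'a::cstar_algebra set \<Rightarrow> ('a \<Rightarrow> 'b::cstar_algebra) \<Rightarrow> bool" where
  "star_hom antilin D f \<longleftrightarrow> f 1 = 1 \<and>
     (\<forall>x\<in>D. \<forall>y\<in>D. f (x + y) = f x + f y \<and> f (x * y) = f x * f y) \<and>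
     (\<forall>x\<in>D. f (x\<^sup>\<dagger>) = (f x)\<^sup>\<dagger>) \<and>
     (\<forall>c. \<forall>x\<in>D. f (c *\<^sub>C x) = (if antilin then cnj c else c) *\<^sub>C f x)"

definition star_iso ::
  "bool \<Rightarrow> 'a::cstar_algebra set \<Rightarrow> 'b::cstar_algebra set \<Rightarrow> ('a \<Rightarrow> 'b) \<Rightarrow> bool" where
  "star_iso antilin D E f \<longleftrightarrow> star_hom antilin D f \<and> bij_betw f D E"

definition cstar_subalgebra :: "'a::cstar_algebra set \<Rightarrow> bool" where
  "cstar_subalgebra B \<longleftrightarrow> closed B \<and> 1 \<in> B \<and>
     (\<forall>x\<in>B. \<forall>y\<in>B. x + y \<in> B \<and> x * y \<in> B) \<and> (\<forall>x\<in>B. x\<^sup>\<dagger> \<in> B) \<and> (\<forall>c. \<forall>x\<in>B. c *\<^sub>C x \<in> B)"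

definition cstar_generated :: "'a::cstar_algebra set \<Rightarrow> 'a set" where
  "cstar_generated S = \<Inter> {B. cstar_subalgebra B \<and> S \<subseteq> B}"

definition state :: "('a::cstar_algebra \<Rightarrow> complex) \<Rightarrow> bool" where
  "state \<phi> \<longleftrightarrow> (\<forall>x y. \<phi> (x + y) = \<phi> x + \<phi> y) \<and> (\<forall>c x. \<phi> (c *\<^sub>C x) = c * \<phi> x) \<and>
     (\<forall>x. \<phi> (x\<^sup>\<dagger> * x) \<in> \<real>\<^sub>\<ge>\<^sub>0) \<and> \<phi> 1 = 1"

definition pure_state :: "('a::cstar_algebra \<Rightarrow> complex) \<Rightarrow> bool" where
  "pure_state \<phi> \<longleftrightarrow> state \<phi> \<and>
     (\<forall>\<phi>\<^sub>1 \<phi>\<^sub>2 t. state \<phi>\<^sub>1 \<and> state \<phi>\<^sub>2 \<and> 0 < t \<and> t < 1 \<and>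
        (\<forall>x. \<phi> x = complex_of_real t * \<phi>\<^sub>1 x + complex_of_real (1 - t) * \<phi>\<^sub>2 x) \<longrightarrow>
        \<phi>\<^sub>1 = \<phi> \<and> \<phi>\<^sub>2 = \<phi>)"

text \<open>
  \<open>(\<pi>, \<Omega>)\<close>, with \<open>\<pi>\<close> a representation on the Hilbert space \<open>'h\<close>, is a GNS triple of the
  restriction of \<open>\<phi>\<close> to the subalgebra \<open>D\<close>.  GNS triples are unique up to unitary equivalence.
\<close>

definition gns ::
  "'a::cstar_algebra set \<Rightarrow> ('a \<Rightarrow> complex) \<Rightarrow> ('a \<Rightarrow> 'h::chilbert bop) \<Rightarrow> 'h \<Rightarrow> bool" where
  "gns D \<phi> \<pi> \<Omega> \<longleftrightarrow> star_hom False D \<pi> \<and> closure ((\<lambda>x. \<pi> x \<cdot> \<Omega>) ` D) = UNIV \<and>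
     (\<forall>x\<in>D. \<phi> x = cinner \<Omega> (\<pi> x \<cdot> \<Omega>))"

definition commutant :: "'h::chilbert bop set \<Rightarrow> 'h bop set" where
  "commutant S = {x. \<forall>y\<in>S. x * y = y * x}"

abbreviation bicommutant :: "'h::chilbert bop set \<Rightarrow> 'h bop set" where
  "bicommutant S \<equiv> commutant (commutant S)"

definition von_neumann_algebra :: "'h::chilbert bop set \<Rightarrow> bool" where
  "von_neumann_algebra M \<longleftrightarrow> (\<forall>x\<in>M. x\<^sup>\<dagger> \<in> M) \<and> bicommutant M = M"

definition projection :: "'h::chilbert bop \<Rightarrow> bool" where
  "projection e \<longleftrightarrow> e\<^sup>\<dagger> = e \<and> e * e = e"

definition type_I :: "'h::chilbert bop set \<Rightarrow> bool" where
  "type_I M \<longleftrightarrow>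
     (\<forall>z \<in> M \<inter> commutant M. projection z \<and> z \<noteq> 0 \<longrightarrow>
        (\<exists>e\<in>M. projection e \<and> e \<noteq> 0 \<and> z * e = e \<and>
           (\<forall>x\<in>M. \<forall>y\<in>M. (e * x * e) * (e * y * e) = (e * y * e) * (e * x * e))))"

text \<open>
  The \<open>\<sigma>\<close>-weak topology is generated by the functionals \<open>T \<mapsto> \<Sum>k. \<langle>\<xi> k, T (\<eta> k)\<rangle>\<close> with
  square-summable \<open>\<xi>\<close> and \<open>\<eta>\<close>.
\<close>

definition sigma_weak_limit :: "(nat \<Rightarrow> 'h::chilbert bop) \<Rightarrow> 'h bop \<Rightarrow> bool" where
  "sigma_weak_limit X T \<longleftrightarrow>
     (\<forall>\<xi> \<eta> :: nat \<Rightarrow> 'h.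
        summable (\<lambda>k. (norm (\<xi> k))\<^sup>2) \<and> summable (\<lambda>k. (norm (\<eta> k))\<^sup>2) \<longrightarrow>
        (\<lambda>N. \<Sum>k. cinner (\<xi> k) (X N \<cdot> \<eta> k)) \<longlonglongrightarrow> (\<Sum>k. cinner (\<xi> k) (T \<cdot> \<eta> k)))"

definition Ad :: "'a::cstar_algebra \<Rightarrow> 'a \<Rightarrow> 'a" where
  "Ad y x = y * x * y\<^sup>\<dagger>"

section \<open>The CAR algebra over \<open>l\<^sup>2(\<int>) \<otimes> \<complex>\<^sup>d\<close>\<close>

text \<open>
  \<open>l\<^sup>2(\<int>) \<otimes> \<complex>\<^sup>d\<close> is the space of square-summable functions from the integers to
  \<open>complex ^ 'd\<close>, with \<open>d = CARD('d)\<close>.  Where Fock space enters, \<open>'d\<close> is linearly ordered and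
  stands for \<open>{1 < ... < d}\<close>.
\<close>

definition l2Z :: "(int \<Rightarrow> complex ^ 'd::finite) set" where
  "l2Z = {f. (\<lambda>x. (norm (f x))\<^sup>2) summable_on UNIV}"

definition l2inner :: "(int \<Rightarrow> complex ^ 'd::finite) \<Rightarrow> (int \<Rightarrow> complex ^ 'd) \<Rightarrow> complex" where
  "l2inner f g = (\<Sum>\<^sub>\<infinity>x. cinner (f x) (g x))"

text \<open>
  The C*-algebra \<open>'a\<close> is the CAR algebra with annihilation operators \<open>a f\<close>; these data
  determine it up to isomorphism.  Values of \<open>a\<close> outside \<open>l2Z\<close> are irrelevant.
\<close>

definition car_algebra :: "((int \<Rightarrow> complex ^ 'd::finite) \<Rightarrow> 'a::cstar_algebra) \<Rightarrow> bool" where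
  "car_algebra a \<longleftrightarrow>
     (\<forall>f\<in>l2Z. \<forall>g\<in>l2Z. a (\<lambda>x. f x + g x) = a f + a g) \<and>
     (\<forall>c. \<forall>f\<in>l2Z. a (\<lambda>x. c *\<^sub>C f x) = cnj c *\<^sub>C a f) \<and>
     (\<forall>f\<in>l2Z. \<forall>g\<in>l2Z. a f * a g + a g * a f = 0) \<and>
     (\<forall>f\<in>l2Z. \<forall>g\<in>l2Z. a f * (a g)\<^sup>\<dagger> + (a g)\<^sup>\<dagger> * a f = l2inner f g *\<^sub>C 1) \<and>
     cstar_generated (a ` l2Z) = UNIV"

definition car_local ::
  "((int \<Rightarrow> complex ^ 'd::finite) \<Rightarrow> 'a::cstar_algebra) \<Rightarrow> int set \<Rightarrow> 'a set" where
  "car_local a X = cstar_generated (a ` {f \<in> l2Z. \<forall>x. x \<notin> X \<longrightarrow> f x = 0})"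

abbreviation car_right :: "((int \<Rightarrow> complex ^ 'd::finite) \<Rightarrow> 'a::cstar_algebra) \<Rightarrow> 'a set" where
  "car_right a \<equiv> car_local a {0..}"

text \<open>
  \<open>\<beta>\<close> is the linear or anti-linear *-automorphism \<open>\<beta>\<^sub>w\<close> with \<open>\<beta>\<^sub>w (a f) = a (w f)\<close>; it is
  uniquely determined because the \<open>a f\<close> generate.
\<close>

definition bogoliubov ::
  "((int \<Rightarrow> complex ^ 'd::finite) \<Rightarrow> 'a::cstar_algebra) \<Rightarrow> bool \<Rightarrow>
    ((int \<Rightarrow> complex ^ 'd) \<Rightarrow> (int \<Rightarrow> complex ^ 'd)) \<Rightarrow> ('a \<Rightarrow> 'a) \<Rightarrow> bool" where
  "bogoliubov a antilin w \<beta> \<longleftrightarrow> star_iso antilin UNIV UNIV \<beta> \<and> (\<forall>f\<in>l2Z. \<beta> (a f) = a (w f))"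

definition shift :: "int \<Rightarrow> (int \<Rightarrow> complex ^ 'd::finite) \<Rightarrow> (int \<Rightarrow> complex ^ 'd)" where
  "shift x f = (\<lambda>y. f (y - x))"

definition sitewise ::
  "(complex ^ 'd::finite \<Rightarrow> complex ^ 'd) \<Rightarrow> (int \<Rightarrow> complex ^ 'd) \<Rightarrow> (int \<Rightarrow> complex ^ 'd)" where
  "sitewise u f = (\<lambda>y. u (f y))"

definition split_state ::
  "((int \<Rightarrow> complex ^ 'd::finite) \<Rightarrow> 'a::cstar_algebra) \<Rightarrow> ('a \<Rightarrow> complex) \<Rightarrow>
    ('a \<Rightarrow> 'h::chilbert bop) \<Rightarrow> 'h \<Rightarrow> bool" where
  "split_state a \<phi> \<pi>\<^sub>R \<Omega>\<^sub>R \<longleftrightarrow>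
     gns (car_right a) \<phi> \<pi>\<^sub>R \<Omega>\<^sub>R \<and> type_I (bicommutant (\<pi>\<^sub>R ` car_right a))"

section \<open>Fock space over \<open>\<complex>\<^sup>d\<close>\<close>

text \<open>
  The Fock space is the space of functions on the power set of the (linearly ordered) index set
  \<open>'d\<close>.  On the unit vectors \<open>axis \<mu> 1\<close> the creation operator of the \<open>i\<close>-th basis vector of
  \<open>\<complex>\<^sup>d\<close> is left exterior multiplication: it sends \<open>axis \<mu> 1\<close> to
  \<open>(-1)^card {k\<in>\<mu>. k < i}\<close> times \<open>axis (insert i \<mu>) 1\<close> if \<open>i \<notin> \<mu>\<close>, and to \<open>0\<close> otherwise.
\<close>

type_synonym 'd fock = "(complex, 'd set) vec"

lemma bounded_linear_fock_create_basis:
  "bounded_linear (\<lambda>v::'d::{finite,linorder} fock.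
     (\<chi> \<mu>. if i \<in> \<mu> then (-1) ^ card {k\<in>\<mu>. k < i} * v $ (\<mu> - {i}) else 0) :: 'd fock)"
  unfolding linear_conv_bounded_linear[symmetric]
  by (rule linearI) (auto simp: vec_eq_iff algebra_simps)

lift_definition fock_create_basis :: "'d::{finite,linorder} \<Rightarrow> 'd fock bop" is
  "\<lambda>i. Blinfun (\<lambda>v. \<chi> \<mu>. if i \<in> \<mu> then (-1) ^ card {k\<in>\<mu>. k < i} * v $ (\<mu> - {i}) else 0)"
  subgoal for i
    using bounded_linear_fock_create_basis[of i]
    by (auto simp: bounded_linear_Blinfun_apply vec_eq_iff scaleC_vec_def scaleC_complex_def)
  done

lemma fock_create_basis_apply:
  "fock_create_basis i \<cdot> v =
     (\<chi> \<mu>. if i \<in> \<mu> then (-1) ^ card {k\<in>\<mu>. k < i} * v $ (\<mu> - {i}) else 0)"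
  by transfer (simp add: bounded_linear_Blinfun_apply bounded_linear_fock_create_basis)

definition fock_create :: "complex ^ 'd::{finite,linorder} \<Rightarrow> 'd fock bop" where
  "fock_create f = (\<Sum>i\<in>UNIV. (f $ i) *\<^sub>C fock_create_basis i)"

definition fock_annihilate :: "complex ^ 'd::{finite,linorder} \<Rightarrow> 'd fock bop" where
  "fock_annihilate f = (fock_create f)\<^sup>\<dagger>"

definition fock_vacuum :: "'d::{finite,linorder} fock" where
  "fock_vacuum = axis {} 1"

text \<open>\<open>fock_word [f\<^sub>1, ..., f\<^sub>l] = a*(f\<^sub>1) ... a*(f\<^sub>l) \<psi>\<^sub>\<emptyset>\<close>.\<close>

definition fock_word :: "(complex ^ 'd::{finite,linorder}) list \<Rightarrow> 'd fock" where
  "fock_word fs = foldr (\<lambda>f v. fock_create f \<cdot> v) fs fock_vacuum"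

definition fock_basis :: "'d::{finite,linorder} set \<Rightarrow> 'd fock" where
  "fock_basis \<mu> = fock_word (map (\<lambda>i. axis i 1) (sorted_list_of_set \<mu>))"

lemma fock_create_axis: "fock_create (axis i 1) = fock_create_basis i"
proof -
  have "fock_create (axis i 1) = (\<Sum>j\<in>UNIV. if j = i then fock_create_basis i else 0)"
    unfolding fock_create_def by (rule sum.cong) (auto simp: axis_def)
  then show ?thesis by simp
qed

lemma fock_basis_eq: "fock_basis \<mu> = axis \<mu> 1"
proof -
  have "foldr (\<lambda>f v. fock_create f \<cdot> v) (map (\<lambda>i. axis i 1) xs) fock_vacuum = axis (set xs) 1"
    if "sorted_wrt (<) xs" for xs :: "'a list"
    using that
  proof (induction xs)
    case (Cons i xs)
    have "{k \<in> insert i (set xs). k < i} = {}" using Cons.prems by auto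
    moreover have "i \<notin> set xs" using Cons.prems by auto
    ultimately have "fock_create_basis i \<cdot> axis (set xs) 1 = axis (insert i (set xs)) 1"
    proof (intro vec_eq_iff[THEN iffD2] allI)
      fix \<mu> :: "'a set"
      assume e: "{k \<in> insert i (set xs). k < i} = {}" and i: "i \<notin> set xs"
      show "(fock_create_basis i \<cdot> axis (set xs) 1) $ \<mu> = axis (insert i (set xs)) 1 $ \<mu>"
      proof (cases "\<mu> = insert i (set xs)")
        case True
        then have "\<mu> - {i} = set xs" "i \<in> \<mu>" using i by auto
        then show ?thesis using e True by (simp only: fock_create_basis_apply vec_lambda_beta) simp
      next
        case False
        then have "i \<in> \<mu> \<Longrightarrow> \<mu> - {i} \<noteq> set xs" by auto
        then show ?thesis using False by (simp add: fock_create_basis_apply axis_def)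
      qed
    qed
    then show ?case using Cons by (simp add: fock_create_axis)
  qed (simp add: fock_vacuum_def)
  then show ?thesis unfolding fock_basis_def fock_word_def by simp
qed

text \<open>
  The second quantization of \<open>u\<close> is the (anti-)linear extension of
  \<open>a*(e\<^sub>i) ... a*(e\<^sub>j) \<psi>\<^sub>\<emptyset> \<mapsto> a*(u e\<^sub>i) ... a*(u e\<^sub>j) \<psi>\<^sub>\<emptyset>\<close>.
\<close>

definition second_quantization ::
  "bool \<Rightarrow> (complex ^ 'd::{finite,linorder} \<Rightarrow> (complex, 'd) vec) \<Rightarrow> 'd fock \<Rightarrow> 'd fock" where
  "second_quantization antilin u v =
     (\<Sum>\<nu>\<in>UNIV. (if antilin then cnj (cinner (fock_basis \<nu>) v) else cinner (fock_basis \<nu>) v) *\<^sub>C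
        fock_word (map (\<lambda>i. u (axis i 1)) (sorted_list_of_set \<nu>)))"

text \<open>
  \<open>E \<mu> \<nu>\<close> corresponds to \<open>|\<psi>\<^sub>\<mu>\<rangle>\<langle>\<psi>\<^sub>\<nu>|\<close> under the *-isomorphism between the bounded operators on
  Fock space and the algebra of the site \<open>0\<close> that matches the annihilation operators.
\<close>

definition site_matrix_units ::
  "((int \<Rightarrow> complex ^ 'd::{finite,linorder}) \<Rightarrow> 'a::cstar_algebra) \<Rightarrow>
    ('d set \<Rightarrow> 'd set \<Rightarrow> 'a) \<Rightarrow> bool" where
  "site_matrix_units a E \<longleftrightarrow>
     (\<exists>j. star_iso False UNIV (car_local a {0}) j \<and>
        (\<forall>v. j (fock_annihilate v) = a (\<lambda>x. if x = 0 then v else 0)) \<and>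
        (\<forall>\<mu> \<nu>. E \<mu> \<nu> = j (butterfly (fock_basis \<mu>) (fock_basis \<nu>))))"

definition parity :: "'d set \<Rightarrow> nat" where
  "parity \<mu> = card \<mu> mod 2"

section \<open>Symmetries and graded dynamical systems\<close>

abbreviation Z2 :: "int monoid" where
  "Z2 \<equiv> integer_mod_group 2"

definition projective_rep ::
  "('g, 'm) monoid_scheme \<Rightarrow> ('g \<Rightarrow> int) \<Rightarrow> ('g \<Rightarrow> 'h::chilbert \<Rightarrow> 'h) \<Rightarrow> bool" where
  "projective_rep G p V \<longleftrightarrow>
     (\<forall>g\<in>carrier G. unitary_map (p g = 1) (V g)) \<and>
     (\<exists>\<upsilon> :: 'g \<Rightarrow> 'g \<Rightarrow> complex.
        (\<forall>g\<in>carrier G. \<forall>h\<in>carrier G. cmod (\<upsilon> g h) = 1 \<and>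
           (\<forall>x. V g (V h x) = \<upsilon> g h *\<^sub>C V (g \<otimes>\<^bsub>G\<^esub> h) x)) \<and>
        (\<forall>g\<in>carrier G. \<upsilon> \<one>\<^bsub>G\<^esub> g = 1 \<and> \<upsilon> g \<one>\<^bsub>G\<^esub> = 1))"

definition state_invariant ::
  "('g, 'm) monoid_scheme \<Rightarrow> ('g \<Rightarrow> int) \<Rightarrow> ('g \<Rightarrow> 'a::cstar_algebra \<Rightarrow> 'a) \<Rightarrow>
    ('a \<Rightarrow> complex) \<Rightarrow> bool" where
  "state_invariant G p \<alpha> \<phi> \<longleftrightarrow>
     (\<forall>g\<in>carrier G. \<forall>x. (if p g = 0 then \<phi> (\<alpha> g x) = \<phi> x else \<phi> (\<alpha> g (x\<^sup>\<dagger>)) = \<phi> x))"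

definition graded_Wstar_system ::
  "('g, 'm) monoid_scheme \<Rightarrow> ('g \<Rightarrow> int) \<Rightarrow> 'h::chilbert bop set \<Rightarrow> ('h bop \<Rightarrow> 'h bop) \<Rightarrow>
    ('g \<Rightarrow> 'h bop \<Rightarrow> 'h bop) \<Rightarrow> bool" where
  "graded_Wstar_system G p M \<theta> \<alpha> \<longleftrightarrow> von_neumann_algebra M \<and>
     star_iso False M M \<theta> \<and> (\<forall>x\<in>M. \<theta> (\<theta> x) = x) \<and>
     (\<forall>g\<in>carrier G. star_iso (p g = 1) M M (\<alpha> g) \<and> (\<forall>x\<in>M. \<alpha> g (\<theta> x) = \<theta> (\<alpha> g x)) \<and>
        (\<forall>h\<in>carrier G. \<forall>x\<in>M. \<alpha> g (\<alpha> h x) = \<alpha> (g \<otimes>\<^bsub>G\<^esub> h) x))"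

definition graded_equivalence ::
  "('g, 'm) monoid_scheme \<Rightarrow> ('h::chilbert bop \<Rightarrow> 'k::chilbert bop) \<Rightarrow>
    'h bop set \<Rightarrow> ('h bop \<Rightarrow> 'h bop) \<Rightarrow> ('g \<Rightarrow> 'h bop \<Rightarrow> 'h bop) \<Rightarrow>
    'k bop set \<Rightarrow> ('k bop \<Rightarrow> 'k bop) \<Rightarrow> ('g \<Rightarrow> 'k bop \<Rightarrow> 'k bop) \<Rightarrow> bool" where
  "graded_equivalence G \<iota> M \<theta> \<alpha> M' \<theta>' \<alpha>' \<longleftrightarrow> star_iso False M M' \<iota> \<and>
     (\<forall>x\<in>M. \<iota> (\<theta> x) = \<theta>' (\<iota> x)) \<and> (\<forall>g\<in>carrier G. \<forall>x\<in>M. \<iota> (\<alpha> g x) = \<alpha>' g (\<iota> x))"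

text \<open>
  \<open>K \<otimes> \<complex>\<^sup>2\<close> is \<open>'k \<times> 'k\<close>, the pair \<open>(x, y)\<close> standing for \<open>x \<otimes> e\<^sub>0 + y \<otimes> e\<^sub>1\<close>, so the algebra
  \<open>B(K) \<otimes> M\<^sub>2\<close> consists of all bounded operators on \<open>'k \<times> 'k\<close> and \<open>grading\<close> is \<open>1 \<otimes> \<sigma>\<^sub>z\<close>.
\<close>

lemma bounded_linear_grading:
  "bounded_linear (\<lambda>(x, y). (x, - y) :: 'k::chilbert \<times> 'k)"
  unfolding case_prod_beta
  by (intro bounded_linear_Pair bounded_linear_fst bounded_linear_minus bounded_linear_snd)

lift_definition grading :: "('k::chilbert \<times> 'k) bop" is "Blinfun (\<lambda>(x, y). (x, - y))"
  by (simp add: bounded_linear_Blinfun_apply[OF bounded_linear_grading] scaleC_prod_def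
      scaleC_minus_right case_prod_beta)

lemma grading_apply: "grading \<cdot> (x, y) = (x, - y)"
  by transfer (simp add: bounded_linear_Blinfun_apply[OF bounded_linear_grading])

text \<open>\<open>(B(K \<otimes> \<complex>\<^sup>2), Ad_\<Gamma>, Ad_{V_g})\<close> belongs to the class \<open>S\<^sub>0\<close>.\<close>

definition S0_rep ::
  "('g, 'm) monoid_scheme \<Rightarrow> ('g \<Rightarrow> int) \<Rightarrow> ('g \<Rightarrow> 'k::chilbert \<times> 'k \<Rightarrow> 'k \<times> 'k) \<Rightarrow> bool" where
  "S0_rep G p V \<longleftrightarrow> projective_rep G p V \<and>
     (\<exists>q\<in>hom G Z2. \<forall>g\<in>carrier G. Ad_map (V g) grading = (-1) ^ nat (q g) * grading)"

end

theory Submission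
  imports Defs
begin

text \<open>
  Transported by \<open>\<iota>\<close>, the half-line algebra acts irreducibly on \<open>K \<otimes> \<complex>\<^sup>2\<close>, and the endomorphism \<open>\<rho>\<close>
  commutes with the matrix units \<open>e \<mu> \<nu>\<close> of the site \<open>0\<close> once these are twisted by powers of the grading.
  Hence \<open>y \<mapsto> \<rho> y * e {} {}\<close> is, by irreducibility, unitarily equivalent to the identity representation;
  an intertwiner \<open>B\<^sub>0\<close> is \<open>v \<mapsto> \<rho> (|v\<rangle>\<langle>\<xi>|) \<eta>\<close> for a unit vector \<open>\<eta>\<close> in the range of
  \<open>\<rho> (|\<xi>\<rangle>\<langle>\<xi>|) * e {} {}\<close>, and \<open>B \<mu> = e \<mu> {} * B\<^sub>0\<close>.  Parity and covariance of the \<open>B \<mu>\<close> follow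
  because two isometries that intertwine the irreducible algebra in the same way and have the same range
  projection differ by a phase.

  The iterates \<open>T\<^sup>N y\<close> commute with more and more of the local algebra, so their weak operator cluster
  points are scalars.  The state \<open>\<langle>\<Omega>, \<iota>\<^sup>-\<^sup>1(\<cdot>) \<Omega>\<rangle>\<close> is normal and invariant under \<open>T\<close>, which identifies
  the scalar.
\<close>

section \<open>Hilbert space preliminaries\<close>

text \<open>Two obstacles shape the proof. Odd elements of different sites anticommute, so the
  algebra of the site 0 does not commute with the range of \<rho>. Conjugation by the grading is the
  parity, hence multiplying an odd matrix unit by the grading turns anticommutation into
  commutation; the signs of the final formulas record these factors. Moreover
  \<open>star_iso\<close> is a purely algebraic notion, so identities on the C*-algebra cannot
  simply be extended to weak closures by continuity. Algebra replaces continuity: purity makes the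
  weak closure of the whole representation equal to all bounded operators, so
  \<open>\<tau>\<omega>\<close> is an automorphism of these and carries commutants to commutants and
  minimal projections to minimal projections. Normality of the vector state composed with the
  inverse of \<iota> comes from exhibiting that inverse as a multiple of the identity
  representation. Invariance of the state under T is again a parity matter: T and \<rho> agree on
  even elements, and the state vanishes on odd ones.\<close>

lemmas bop_simps = alg_bop_apply real_bop_apply scaleC_bop_apply

lemma bop_add_right: "T \<cdot> (v + w) = T \<cdot> v + T \<cdot> w"
  by (rule linear_add[OF bounded_linear.linear[OF bop_bounded_linear]])

lemma bop_diff_right: "T \<cdot> (v - w) = T \<cdot> v - T \<cdot> w"
  by (rule linear_diff[OF bounded_linear.linear[OF bop_bounded_linear]])

lemma bop_zero_right [simp]: "T \<cdot> 0 = 0"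
  by (rule linear_0[OF bounded_linear.linear[OF bop_bounded_linear]])

lemma bop_sum_right: "T \<cdot> (\<Sum>i\<in>I. f i) = (\<Sum>i\<in>I. T \<cdot> f i)"
  by (rule linear_sum[OF bounded_linear.linear[OF bop_bounded_linear]])

lemma bop_sum_left: "(\<Sum>i\<in>I. T i) \<cdot> v = (\<Sum>i\<in>I. T i \<cdot> v)"
  by (induction I rule: infinite_finite_induct) (simp_all add: real_bop_apply)

lemma scaleC_minus_left: "(- c) *\<^sub>C (x::'a::cvector) = - (c *\<^sub>C x)"
  using scaleC_add_left[of c "-c" x] by (simp add: eq_neg_iff_add_eq_0 add.commute)

lemma scaleC_diff_left: "(b - c) *\<^sub>C (x::'a::cvector) = b *\<^sub>C x - c *\<^sub>C x"
  using scaleC_add_left[of b "-c" x] by (simp add: scaleC_minus_left)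

lemma scaleC_sum_right: "c *\<^sub>C (\<Sum>i\<in>I. f i) = (\<Sum>i\<in>I. c *\<^sub>C (f i :: 'a::cvector))"
  by (induction I rule: infinite_finite_induct) (simp_all add: scaleC_add_right)

lemma scaleC_sum_left: "(\<Sum>i\<in>I. f i) *\<^sub>C x = (\<Sum>i\<in>I. f i *\<^sub>C (x :: 'a::cvector))"
  by (induction I rule: infinite_finite_induct) (simp_all add: scaleC_add_left)

lemma scaleC_eq_0_iff: "c *\<^sub>C (x::'a::cvector) = 0 \<longleftrightarrow> c = 0 \<or> x = 0"
proof (cases "c = 0")
  case False
  then have "inverse c *\<^sub>C c *\<^sub>C x = x" by (simp add: scaleC_scaleC)
  then show ?thesis using False by (metis scaleC_zero_right)
qed simp

lemma minus_one_power_scaleC: "(-1) ^ n * (x::'a::cstar_algebra) = ((-1) ^ n) *\<^sub>C x"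
  by (cases "even n") (simp_all add: scaleC_minus_left)

lemma cinner_zero_left [simp]: "cinner 0 (x::'a::chilbert) = 0"
  using cinner_scaleC_left[of 0 x x] by simp

lemma cinner_zero_right [simp]: "cinner (x::'a::chilbert) 0 = 0"
  using cinner_scaleC_right[of x 0 x] by simp

lemma cinner_minus_right: "cinner x (- y) = - cinner x (y::'a::chilbert)"
  using cinner_add_right[of x y "-y"] by (simp add: eq_neg_iff_add_eq_0 add.commute)

lemma cinner_minus_left: "cinner (- x) y = - cinner x (y::'a::chilbert)"
  using cinner_add_left[of x "-x" y] by (simp add: eq_neg_iff_add_eq_0 add.commute)

lemma cinner_diff_right: "cinner x (y - z) = cinner x y - cinner x (z::'a::chilbert)"
  using cinner_add_right[of x y "-z"] by (simp add: cinner_minus_right)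

lemma cinner_diff_left: "cinner (x - y) z = cinner x z - cinner y (z::'a::chilbert)"
  using cinner_add_left[of x "-y" z] by (simp add: cinner_minus_left)

lemma cinner_sum_right: "cinner x (\<Sum>i\<in>I. f i) = (\<Sum>i\<in>I. cinner x (f i :: 'a::chilbert))"
  by (induction I rule: infinite_finite_induct) (simp_all add: cinner_add_right)

lemma cinner_sum_left: "cinner (\<Sum>i\<in>I. f i) x = (\<Sum>i\<in>I. cinner (f i) (x :: 'a::chilbert))"
  by (induction I rule: infinite_finite_induct) (simp_all add: cinner_add_left)

lemmas cinner_simps = cinner_add_left cinner_add_right cinner_diff_left cinner_diff_right
  cinner_minus_left cinner_minus_right cinner_scaleC_left cinner_scaleC_right

lemma cinner_eq_zero_iff [simp]: "cinner x x = 0 \<longleftrightarrow> x = (0::'a::chilbert)"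
  by (simp add: cinner_self)

lemma norm_sq_cinner: "(norm x)\<^sup>2 = Re (cinner x (x::'a::chilbert))"
  by (simp add: cinner_self)

lemma cinner_cauchy_schwarz: "cmod (cinner x y) \<le> norm x * norm (y::'a::chilbert)"
proof (cases "cinner x y = 0")
  case False
  define u where "u = cnj (cinner x y) / cmod (cinner x y)"
  have u: "cmod u = 1" using False by (simp add: u_def norm_divide)
  have "cinner x (u *\<^sub>C y) = complex_of_real (cmod (cinner x y))"
    unfolding u_def cinner_scaleC_right using False
    by (simp add: mult.commute complex_norm_square[symmetric] power2_eq_square)
  then have "cmod (cinner x y) = inner x (u *\<^sub>C y)"
    by (metis Re_cinner Re_complex_of_real)
  also have "\<dots> \<le> norm x * norm (u *\<^sub>C y)" by (rule norm_cauchy_schwarz)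
  finally show ?thesis by (simp add: norm_scaleC u)
qed simp

lemma cinner_dense_zero:
  assumes "closure D = UNIV" "\<And>y. y \<in> D \<Longrightarrow> cinner y (x::'a::chilbert) = 0"
  shows "x = 0"
proof -
  have "closed {y. inner y x = 0}"
    by (intro closed_Collect_eq continuous_intros)
  moreover have "D \<subseteq> {y. inner y x = 0}"
    using assms(2) by (auto simp flip: Re_cinner)
  ultimately have "closure D \<subseteq> {y. inner y x = 0}" by (rule closure_minimal[rotated])
  then have "inner x x = 0" using assms(1) by blast
  then show ?thesis by simp
qed

lemma star_zero [simp]: "(0::'a::cstar_algebra)\<^sup>\<dagger> = 0"
  using star_add[of "0::'a" 0] by simp

lemma star_minus: "(- x)\<^sup>\<dagger> = - (x::'a::cstar_algebra)\<^sup>\<dagger>"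
  using star_add[of x "-x"] by (simp add: eq_neg_iff_add_eq_0 add.commute)

lemma star_diff: "(x - y)\<^sup>\<dagger> = x\<^sup>\<dagger> - (y::'a::cstar_algebra)\<^sup>\<dagger>"
  using star_add[of x "-y"] by (simp add: star_minus)

lemma star_one [simp]: "(1::'a::cstar_algebra)\<^sup>\<dagger> = 1"
  by (metis mult.left_neutral mult.right_neutral star_mult star_star)

lemma star_sum: "(\<Sum>i\<in>I. f i)\<^sup>\<dagger> = (\<Sum>i\<in>I. (f i :: 'a::cstar_algebra)\<^sup>\<dagger>)"
  by (induction I rule: infinite_finite_induct) (simp_all add: star_add)

lemma star_power: "(x ^ n)\<^sup>\<dagger> = (x\<^sup>\<dagger>) ^ n" for x :: "'a::cstar_algebra"
  by (induction n) (simp_all add: star_mult power_commutes)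

lemma star_scaleR: "(r *\<^sub>R x)\<^sup>\<dagger> = r *\<^sub>R (x\<^sup>\<dagger> :: 'a::cstar_algebra)"
  by (simp add: scaleR_eq_scaleC star_scaleC)

lemma norm_star: "norm (x\<^sup>\<dagger>) = norm (x::'a::cstar_algebra)"
proof -
  have le: "norm x \<le> norm (x\<^sup>\<dagger>)" for x :: 'a
  proof (cases "x = 0")
    case False
    have "norm x * norm x \<le> norm (x\<^sup>\<dagger>) * norm x"
      using cstar_identity[of x] norm_mult_ineq[of "x\<^sup>\<dagger>" x] by (simp add: power2_eq_square)
    then show ?thesis using False by (simp add: mult_le_cancel_right)
  qed simp
  show ?thesis using le[of x] le[of "x\<^sup>\<dagger>"] by (simp add: star_star)
qed

lemma bounded_linear_star: "bounded_linear (star :: 'a::cstar_algebra \<Rightarrow> 'a)"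
  by (rule bounded_linear_intro[of _ 1]) (simp_all add: star_add star_scaleR norm_star)

lemma cstar_norm_scaleC: "norm (c *\<^sub>C x) = cmod c * norm (x::'a::cstar_algebra)"
proof -
  have "(c *\<^sub>C x)\<^sup>\<dagger> * (c *\<^sub>C x) = (cmod c)\<^sup>2 *\<^sub>R (x\<^sup>\<dagger> * x)"
    by (simp add: star_scaleC scaleC_mult_left scaleC_mult_right scaleC_scaleC scaleR_eq_scaleC
        complex_norm_square mult.commute del: of_real_power)
  then have "(norm (c *\<^sub>C x))\<^sup>2 = (cmod c * norm x)\<^sup>2"
    by (simp add: cstar_identity[symmetric] power_mult_distrib)
  then show ?thesis by simp
qed

lemma mult_butterfly: "T * butterfly x y = butterfly (T \<cdot> x) y"
  by (rule bop_eqI) (simp add: bop_simps butterfly_apply bop_scaleC)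

lemma butterfly_mult: "butterfly x y * T = butterfly x (T\<^sup>\<dagger> \<cdot> y)"
  by (rule bop_eqI) (simp add: bop_simps butterfly_apply cinner_star_left)

lemma star_butterfly: "(butterfly x y)\<^sup>\<dagger> = butterfly y x"
  by (rule bop_cinner_eqI)
    (simp add: cinner_star_right butterfly_apply cinner_simps cinner_commute[of y])

lemma butterfly_butterfly: "butterfly x y * butterfly z w = cinner y z *\<^sub>C butterfly x w"
  by (rule bop_eqI) (simp add: bop_simps butterfly_apply bop_scaleC scaleC_scaleC mult.commute cinner_simps)

lemma butterfly_add_left: "butterfly (x + x') y = butterfly x y + butterfly x' y"
  by (rule bop_eqI) (simp add: bop_simps butterfly_apply scaleC_add_right)

lemma butterfly_scaleC_left: "butterfly (c *\<^sub>C x) y = c *\<^sub>C butterfly x y"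
  by (rule bop_eqI) (simp add: bop_simps butterfly_apply scaleC_scaleC mult.commute)

lemma butterfly_scaleC_right: "butterfly x (c *\<^sub>C y) = cnj c *\<^sub>C butterfly x y"
  by (rule bop_eqI) (simp add: bop_simps butterfly_apply scaleC_scaleC mult.commute cinner_simps)

lemma exists_unit_vector: obtains \<xi> :: "'a::chilbert" where "cinner \<xi> \<xi> = 1"
proof -
  obtain \<xi> :: 'a where "\<xi> \<noteq> 0" using chilbert_nontrivial by blast
  then have "cinner (complex_of_real (1 / norm \<xi>) *\<^sub>C \<xi>) (complex_of_real (1 / norm \<xi>) *\<^sub>C \<xi>) = 1"
    by (simp add: cinner_self norm_scaleC norm_divide)
  then show ?thesis by (rule that)
qed

lemma butterfly_unit_nonzero: "cinner \<xi> \<xi> = 1 \<Longrightarrow> butterfly \<xi> \<xi> \<noteq> 0"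
  by (metis butterfly_apply cinner_zero_left real_bop_apply(1) scaleC_one zero_neq_one)

section \<open>Orthogonal projections onto closed complex subspaces\<close>

text \<open>Midpoints stay in \<open>N\<close>, so by the parallelogram law two near-minimizers of
  the distance are close to each other, and a minimizing sequence is Cauchy.\<close>

lemma nearest_point_exists:
  fixes N :: "'a::chilbert set"
  assumes ne: "N \<noteq> {}" and cl: "closed N"
    and add: "\<And>x y. x \<in> N \<Longrightarrow> y \<in> N \<Longrightarrow> x + y \<in> N"
    and sc: "\<And>c x. x \<in> N \<Longrightarrow> c *\<^sub>C x \<in> N"
  obtains z where "z \<in> N" "\<And>y. y \<in> N \<Longrightarrow> norm (v - z) \<le> norm (v - y)"
proof -
  define J where "J x = (norm (v - x))\<^sup>2" for x
  define m where "m = Inf (J ` N)"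
  have bdd: "bdd_below (J ` N)" by (rule bdd_belowI[of _ 0]) (auto simp: J_def)
  have mle: "m \<le> J x" if "x \<in> N" for x
    unfolding m_def using that by (intro cInf_lower bdd) auto
  have "\<exists>x\<in>N. J x < m + 1 / Suc n" for n
    using cInf_lessD[of "J ` N" "m + 1 / Suc n"] ne unfolding m_def by auto
  then obtain X where X: "\<And>n. X n \<in> N" "\<And>n. J (X n) < m + 1 / Suc n" by metis
  have par: "(norm (x - y))\<^sup>2 \<le> 2 * (J x - m) + 2 * (J y - m)" if "x \<in> N" "y \<in> N" for x y
  proof -
    have mid: "(1/2) *\<^sub>R (x + y) \<in> N" using that by (simp add: scaleR_eq_scaleC add sc)
    have "(norm ((v - x) + (v - y)))\<^sup>2 + (norm ((v - x) - (v - y)))\<^sup>2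
        = 2 * (norm (v - x))\<^sup>2 + 2 * (norm (v - y))\<^sup>2"
      unfolding power2_norm_eq_inner
      by (simp add: inner_add_left inner_add_right inner_diff_left inner_diff_right algebra_simps)
    moreover have "(v - x) + (v - y) = 2 *\<^sub>R (v - (1/2) *\<^sub>R (x + y))"
      by (simp add: scaleR_2 algebra_simps)
    moreover have "norm ((v - x) - (v - y)) = norm (x - y)" by (simp add: norm_minus_commute)
    ultimately have "4 * J ((1/2) *\<^sub>R (x + y)) + (norm (x - y))\<^sup>2 = 2 * J x + 2 * J y"
      unfolding J_def by (simp only: norm_scaleR power_mult_distrib) simp
    then show ?thesis using mle[OF mid] by argo
  qed
  have "Cauchy X"
  proof (rule metric_CauchyI)
    fix e :: real assume e: "0 < e"
    obtain K where K: "4 / e\<^sup>2 < real (Suc K)" using reals_Archimedean2 less_trans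
      by (metis lessI of_nat_less_iff)
    show "\<exists>M. \<forall>m\<ge>M. \<forall>n\<ge>M. dist (X m) (X n) < e"
    proof (intro exI allI impI)
      fix k n assume kn: "k \<ge> K" "n \<ge> K"
      have b: "J (X i) - m < 1 / real (Suc K)" if "i \<ge> K" for i
      proof -
        have "1 / real (Suc i) \<le> 1 / real (Suc K)" using that by (simp add: frac_le)
        then show ?thesis using X(2)[of i] by linarith
      qed
      have "(norm (X k - X n))\<^sup>2 < 4 * (1 / real (Suc K))"
        using par[OF X(1) X(1), of k n] b[OF kn(1)] b[OF kn(2)] by argo
      also have "\<dots> < e\<^sup>2" using K e by (simp add: field_simps)
      finally show "dist (X k) (X n) < e" using e by (simp add: dist_norm power_less_imp_less_base)
    qed
  qed
  then obtain z where z: "X \<longlonglongrightarrow> z" using Cauchy_convergent convergent_def by metis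
  have zN: "z \<in> N" using closed_sequentially[OF cl] X(1) z by blast
  have "(\<lambda>n. J (X n)) \<longlonglongrightarrow> J z" unfolding J_def by (intro tendsto_intros z)
  moreover have "(\<lambda>n. m + 1 / real (Suc n)) \<longlonglongrightarrow> m + 0"
    by (intro tendsto_intros LIMSEQ_Suc[OF lim_1_over_n])
  ultimately have "J z \<le> m" using X(2) LIMSEQ_le[of "\<lambda>n. J (X n)" "J z" "\<lambda>n. m + 1 / real (Suc n)" m]
    by (metis add.right_neutral less_imp_le)
  then have "norm (v - z) \<le> norm (v - y)" if "y \<in> N" for y
    using mle[OF that] unfolding J_def by (meson norm_ge_zero order_trans power2_le_imp_le)
  then show ?thesis using zN that by blast
qed

text \<open>Moving \<open>z\<close> by the component of \<open>v - z\<close> along \<open>y\<close>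
  would lower the squared distance by the squared modulus of \<open>cinner y (v - z)\<close> over
  \<open>(norm y)\<^sup>2\<close>, so minimality makes this inner product vanish.\<close>

lemma nearest_point_orthogonal:
  fixes N :: "'a::chilbert set"
  assumes add: "\<And>x y. x \<in> N \<Longrightarrow> y \<in> N \<Longrightarrow> x + y \<in> N"
    and sc: "\<And>c x. x \<in> N \<Longrightarrow> c *\<^sub>C x \<in> N"
    and z: "z \<in> N" "\<And>y. y \<in> N \<Longrightarrow> norm (v - z) \<le> norm (v - y)" and y: "y \<in> N"
  shows "cinner y (v - z) = 0"
proof (cases "y = 0")
  case False
  define c where "c = cinner y (v - z) / (norm y)\<^sup>2"
  have "norm (v - z) \<le> norm (v - (z + c *\<^sub>C y))" using z(1) y by (intro z(2) add sc)
  then have "(norm (v - z))\<^sup>2 \<le> (norm ((v - z) - c *\<^sub>C y))\<^sup>2" by (simp add: diff_diff_eq)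
  also have "\<dots> = (norm (v - z))\<^sup>2 - Re (cnj c * cinner y (v - z))"
  proof -
    have cy: "c * cinner y y = cinner y (v - z)" using False by (simp add: c_def cinner_self)
    have "cinner ((v - z) - c *\<^sub>C y) ((v - z) - c *\<^sub>C y) =
      cinner (v - z) (v - z) - cnj c * cinner y (v - z) - c * cinner (v - z) y + cnj c * (c * cinner y y)"
      unfolding cinner_diff_left[of "v - z"] cinner_diff_right[of _ "v - z"] cinner_scaleC_left cinner_scaleC_right
      by (simp add: algebra_simps)
    also have "\<dots> = cinner (v - z) (v - z) - c * cinner (v - z) y" unfolding cy by simp
    also have "c * cinner (v - z) y = cnj (cnj c * cinner y (v - z))"
      by (simp add: cinner_commute[of "v - z"])
    finally show ?thesis unfolding norm_sq_cinner by simp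
  qed
  finally have "Re (cnj c * cinner y (v - z)) \<le> 0" by simp
  moreover have "cnj c * cinner y (v - z) = of_real ((cmod (cinner y (v - z)))\<^sup>2 / (norm y)\<^sup>2)"
    unfolding c_def of_real_divide complex_norm_square by (simp add: mult.commute)
  ultimately have "(cmod (cinner y (v - z)))\<^sup>2 / (norm y)\<^sup>2 \<le> 0" by (metis Re_complex_of_real)
  then show ?thesis using False by (simp add: divide_le_0_iff)
qed simp

text \<open>A point of \<open>N\<close> whose residual is orthogonal to \<open>N\<close> is unique,
  and this uniqueness makes the choice of nearest points linear.\<close>

lemma projection_exists:
  fixes N :: "'a::chilbert set"
  assumes ne: "N \<noteq> {}" and cl: "closed N"
    and add: "\<And>x y. x \<in> N \<Longrightarrow> y \<in> N \<Longrightarrow> x + y \<in> N"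
    and sc: "\<And>c x. x \<in> N \<Longrightarrow> c *\<^sub>C x \<in> N"
  obtains z :: "'a bop" where "\<And>v. z \<cdot> v \<in> N" "\<And>v y. y \<in> N \<Longrightarrow> cinner y (v - z \<cdot> v) = 0"
proof -
  have "\<exists>z. z \<in> N \<and> (\<forall>y\<in>N. cinner y (v - z) = 0)" for v
  proof -
    obtain z where z: "z \<in> N" "\<And>y. y \<in> N \<Longrightarrow> norm (v - z) \<le> norm (v - y)"
      using nearest_point_exists[of N v] assms by blast
    then show ?thesis using nearest_point_orthogonal[of N z v] add sc by blast
  qed
  then obtain Z where Z: "\<And>v. Z v \<in> N" "\<And>v y. y \<in> N \<Longrightarrow> cinner y (v - Z v) = 0" by metis
  have diff: "x - y \<in> N" if "x \<in> N" "y \<in> N" for x y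
    using add[OF that(1) sc[OF that(2), of "-1"]] by (simp add: scaleC_minus_left)
  have uniq: "Z v = w" if "w \<in> N" "\<And>y. y \<in> N \<Longrightarrow> cinner y (v - w) = 0" for v w
  proof -
    have d: "Z v - w \<in> N" using Z(1) that(1) by (rule diff)
    have "cinner (Z v - w) (Z v - w) = cinner (Z v - w) (v - w) - cinner (Z v - w) (v - Z v)"
      by (simp add: cinner_diff_right)
    then show ?thesis using d that(2) Z(2) by simp
  qed
  have Zadd: "Z (v + w) = Z v + Z w" for v w
  proof (rule uniq)
    fix y assume "y \<in> N"
    then have "cinner y (v - Z v) + cinner y (w - Z w) = 0" using Z(2) by simp
    then show "cinner y (v + w - (Z v + Z w)) = 0"
      by (simp add: cinner_simps algebra_simps)
  qed (use Z add in auto)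
  have Zsc: "Z (c *\<^sub>C v) = c *\<^sub>C Z v" for c v
  proof (rule uniq)
    fix y assume "y \<in> N"
    then have "cinner y (c *\<^sub>C (v - Z v)) = 0" using Z(2) by (simp add: cinner_scaleC_right)
    then show "cinner y (c *\<^sub>C v - c *\<^sub>C Z v) = 0" by (simp add: scaleC_diff_right)
  qed (use Z sc in auto)
  have "norm (Z v) \<le> norm v * 1" for v
  proof -
    have "(norm (Z v))\<^sup>2 = Re (cinner (Z v) v)"
      using Z(2)[OF Z(1), of v v] by (simp add: norm_sq_cinner cinner_diff_right)
    also have "\<dots> \<le> norm (Z v) * norm v"
      using complex_Re_le_cmod cinner_cauchy_schwarz order_trans by blast
    finally show ?thesis by (cases "Z v = 0") (auto simp: power2_eq_square)
  qed
  then have "bounded_linear Z"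
    using Zadd Zsc by (intro bounded_linear_intro[of Z 1]) (auto simp: scaleR_eq_scaleC)
  then obtain z where "bop_apply z = Z" using bop_exists[of Z] Zsc by blast
  then show ?thesis using that[of z] Z by simp
qed

section \<open>Representations of C*-algebras\<close>

lemma bop_eq_on_dense:
  assumes "closure D = UNIV" "\<And>v. v \<in> D \<Longrightarrow> S \<cdot> v = T \<cdot> v"
  shows "S = T"
proof (rule bop_eqI)
  fix v
  have "closed {v. S \<cdot> v = T \<cdot> v}"
    by (intro closed_Collect_eq linear_continuous_on bop_bounded_linear)
  then have "closure D \<subseteq> {v. S \<cdot> v = T \<cdot> v}"
    using assms(2) by (intro closure_minimal) auto
  then show "S \<cdot> v = T \<cdot> v" using assms(1) by blast
qed

lemma cstar_subalgebra_UNIV [simp]: "cstar_subalgebra UNIV"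
  by (simp add: cstar_subalgebra_def)

lemma cstar_subalgebra_diff:
  assumes "cstar_subalgebra D" "x \<in> D" "y \<in> D"
  shows "x - y \<in> D"
proof -
  have "x + (-1) *\<^sub>C y \<in> D" using assms by (simp add: cstar_subalgebra_def)
  then show ?thesis by (simp add: scaleC_minus_left)
qed

lemma cstar_subalgebra_sum:
  assumes "cstar_subalgebra D" "\<And>i. i \<in> I \<Longrightarrow> f i \<in> D"
  shows "(\<Sum>i\<in>I. f i) \<in> D"
  using assms(2)
proof (induction I rule: infinite_finite_induct)
  case (insert i I)
  then show ?case using assms(1) by (simp add: cstar_subalgebra_def)
qed (use cstar_subalgebra_diff[OF assms(1), of 1 1] assms(1) in \<open>auto simp: cstar_subalgebra_def\<close>)

lemma cstar_subalgebra_power: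
  assumes "cstar_subalgebra D" "x \<in> D"
  shows "x ^ n \<in> D"
  using assms by (induction n) (auto simp: cstar_subalgebra_def)

lemma cstar_subalgebra_commutant:
  assumes "\<And>y. y \<in> S \<Longrightarrow> y\<^sup>\<dagger> \<in> S"
  shows "cstar_subalgebra (commutant S)"
proof -
  have "commutant S = (\<Inter>y\<in>S. {x. x * y = y * x})" by (auto simp: commutant_def)
  moreover have "closed {x. x * y = y * x}" for y :: "'a bop"
    by (intro closed_Collect_eq continuous_intros)
  ultimately have "closed (commutant S)" by auto
  moreover have "x\<^sup>\<dagger> \<in> commutant S" if "x \<in> commutant S" for x
    unfolding commutant_def
  proof (clarify)
    fix y assume "y \<in> S"
    then have "(x * y\<^sup>\<dagger>)\<^sup>\<dagger> = (y\<^sup>\<dagger> * x)\<^sup>\<dagger>" using that assms by (auto simp: commutant_def)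
    then show "x\<^sup>\<dagger> * y = y * x\<^sup>\<dagger>" by (simp add: star_mult star_star)
  qed
  moreover have "x * y \<in> commutant S" if "x \<in> commutant S" "y \<in> commutant S" for x y
    using that unfolding commutant_def by (auto simp: mult.assoc) (metis mult.assoc)
  ultimately show ?thesis
    unfolding cstar_subalgebra_def
    by (auto simp: commutant_def distrib_left distrib_right scaleC_mult_left scaleC_mult_right)
qed

lemma cstar_subalgebra_generated: "cstar_subalgebra (cstar_generated S)"
  unfolding cstar_generated_def cstar_subalgebra_def[of "\<Inter> _"]
  by (intro conjI closed_Inter) (auto simp: cstar_subalgebra_def)

lemma cstar_generated_incl: "x \<in> S \<Longrightarrow> x \<in> cstar_generated S"
  by (auto simp: cstar_generated_def)

lemma cstar_generated_minimal: "cstar_subalgebra D \<Longrightarrow> S \<subseteq> D \<Longrightarrow> cstar_generated S \<subseteq> D"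
  by (auto simp: cstar_generated_def)

section \<open>Square roots, and the continuity of star homomorphisms\<close>

text \<open>The root is the binomial series with exponent 1/2 in \<open>- h\<close>. Vandermonde's
  identity turns its Cauchy square into the binomial series with exponent 1, which stops after the
  linear term.\<close>

lemma cstar_sqrt_one_minus:
  fixes h :: "'a::cstar_algebra"
  assumes D: "cstar_subalgebra D" "h \<in> D" and h: "h\<^sup>\<dagger> = h" "norm h < 1"
  obtains s where "s \<in> D" "s\<^sup>\<dagger> = s" "s * s = 1 - h"
proof -
  define c :: "nat \<Rightarrow> real" where "c k = ((1/2) gchoose k)" for k
  define f where "f k = c k *\<^sub>R (- h) ^ k" for k
  have "summable (\<lambda>k. norm (c k * norm h ^ k))"
    using h(2) by (intro abs_summable_in_conv_radius) (auto simp: c_def[abs_def] conv_radius_gchoose Nats_def)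
  then have sn: "summable (\<lambda>k. norm (f k))"
  proof (rule summable_comparison_test')
    fix k show "norm (norm (f k)) \<le> norm (c k * norm h ^ k)"
      by (auto simp: f_def abs_mult intro!: mult_left_mono norm_power_ineq[THEN order_trans])
  qed
  define s where "s = suminf f"
  have fs: "f sums s" using summable_norm_cancel[OF sn] by (simp add: s_def summable_sums)
  have fD: "f k \<in> D" for k
    using D cstar_subalgebra_power[OF D(1), of "-h"] cstar_subalgebra_diff[OF D(1), of "h - h" h]
      cstar_subalgebra_diff[OF D(1), of "h" h]
    by (auto simp: f_def cstar_subalgebra_def scaleR_eq_scaleC)
  have sD: "s \<in> D"
  proof (rule closed_sequentially)
    show "closed D" using D by (simp add: cstar_subalgebra_def)
    show "(\<lambda>n. \<Sum>k<n. f k) \<longlonglongrightarrow> s" using fs by (simp add: sums_def)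
  qed (auto intro: cstar_subalgebra_sum[OF D(1)] fD)
  have "(\<lambda>k. (f k)\<^sup>\<dagger>) sums s\<^sup>\<dagger>" by (rule bounded_linear.sums[OF bounded_linear_star fs])
  moreover have "(f k)\<^sup>\<dagger> = f k" for k by (simp add: f_def star_scaleR star_power star_minus h)
  ultimately have ss: "s\<^sup>\<dagger> = s" using fs sums_unique2 by fastforce
  have "(\<lambda>n. \<Sum>i\<le>n. f i * f (n - i)) sums (s * s)"
    unfolding s_def by (rule Cauchy_product_sums[OF sn sn])
  moreover have "(\<Sum>i\<le>n. f i * f (n - i)) = (1 gchoose n :: real) *\<^sub>R (- h) ^ n" for n
  proof -
    have "(\<Sum>i\<le>n. f i * f (n - i)) = (\<Sum>i\<le>n. (c i * c (n - i)) *\<^sub>R (- h) ^ n)"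
      by (rule sum.cong) (auto simp: f_def power_add[symmetric])
    also have "\<dots> = (\<Sum>i=0..n. c i * c (n - i)) *\<^sub>R (- h) ^ n"
      by (simp add: scaleR_sum_left atLeast0AtMost)
    also have "(\<Sum>i=0..n. c i * c (n - i)) = (1/2 + 1/2) gchoose n"
      unfolding c_def by (rule gbinomial_Vandermonde)
    finally show ?thesis by simp
  qed
  ultimately have "(\<lambda>n. (1 gchoose n :: real) *\<^sub>R (- h) ^ n) sums (s * s)" by simp
  moreover have "(\<lambda>n. (1 gchoose n :: real) *\<^sub>R (- h) ^ n) sums (\<Sum>n<2. (1 gchoose n :: real) *\<^sub>R (- h) ^ n)"
  proof (rule sums_finite)
    fix n :: nat assume "n \<notin> {..<2}"
    then have "(1 gchoose n :: real) = 0"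
      using binomial_gbinomial[of 1 n, where ?'a = real] by (simp add: binomial_eq_0)
    then show "(1 gchoose n :: real) *\<^sub>R (- h) ^ n = 0" by simp
  qed simp
  moreover have "(\<Sum>n<2. (1 gchoose n :: real) *\<^sub>R (- h) ^ n) = 1 - h"
    by (simp add: numeral_2_eq_2)
  ultimately show ?thesis using that[OF sD ss] sums_unique2 by metis
qed

context
  fixes al :: bool and D :: "'a::cstar_algebra set" and f :: "'a \<Rightarrow> 'b::cstar_algebra"
  assumes f: "star_hom al D f" and D: "cstar_subalgebra D"
begin

lemma star_hom_diff: "x \<in> D \<Longrightarrow> y \<in> D \<Longrightarrow> f (x - y) = f x - f y"
proof -
  assume x: "x \<in> D" and y: "y \<in> D"
  then have "f (x + (-1) *\<^sub>C y) = f x + f ((-1) *\<^sub>C y)"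
    using f D by (simp add: star_hom_def cstar_subalgebra_def)
  also have "f ((-1) *\<^sub>C y) = (if al then cnj (-1) else -1) *\<^sub>C f y"
    using f y unfolding star_hom_def by blast
  also have "\<dots> = - f y" by (simp add: scaleC_minus_left)
  finally show ?thesis by (simp add: scaleC_minus_left)
qed

lemma star_hom_zero: "f 0 = 0"
  using star_hom_diff[of 1 1] D by (simp add: cstar_subalgebra_def)

lemma star_hom_sum: "(\<And>i. i \<in> I \<Longrightarrow> g i \<in> D) \<Longrightarrow> f (\<Sum>i\<in>I. g i) = (\<Sum>i\<in>I. f (g i))"
proof (induction I rule: infinite_finite_induct)
  case (insert i I)
  then have "(\<Sum>i\<in>I. g i) \<in> D" by (intro cstar_subalgebra_sum[OF D]) auto
  then show ?case using insert f by (simp add: star_hom_def)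
qed (simp_all add: star_hom_zero)

end

text \<open>
  If \<open>norm y < 1\<close>, then \<open>1 - y\<^sup>\<dagger> * y = s * s\<close> with \<open>s\<close> self-adjoint in the algebra, so its image is
  a positive operator.
\<close>

lemma star_hom_contractive:
  fixes f :: "'a::cstar_algebra \<Rightarrow> 'h::chilbert bop"
  assumes f: "star_hom al D f" and D: "cstar_subalgebra D" and x: "x \<in> D"
  shows "norm (f x) \<le> norm x"
proof (rule field_le_epsilon)
  fix e :: real assume e: "0 < e"
  \<comment> \<open>The extra \<open>e\<close> gives the rescaled element norm strictly below 1, as
    the square root requires.\<close>
  define t where "t = norm x + e"
  have t: "t > 0" "norm x < t" using e by (auto simp: t_def add_nonneg_pos)
  define y where "y = complex_of_real (1 / t) *\<^sub>C x"
  have y: "y \<in> D" "y\<^sup>\<dagger> * y \<in> D" using D x by (auto simp: y_def cstar_subalgebra_def)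
  have ny: "norm y < 1" using t by (simp add: y_def cstar_norm_scaleC norm_divide)
  have "norm (y\<^sup>\<dagger> * y) < 1" unfolding cstar_identity using ny by (simp add: power_less_one_iff)
  then obtain s where s: "s \<in> D" "s\<^sup>\<dagger> = s" "s * s = 1 - y\<^sup>\<dagger> * y"
    using cstar_sqrt_one_minus[OF D y(2)] by (auto simp: star_mult star_star)
  have "f (s * s) = 1 - (f y)\<^sup>\<dagger> * f y"
    using f D y s star_hom_diff[OF f D, of 1 "y\<^sup>\<dagger> * y"] by (simp add: star_hom_def cstar_subalgebra_def)
  then have fs: "(f s)\<^sup>\<dagger> * f s = 1 - (f y)\<^sup>\<dagger> * f y"
    using f s by (metis star_hom_def)
  have "norm (f y \<cdot> v) \<le> 1 * norm v" for v
  proof -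
    have "cinner v (((f s)\<^sup>\<dagger> * f s) \<cdot> v) = cinner v v - cinner v (((f y)\<^sup>\<dagger> * f y) \<cdot> v)"
      by (simp add: fs bop_simps cinner_simps)
    then have "cinner (f s \<cdot> v) (f s \<cdot> v) = cinner v v - cinner (f y \<cdot> v) (f y \<cdot> v)"
      by (simp add: bop_simps cinner_star_right)
    then have "(norm (f y \<cdot> v))\<^sup>2 = (norm v)\<^sup>2 - (norm (f s \<cdot> v))\<^sup>2"
      unfolding norm_sq_cinner by simp
    then have "(norm (f y \<cdot> v))\<^sup>2 \<le> (norm v)\<^sup>2" by simp
    then show ?thesis by simp
  qed
  then have "norm (f y) \<le> 1" by (intro norm_bop_bound) auto
  moreover have "f y = (if al then cnj (1 / t) else 1 / t) *\<^sub>C f x"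
    using f x by (simp add: y_def star_hom_def)
  ultimately have "norm (f x) \<le> t" using t by (cases al) (simp_all add: cstar_norm_scaleC norm_divide)
  then show "norm (f x) \<le> norm x + e" using t(1) by (simp add: t_def)
qed

lemma star_hom_continuous:
  fixes f :: "'a::cstar_algebra \<Rightarrow> 'h::chilbert bop"
  assumes f: "star_hom al D f" and D: "cstar_subalgebra D"
  shows "continuous_on D f"
  unfolding continuous_on_iff
proof (intro ballI allI impI)
  fix x and e :: real assume x: "x \<in> D" and e: "0 < e"
  have "dist (f x') (f x) \<le> dist x' x" if "x' \<in> D" for x'
    using star_hom_contractive[OF f D, of "x' - x"] star_hom_diff[OF f D that x]
      cstar_subalgebra_diff[OF D that x] by (simp add: dist_norm)
  then show "\<exists>d>0. \<forall>x'\<in>D. dist x' x < d \<longrightarrow> dist (f x') (f x) < e"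
    using e by (intro exI[of _ e]) (auto intro: le_less_trans)
qed

text \<open>Continuity makes the preimage closed. This is what reduces properties of a generated
  C*-algebra to its generators.\<close>

lemma star_hom_preimage_subalgebra:
  fixes f :: "'a::cstar_algebra \<Rightarrow> 'h::chilbert bop"
  assumes f: "star_hom al D f" and D: "cstar_subalgebra D" and E: "cstar_subalgebra E"
  shows "cstar_subalgebra {x \<in> D. f x \<in> E}"
proof -
  have "closed D" "closed E" using D E by (auto simp: cstar_subalgebra_def)
  then have "closed {x \<in> D. f x \<in> E}"
    using continuous_closed_preimage[OF star_hom_continuous[OF f D]]
    by (simp add: vimage_def Int_def conj_commute)
  then show ?thesis using f D E by (auto simp: cstar_subalgebra_def star_hom_def)
qed

section \<open>Pure states\<close>

text \<open>A state without the normalization: the two parts into which a pure state is split below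
  have masses \<open>t\<close> and \<open>1 - t\<close>.\<close>

definition positive_functional :: "('a::cstar_algebra \<Rightarrow> complex) \<Rightarrow> bool" where
  "positive_functional \<psi> \<longleftrightarrow> (\<forall>x y. \<psi> (x + y) = \<psi> x + \<psi> y) \<and> (\<forall>c x. \<psi> (c *\<^sub>C x) = c * \<psi> x) \<and>
     (\<forall>x. \<psi> (x\<^sup>\<dagger> * x) \<in> \<real>\<^sub>\<ge>\<^sub>0)"

text \<open>Purity speaks of convex combinations of states, so both parts are first divided by their
  masses.\<close>

lemma pure_state_decomposition:
  assumes \<phi>: "pure_state \<phi>" and \<psi>: "positive_functional \<psi>\<^sub>1" "positive_functional \<psi>\<^sub>2"
    and sum: "\<And>x. \<phi> x = \<psi>\<^sub>1 x + \<psi>\<^sub>2 x" and t: "\<psi>\<^sub>1 1 = complex_of_real t" "0 < t" "t < 1"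
  shows "\<psi>\<^sub>1 x = t * \<phi> x"
proof -
  have t2: "\<psi>\<^sub>2 1 = complex_of_real (1 - t)"
    using sum[of 1] t \<phi> by (simp add: pure_state_def state_def eq_diff_eq add.commute)
  have st: "state (\<lambda>x. complex_of_real (1 / r) * \<psi> x)"
    if "positive_functional \<psi>" "\<psi> 1 = complex_of_real r" "0 < r" for \<psi> and r :: real
  proof -
    have "complex_of_real (1 / r) * \<psi> (x\<^sup>\<dagger> * x) \<in> \<real>\<^sub>\<ge>\<^sub>0" for x
      using that by (intro nonneg_Reals_mult_I) (auto simp: positive_functional_def)
    then show ?thesis using that by (simp add: state_def positive_functional_def add_divide_distrib)
  qed
  have "(\<lambda>x. complex_of_real (1 / t) * \<psi>\<^sub>1 x) = \<phi>"
  proof -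
    have "\<phi> x = complex_of_real t * (complex_of_real (1 / t) * \<psi>\<^sub>1 x) +
      complex_of_real (1 - t) * (complex_of_real (1 / (1 - t)) * \<psi>\<^sub>2 x)" for x
      using t by (simp add: sum field_simps)
    moreover have "state (\<lambda>x. complex_of_real (1 / (1 - t)) * \<psi>\<^sub>2 x)"
      using st[OF \<psi>(2) t2] t(3) by simp
    ultimately show ?thesis
      using \<phi> st[OF \<psi>(1) t(1,2)] t(2,3) unfolding pure_state_def by blast
  qed
  then have "complex_of_real (1 / t) * \<psi>\<^sub>1 x = \<phi> x" by (rule fun_cong)
  then show ?thesis using t by (auto simp: field_simps)
qed

lemma vector_positive_functional:
  assumes "star_hom False UNIV \<pi>" "0 \<le> r"
  shows "positive_functional (\<lambda>x. complex_of_real r * cinner v (\<pi> x \<cdot> v))"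
proof -
  have "cinner v (\<pi> (x\<^sup>\<dagger> * x) \<cdot> v) = of_real ((norm (\<pi> x \<cdot> v))\<^sup>2)" for x
    using assms(1) by (simp add: star_hom_def bop_simps cinner_star_right cinner_self)
  then have "complex_of_real r * cinner v (\<pi> (x\<^sup>\<dagger> * x) \<cdot> v) \<in> \<real>\<^sub>\<ge>\<^sub>0" for x
    using assms(2) by (metis mult_nonneg_nonneg nonneg_Reals_of_real_iff of_real_mult zero_le_power2)
  then show ?thesis
    using assms(1) by (simp add: positive_functional_def star_hom_def bop_simps cinner_simps algebra_simps)
qed

context
  fixes \<phi> :: "'a::cstar_algebra \<Rightarrow> complex" and \<pi> :: "'a \<Rightarrow> 'h::chilbert bop" and \<Omega> :: 'h
  assumes pure: "pure_state \<phi>" and gns: "gns UNIV \<phi> \<pi> \<Omega>"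
begin

lemma gns_hom: "star_hom False UNIV \<pi>"
  and gns_dense: "closure (range (\<lambda>x. \<pi> x \<cdot> \<Omega>)) = UNIV"
  and gns_vector: "\<phi> x = cinner \<Omega> (\<pi> x \<cdot> \<Omega>)"
  using gns by (auto simp: gns_def)

lemma gns_unit: "norm \<Omega> = 1"
proof -
  have "cinner \<Omega> \<Omega> = 1"
    using gns_vector[of 1] pure gns_hom by (simp add: pure_state_def state_def star_hom_def bop_simps)
  then have "(norm \<Omega>)\<^sup>2 = 1" by (simp add: norm_sq_cinner)
  then show ?thesis using norm_ge_zero[of \<Omega>] by (auto simp: power2_eq_1_iff simp del: norm_ge_zero)
qed

text \<open>The positive operators (1 + h)/2 and (1 - h)/2 commute with the representation and so
  split \<phi> into two positive functionals. Purity makes the first proportional to \<phi>, which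
  says that \<Omega> is an eigenvector of \<open>h\<close>; since \<Omega> is cyclic,
  \<open>h\<close> is the eigenvalue.\<close>

lemma pure_commutant_selfadjoint:
  assumes h: "h \<in> commutant (range \<pi>)" "h\<^sup>\<dagger> = h" "norm h < 1"
  shows "\<exists>c. h = c *\<^sub>C 1"
proof -
  note [simp] = bop_simps
  have \<pi>: "\<pi> (x + y) = \<pi> x + \<pi> y" "\<pi> (x * y) = \<pi> x * \<pi> y" "\<pi> (x\<^sup>\<dagger>) = (\<pi> x)\<^sup>\<dagger>" "\<pi> 1 = 1"
    "\<pi> (c *\<^sub>C x) = c *\<^sub>C \<pi> x" for x y c
    using gns_hom by (auto simp: star_hom_def)
  have comm: "h \<cdot> \<pi> x \<cdot> v = \<pi> x \<cdot> h \<cdot> v" for x v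
    using h(1) by (auto simp: commutant_def simp flip: alg_bop_apply(2))
  define q where "q v = Re (cinner v (h \<cdot> v))" for v
  have q: "cinner v (h \<cdot> v) = of_real (q v)" for v
  proof -
    have "cinner v (h \<cdot> v) = cnj (cinner v (h \<cdot> v))"
      by (metis cinner_commute cinner_star_left h(2))
    then show ?thesis unfolding q_def by (simp add: complex_eq_iff)
  qed
  have qle: "\<bar>q v\<bar> \<le> norm h * (norm v)\<^sup>2" for v
  proof -
    have "\<bar>q v\<bar> \<le> cmod (cinner v (h \<cdot> v))" unfolding q_def by (rule abs_Re_le_cmod)
    also have "\<dots> \<le> norm v * (norm h * norm v)"
      by (intro order_trans[OF cinner_cauchy_schwarz] mult_left_mono norm_bop_apply) simp
    finally show ?thesis by (simp add: power2_eq_square ac_simps)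
  qed
  define \<psi> where "\<psi> s x = (1/2) * cinner \<Omega> ((1 + complex_of_real s *\<^sub>C h) \<cdot> \<pi> x \<cdot> \<Omega>)" for s :: real and x
  have pos: "positive_functional (\<psi> s)" if s: "\<bar>s\<bar> = 1" for s
  proof -
    have "\<psi> s (x\<^sup>\<dagger> * x) \<in> \<real>\<^sub>\<ge>\<^sub>0" for x
    proof -
      let ?v = "\<pi> x \<cdot> \<Omega>"
      have "\<psi> s (x\<^sup>\<dagger> * x) = (1/2) * (cinner ?v ?v + s * cinner ?v (h \<cdot> ?v))"
        unfolding \<psi>_def by (simp add: \<pi> comm cinner_simps cinner_star_right)
          (metis \<pi>(3) cinner_star_right comm)
      also have "\<dots> = of_real (((norm ?v)\<^sup>2 + s * q ?v) / 2)" by (simp add: q cinner_self)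
      moreover have "0 \<le> (norm ?v)\<^sup>2 + s * q ?v"
      proof -
        have "\<bar>s * q ?v\<bar> \<le> 1 * (norm ?v)\<^sup>2"
          using order_trans[OF qle mult_right_mono[OF less_imp_le[OF h(3)]]] s by (simp add: abs_mult)
        then show ?thesis by linarith
      qed
      ultimately show ?thesis by (metis divide_nonneg_pos nonneg_Reals_of_real_iff zero_less_numeral)
    qed
    then show ?thesis
      by (simp add: positive_functional_def \<psi>_def \<pi> cinner_simps bop_scaleC bop_add_right algebra_simps)
  qed
  have tq: "\<psi> 1 1 = complex_of_real ((1 + q \<Omega>) / 2)"
    by (simp add: \<psi>_def \<pi> cinner_simps q cinner_self gns_unit)
  have qb: "\<bar>q \<Omega>\<bar> < 1" using qle[of \<Omega>] h(3) gns_unit by simp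
  have "\<psi> 1 x = complex_of_real ((1 + q \<Omega>) / 2) * \<phi> x" for x
  proof (rule pure_state_decomposition[OF pure pos pos _ tq])
    show "\<phi> x = \<psi> 1 x + \<psi> (-1) x" for x
      by (simp add: \<psi>_def gns_vector cinner_simps algebra_simps scaleC_minus_left)
    show "0 < (1 + q \<Omega>) / 2" "(1 + q \<Omega>) / 2 < 1" using qb by (auto simp: abs_less_iff)
  qed simp_all
  then have "cinner \<Omega> (h \<cdot> \<pi> x \<cdot> \<Omega>) = q \<Omega> * cinner \<Omega> (\<pi> x \<cdot> \<Omega>)" for x
    by (simp add: \<psi>_def gns_vector cinner_simps field_simps)
  then have "cinner (\<pi> x \<cdot> \<Omega>) (h \<cdot> \<Omega> - q \<Omega> *\<^sub>C \<Omega>) = 0" for x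
    using comm[of "x\<^sup>\<dagger>" \<Omega>] by (simp add: cinner_simps \<pi> flip: cinner_star_right) (metis \<pi>(3))
  then have "h \<cdot> \<Omega> - q \<Omega> *\<^sub>C \<Omega> = 0" using cinner_dense_zero[OF gns_dense] by blast
  then have h\<Omega>: "h \<cdot> \<Omega> = q \<Omega> *\<^sub>C \<Omega>" by simp
  have "h = q \<Omega> *\<^sub>C 1"
    by (rule bop_eq_on_dense[OF gns_dense]) (auto simp: comm h\<Omega> bop_scaleC)
  then show ?thesis by blast
qed

text \<open>A self-adjoint element is rescaled to norm below 1, and \<open>x\<close> is a
  combination of the self-adjoint elements \<open>x + x\<^sup>\<dagger>\<close> and
  \<open>\<i> *\<^sub>C (x - x\<^sup>\<dagger>)\<close>.\<close>

lemma pure_commutant: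
  assumes "x \<in> commutant (range \<pi>)"
  shows "\<exists>c. x = c *\<^sub>C 1"
proof -
  have sub: "cstar_subalgebra (commutant (range \<pi>))"
    using gns_hom by (intro cstar_subalgebra_commutant) (auto simp: star_hom_def image_iff, metis)
  have sa: "\<exists>c. h = c *\<^sub>C 1" if h: "h \<in> commutant (range \<pi>)" "h\<^sup>\<dagger> = h" for h
  proof -
    define r where "r = 1 / (norm h + 1)"
    have r: "r > 0" "r * norm h < 1" by (auto simp: r_def add_nonneg_pos divide_less_eq)
    have "\<exists>c. complex_of_real r *\<^sub>C h = c *\<^sub>C 1"
      using h sub r by (intro pure_commutant_selfadjoint)
        (auto simp: cstar_subalgebra_def star_scaleC cstar_norm_scaleC)
    then obtain c where "complex_of_real r *\<^sub>C h = c *\<^sub>C 1" by blast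
    then have "complex_of_real (1 / r) *\<^sub>C complex_of_real r *\<^sub>C h = (complex_of_real (1 / r) * c) *\<^sub>C 1"
      by (simp add: scaleC_scaleC)
    then show ?thesis using r by (auto simp: scaleC_scaleC)
  qed
  have xs: "x\<^sup>\<dagger> \<in> commutant (range \<pi>)" using sub assms by (simp add: cstar_subalgebra_def)
  obtain b where b: "x + x\<^sup>\<dagger> = b *\<^sub>C 1"
    using sa[of "x + x\<^sup>\<dagger>"] sub assms xs by (auto simp: cstar_subalgebra_def star_add star_star add.commute)
  have "(\<i> *\<^sub>C (x - x\<^sup>\<dagger>))\<^sup>\<dagger> = \<i> *\<^sub>C (x - x\<^sup>\<dagger>)"
    by (simp add: star_diff star_star star_scaleC scaleC_minus_left scaleC_diff_right)
  moreover have "\<i> *\<^sub>C (x - x\<^sup>\<dagger>) \<in> commutant (range \<pi>)"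
    using sub cstar_subalgebra_diff[OF sub assms xs] by (simp add: cstar_subalgebra_def)
  ultimately obtain c where c: "\<i> *\<^sub>C (x - x\<^sup>\<dagger>) = c *\<^sub>C 1" using sa by blast
  have "- \<i> *\<^sub>C \<i> *\<^sub>C (x - x\<^sup>\<dagger>) = (- \<i> * c) *\<^sub>C 1" unfolding c by (simp add: scaleC_scaleC)
  then have c': "x - x\<^sup>\<dagger> = (- \<i> * c) *\<^sub>C 1" by (simp add: scaleC_scaleC)
  have "x = (1/2) *\<^sub>C ((x + x\<^sup>\<dagger>) + (x - x\<^sup>\<dagger>))"
    using scaleC_add_left[of "1/2" "1/2" x] by (simp add: scaleC_add_right)
  also have "\<dots> = ((1/2) * (b + (- \<i> * c))) *\<^sub>C 1"
    unfolding b c' by (simp only: scaleC_add_left scaleC_scaleC distrib_left scaleC_add_right)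
  finally show ?thesis by blast
qed

text \<open>For |c| = 1 the vectors \<Omega> + c \<Omega>' and \<Omega> - c \<Omega>' induce
  positive functionals with sum 4 \<phi>. Purity makes each a multiple of \<phi>; varying c, the
  cross terms between \<Omega> and \<Omega>' are multiples of \<phi> too, and cyclicity turns this
  into proportionality of the vectors.\<close>

lemma pure_vector_unique:
  assumes \<Omega>': "\<And>x. cinner \<Omega>' (\<pi> x \<cdot> \<Omega>') = \<phi> x"
  obtains k where "\<Omega>' = k *\<^sub>C \<Omega>"
proof -
  note [simp] = bop_simps
  have \<pi>1: "\<pi> 1 = 1" and \<pi>s: "\<pi> (x\<^sup>\<dagger>) = (\<pi> x)\<^sup>\<dagger>" for x using gns_hom by (auto simp: star_hom_def)
  have n1: "cinner \<Omega> \<Omega> = 1" "cinner \<Omega>' \<Omega>' = 1"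
    using \<Omega>'[of 1] gns_vector[of 1] pure by (simp_all add: \<pi>1 pure_state_def state_def)
  have main: "cinner (\<Omega> + c *\<^sub>C \<Omega>') (\<pi> x \<cdot> (\<Omega> + c *\<^sub>C \<Omega>')) =
      cinner (\<Omega> + c *\<^sub>C \<Omega>') (\<Omega> + c *\<^sub>C \<Omega>') * \<phi> x" if c: "cnj c * c = 1" for c x
  proof -
    define v where "v = \<Omega> + c *\<^sub>C \<Omega>'"
    define w where "w = \<Omega> - c *\<^sub>C \<Omega>'"
    define \<psi> where "\<psi> u x = complex_of_real (1/4) * cinner u (\<pi> x \<cdot> u)" for u x
    have c1: "cnj c * (c * a) = a" for a by (simp add: c flip: mult.assoc)
    then have c2: "cnj c * (c * a) = a" "c * (cnj c * a) = a" for a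
      by (simp_all add: mult.left_commute)
    have sum: "\<phi> x = \<psi> v x + \<psi> w x" for x
      unfolding \<psi>_def v_def w_def bop_add_right bop_diff_right bop_scaleC cinner_simps
      by (simp add: gns_vector[symmetric] \<Omega>' c2 algebra_simps)
    define t where "t = (norm v)\<^sup>2 / 4"
    have t: "\<psi> v 1 = complex_of_real t" by (simp add: \<psi>_def t_def \<pi>1 cinner_self)
    have t': "t + (norm w)\<^sup>2 / 4 = 1"
    proof -
      have "\<psi> v 1 + \<psi> w 1 = 1" using sum[of 1] pure by (simp add: pure_state_def state_def)
      then have "complex_of_real (t + (norm w)\<^sup>2 / 4) = 1" unfolding t by (simp add: \<psi>_def \<pi>1 cinner_self)
      then show ?thesis using of_real_eq_1_iff by blast
    qed
    have t0: "0 \<le> t" by (simp add: t_def)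
    have "\<psi> v x = t * \<phi> x"
    \<comment> \<open>At the endpoints \<open>v\<close> or \<open>w\<close> is zero;
      \<open>pure_state_decomposition\<close> covers only masses strictly in between.\<close>
    proof (cases "t = 0 \<or> t = 1")
      case True
      then have "v = 0 \<or> w = 0" using t' by (auto simp: t_def)
      then show ?thesis
      proof
        assume "v = 0" then show ?thesis by (simp add: \<psi>_def t_def)
      next
        assume "w = 0"
        then have "\<psi> w x = 0" "t = 1" using t' by (auto simp: \<psi>_def)
        then show ?thesis using sum[of x] by simp
      qed
    next
      case False
      then have "t < 1" using t' zero_le_power2[of "norm w"] by linarith
      then show ?thesis
        using False t0 sum t vector_positive_functional[OF gns_hom, of "1/4"] unfolding \<psi>_def[abs_def]
        by (intro pure_state_decomposition[OF pure, of _ "\<lambda>x. complex_of_real (1/4) * cinner w (\<pi> x \<cdot> w)"]) auto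
    qed
    then show ?thesis unfolding v_def[symmetric] by (simp add: \<psi>_def t_def cinner_self field_simps)
  qed
  define k where "k = cinner \<Omega> \<Omega>'"
  have "cinner \<Omega> (\<pi> x \<cdot> \<Omega>') = k * \<phi> x" for x
  proof -
    define f where "f = cinner \<Omega> (\<pi> x \<cdot> \<Omega>') - k * \<phi> x"
    define g where "g = cinner \<Omega>' (\<pi> x \<cdot> \<Omega>) - cnj k * \<phi> x"
    have k': "cinner \<Omega>' \<Omega> = cnj k" by (simp add: k_def cinner_commute[symmetric])
    have "c * f + cnj c * g = 0" if c: "cnj c * c = 1" for c
    proof -
      have c2: "cnj c * (c * a) = a" for a by (simp add: c flip: mult.assoc)
      have "cinner \<Omega> (\<pi> x \<cdot> \<Omega>) = \<phi> x" by (simp add: gns_vector)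
      then show ?thesis using main[OF c, of x]
        unfolding bop_add_right bop_scaleC cinner_simps f_def g_def
        by (simp add: n1 k' \<Omega>' k_def[symmetric] c2 algebra_simps)
    qed
    from this[of 1] this[of \<i>] have "f + g = 0" "\<i> * f - \<i> * g = 0" by simp_all
    then have "f = - g" "f = g" by (simp_all add: eq_neg_iff_add_eq_0)
    then have "f = 0" by simp
    then show ?thesis by (simp add: f_def)
  qed
  then have "cinner (\<pi> x \<cdot> \<Omega>) (\<Omega>' - k *\<^sub>C \<Omega>) = 0" for x
    using \<pi>s[of x] by (simp add: cinner_simps gns_vector flip: cinner_star_right) (metis)
  then have "\<Omega>' - k *\<^sub>C \<Omega> = 0" using cinner_dense_zero[OF gns_dense] by blast
  then show ?thesis using that by simp
qed

text \<open>
  The automorphism maps the rank-one projection onto \<open>\<Omega>\<close> to a minimal projection, any unit vector of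
  which induces the state \<open>\<phi>\<close> again.
\<close>

lemma pure_automorphism_invariant:
  assumes \<tau>: "star_iso False UNIV UNIV \<tau>" and \<beta>: "surj \<beta>" "\<And>x. \<tau> (\<pi> x) = \<pi> (\<beta> x)" "\<And>x. \<phi> (\<beta> x) = \<phi> x"
  shows "cinner \<Omega> (\<tau> y \<cdot> \<Omega>) = cinner \<Omega> (y \<cdot> \<Omega>)"
proof -
  note [simp] = bop_simps
  have hom: "\<tau> (x * y) = \<tau> x * \<tau> y" "\<tau> (x\<^sup>\<dagger>) = (\<tau> x)\<^sup>\<dagger>" "\<tau> (c *\<^sub>C x) = c *\<^sub>C \<tau> x" for x y c
    using \<tau> by (auto simp: star_iso_def star_hom_def)
  define P where "P = butterfly \<Omega> \<Omega>"
  have n1: "cinner \<Omega> \<Omega> = 1" by (simp add: cinner_self gns_unit)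
  \<comment> \<open>This expresses the minimality of \<open>P\<close>; being algebraic, it survives
    an application of \<tau>.\<close>
  have PyP: "P * (y * P) = cinner \<Omega> (y \<cdot> \<Omega>) *\<^sub>C P" for y
    by (simp add: P_def mult_butterfly butterfly_apply butterfly_scaleC_left)
  have PP: "P * P = P" "P\<^sup>\<dagger> = P" by (simp_all add: P_def butterfly_butterfly n1 star_butterfly)
  have "P \<noteq> 0" unfolding P_def by (rule butterfly_unit_nonzero[OF n1])
  moreover have "\<tau> 0 = 0" using hom(3)[of 0 0] by simp
  ultimately have "\<tau> P \<noteq> 0"
    using \<tau> by (metis UNIV_I bij_betw_imp_inj_on inj_onD star_iso_def)
  then obtain w where w: "\<tau> P \<cdot> w \<noteq> 0" using bop_eqI[of "\<tau> P" 0] by auto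
  define \<Omega>' where "\<Omega>' = complex_of_real (1 / norm (\<tau> P \<cdot> w)) *\<^sub>C \<tau> P \<cdot> w"
  have P': "\<tau> P \<cdot> \<Omega>' = \<Omega>'"
    using arg_cong[OF PP(1), of "\<lambda>Q. \<tau> Q \<cdot> w"] by (simp add: \<Omega>'_def bop_scaleC hom)
  have n1': "cinner \<Omega>' \<Omega>' = 1"
    using w by (simp add: cinner_self \<Omega>'_def norm_scaleC norm_divide)
  have state: "cinner \<Omega>' (\<tau> y \<cdot> \<Omega>') = cinner \<Omega> (y \<cdot> \<Omega>)" for y
  proof -
    have "cinner \<Omega>' (\<tau> y \<cdot> \<Omega>') = cinner (\<tau> P \<cdot> \<Omega>') (\<tau> y \<cdot> \<tau> P \<cdot> \<Omega>')" by (simp add: P')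
    also have "\<dots> = cinner \<Omega>' (\<tau> (P * (y * P)) \<cdot> \<Omega>')"
      using hom(2)[of P] by (simp add: hom(1) PP flip: cinner_star_right)
    also have "\<dots> = cinner \<Omega> (y \<cdot> \<Omega>)" by (simp add: PyP hom(3) P' cinner_simps n1')
    finally show ?thesis .
  qed
  \<comment> \<open>Here the invariance of \<phi> enters: with \<open>x = \<beta> z\<close>, the
    identity \<open>state\<close> at \<open>\<pi> z\<close> returns \<open>\<phi> z\<close>, which
    equals \<open>\<phi> (\<beta> z)\<close>.\<close>
  have "cinner \<Omega>' (\<pi> x \<cdot> \<Omega>') = \<phi> x" for x
  proof -
    obtain z where z: "x = \<beta> z" using \<beta>(1) by blast
    show ?thesis using state[of "\<pi> z"] by (simp add: z \<beta> gns_vector[symmetric])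
  qed
  then obtain k where k: "\<Omega>' = k *\<^sub>C \<Omega>" using pure_vector_unique by blast
  have "cnj k * k = 1" using n1' by (simp add: k cinner_simps n1 mult.commute)
  then have "cinner \<Omega> (\<tau> y \<cdot> \<Omega>) = cnj k * k * cinner \<Omega> (\<tau> y \<cdot> \<Omega>)" by simp
  also have "\<dots> = cinner \<Omega>' (\<tau> y \<cdot> \<Omega>')" by (simp add: k bop_scaleC cinner_simps)
  finally show ?thesis by (simp add: state)
qed

end

section \<open>Weak operator limits\<close>

lemma commutant_UNIV_scalar:
  assumes "\<And>y. x * y = y * (x::'h::chilbert bop)"
  obtains c where "x = c *\<^sub>C 1"
proof -
  obtain e :: 'h where e: "cinner e e = 1" by (rule exists_unit_vector)
  define c where "c = cinner e (x \<cdot> e)"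
  have "x \<cdot> v = c *\<^sub>C v" for v
  proof -
    have "(x * butterfly v e) \<cdot> e = (butterfly v e * x) \<cdot> e" by (simp add: assms)
    then show ?thesis by (simp add: bop_simps butterfly_apply c_def e)
  qed
  then have "x = c *\<^sub>C 1"
    by (intro bop_eqI) (simp add: bop_simps)
  then show ?thesis using that by blast
qed

text \<open>Finite linear combinations of matrix elements, that is, the functionals continuous for
  the weak operator topology. Normality is expressed below as approximation by them in norm.\<close>

inductive wot_functional :: "('h::chilbert bop \<Rightarrow> complex) \<Rightarrow> bool" where
  zero: "wot_functional (\<lambda>T. 0)"
| add: "wot_functional f \<Longrightarrow> wot_functional (\<lambda>T. c * cinner v (T \<cdot> w) + f T)"

lemma wot_functional_add:
  "wot_functional f \<Longrightarrow> wot_functional g \<Longrightarrow> wot_functional (\<lambda>T. f T + g T)"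
  by (induction rule: wot_functional.induct) (simp_all add: add.assoc wot_functional.add)

text \<open>As a function of the whole array of matrix elements, the functional involves finitely
  many coordinates, so it is continuous for the product topology in which cluster points are
  taken.\<close>

lemma wot_functional_continuous:
  assumes "wot_functional f"
  obtains g :: "('h::chilbert \<times> 'h \<Rightarrow> complex) \<Rightarrow> complex" where
    "continuous_on UNIV g" "\<And>T. g (\<lambda>p. cinner (fst p) (T \<cdot> snd p)) = f T"
proof -
  have "\<exists>g :: ('h \<times> 'h \<Rightarrow> complex) \<Rightarrow> complex. continuous_on UNIV g \<and>
    (\<forall>T. g (\<lambda>p. cinner (fst p) (T \<cdot> snd p)) = f T)"
    using assms
  proof induction
    case zero
    show ?case by (rule exI[of _ "\<lambda>_. 0"]) simp
  next
    case (add f c v w)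
    then obtain g :: "('h \<times> 'h \<Rightarrow> complex) \<Rightarrow> complex" where
      g: "continuous_on UNIV g" "\<And>T. g (\<lambda>p. cinner (fst p) (T \<cdot> snd p)) = f T" by blast
    show ?case
      by (rule exI[of _ "\<lambda>p. c * p (v, w) + g p"])
        (auto simp: g intro!: continuous_intros continuous_on_product_coordinates)
  qed
  then show ?thesis using that by blast
qed

text \<open>The Riesz theorem is applied to the real part of \<open>L\<close> in its first argument;
  the imaginary part is recovered by replacing \<open>v\<close> by
  \<open>\<i> *\<^sub>C v\<close>.\<close>

lemma bounded_form_operator:
  fixes L :: "'h::chilbert \<times> 'h \<Rightarrow> complex"
  assumes bound: "\<And>v w. cmod (L (v, w)) \<le> K * norm v * norm w"
    and add_left: "\<And>u v w. L (u + v, w) = L (u, w) + L (v, w)"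
    and add_right: "\<And>u v w. L (u, v + w) = L (u, v) + L (u, w)"
    and scale_left: "\<And>c v w. L (c *\<^sub>C v, w) = cnj c * L (v, w)"
    and scale_right: "\<And>c v w. L (v, c *\<^sub>C w) = c * L (v, w)"
  obtains T where "\<And>v w. L (v, w) = cinner v (T \<cdot> w)"
proof -
  have "\<exists>z. \<forall>v. L (v, w) = cinner v z" for w
  proof -
    have "bounded_linear (\<lambda>v. Re (L (v, w)))"
    proof (rule bounded_linear_intro[of _ "K * norm w"])
      show "norm (Re (L (v, w))) \<le> norm v * (K * norm w)" for v
        using order_trans[OF abs_Re_le_cmod bound[of v w]] by (simp add: ac_simps)
    qed (simp_all add: add_left scale_left scaleR_eq_scaleC)
    then obtain z where z: "\<And>v. Re (L (v, w)) = inner z v" by (rule riesz_real) blast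
    have "L (v, w) = cinner v z" for v
    proof (rule complex_eqI)
      show "Re (L (v, w)) = Re (cinner v z)" by (simp add: z Re_cinner inner_commute)
      have "Im (L (v, w)) = Re (L (\<i> *\<^sub>C v, w))" by (simp add: scale_left)
      also have "\<dots> = Re (cinner (\<i> *\<^sub>C v) z)" by (simp add: z Re_cinner inner_commute)
      finally show "Im (L (v, w)) = Im (cinner v z)" by (simp add: cinner_scaleC_left)
    qed
    then show ?thesis by blast
  qed
  then obtain Z where Z: "\<And>v w. L (v, w) = cinner v (Z w)" by metis
  have eqI: "x = y" if "\<And>v. cinner v x = cinner v y" for x y :: 'h
    using that[of "x - y"] by (metis cinner_diff_right cinner_eq_zero_iff right_minus_eq)
  have add: "Z (x + y) = Z x + Z y" for x y
    by (rule eqI) (simp add: Z[symmetric] add_right cinner_add_right)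
  have sc: "Z (c *\<^sub>C x) = c *\<^sub>C Z x" for c x
    by (rule eqI) (simp add: Z[symmetric] scale_right cinner_scaleC_right)
  have "norm (Z w) \<le> norm w * K" for w
  proof (cases "Z w = 0")
    case True
    have "0 \<le> K * norm w * norm w" using order_trans[OF norm_ge_zero bound[of w w]] by simp
    then have "0 \<le> norm w * K"
      by (cases "w = 0") (auto simp: zero_le_mult_iff mult_le_0_iff)
    then show ?thesis using True by simp
  next
    case False
    have "norm (Z w) * norm (Z w) = cmod (cinner (Z w) (Z w))"
      by (simp add: cinner_self power2_eq_square norm_mult)
    also have "\<dots> \<le> norm (Z w) * (norm w * K)" using bound[of "Z w" w] by (simp add: Z ac_simps)
    finally show ?thesis using False by simp
  qed
  then have "bounded_linear Z"
    using add sc by (intro bounded_linear_intro[of Z K]) (auto simp: scaleR_eq_scaleC)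
  then obtain T where "bop_apply T = Z" using bop_exists[of Z] sc by blast
  then show ?thesis using that[of T] Z by simp
qed

text \<open>
  Weak operator cluster points exist by Tychonoff's theorem.  They are scalars by irreducibility, and the
  normal functional \<open>\<phi>\<close>, which is constant along the sequence, determines the scalar.
\<close>

lemma wot_limit_scalar:
  fixes X :: "nat \<Rightarrow> 'h::chilbert bop" and \<phi> :: "'h bop \<Rightarrow> complex"
  assumes bound: "\<And>N. norm (X N) \<le> K"
    and asym: "\<And>s. s \<in> S \<Longrightarrow> \<forall>\<^sub>F N in sequentially. X N * s = s * X N"
    and irr: "\<And>x. (\<And>s. s \<in> S \<Longrightarrow> x * s = s * x) \<Longrightarrow> \<exists>c. x = c *\<^sub>C 1"
    and normal: "\<And>e. 0 < e \<Longrightarrow> \<exists>f. wot_functional f \<and> (\<forall>T. cmod (\<phi> T - f T) \<le> e * norm T)"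
    and \<phi>: "\<And>c. \<phi> (c *\<^sub>C 1) = c" "\<And>N. \<phi> (X N) = c\<^sub>0"
  shows "(\<lambda>N. cinner v (X N \<cdot> w)) \<longlonglongrightarrow> c\<^sub>0 * cinner v w"
proof (rule ccontr)
  assume "\<not> ?thesis"
  then obtain e where e: "0 < e"
    "\<exists>\<^sub>F N in sequentially. e \<le> dist (cinner v (X N \<cdot> w)) (c\<^sub>0 * cinner v w)"
    unfolding tendsto_iff frequently_def by (auto simp: not_le)
  \<comment> \<open>\<open>F\<close> collects the indices at which the matrix element stays
    \<open>e\<close> away from its intended limit; a cluster point along \<open>F\<close> inherits
    this gap.\<close>
  define F where "F = inf sequentially (principal {N. e \<le> dist (cinner v (X N \<cdot> w)) (c\<^sub>0 * cinner v w)})"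
  have F: "F \<noteq> bot"
    using e(2) unfolding F_def trivial_limit_def eventually_inf_principal frequently_def by simp
  have evF: "eventually P F" if "eventually P sequentially" for P
    unfolding F_def by (rule filter_leD[OF inf_le1 that])
  define Y where "Y N = (\<lambda>p. cinner (fst p) (X N \<cdot> snd p))" for N
  have Y: "Y N (a, b) = cinner a (X N \<cdot> b)" for N a b by (simp add: Y_def)
  have K: "0 \<le> K" using order_trans[OF norm_ge_zero bound[of 0]] .
  have Yb: "cmod (Y N (a, b)) \<le> K * norm a * norm b" for N a b
  proof -
    have "cmod (Y N (a, b)) \<le> norm a * (norm (X N) * norm b)"
      unfolding Y by (intro order_trans[OF cinner_cauchy_schwarz] mult_left_mono norm_bop_apply) simp
    also have "\<dots> \<le> norm a * (K * norm b)" by (intro mult_left_mono mult_right_mono bound) auto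
    finally show ?thesis by (simp add: ac_simps)
  qed
  let ?C = "PiE UNIV (\<lambda>p::'h \<times> 'h. cball (0::complex) (K * norm (fst p) * norm (snd p)))"
  have "compact ?C"
    using compactin_PiE[of "\<lambda>_. euclidean" UNIV "\<lambda>p::'h \<times> 'h. cball (0::complex) (K * norm (fst p) * norm (snd p))"]
    by (simp add: euclidean_product_topology)
  moreover have "eventually (\<lambda>y. y \<in> ?C) (filtermap Y F)"
    unfolding eventually_filtermap using Yb by (intro always_eventually) auto
  moreover have "filtermap Y F \<noteq> bot" using F by (simp add: filtermap_bot_iff)
  ultimately obtain L where L: "inf (nhds L) (filtermap Y F) \<noteq> bot"
    unfolding compact_filter by blast
  \<comment> \<open>Closed conditions that hold along \<open>F\<close> pass to \<open>L\<close>. The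
    norm bound, sesquilinearity, commutation with \<open>S\<close> and the final gap are all
    transferred in this way.\<close>
  have cluster: "L \<in> Z" if Z: "closed Z" "eventually (\<lambda>N. Y N \<in> Z) F" for Z
  proof (rule ccontr)
    assume "L \<notin> Z"
    then have "eventually (\<lambda>y. y \<in> - Z) (nhds L)" using Z(1) by (intro eventually_nhds_in_open) auto
    moreover have "eventually (\<lambda>y. y \<in> Z) (filtermap Y F)" using Z(2) by (simp add: eventually_filtermap)
    ultimately have "eventually (\<lambda>y. False) (inf (nhds L) (filtermap Y F))"
      unfolding eventually_inf by (intro exI[of _ "\<lambda>y. y \<in> - Z"] exI[of _ "\<lambda>y. y \<in> Z"]) auto
    then show False using L by (simp add: trivial_limit_def)
  qed
  note ci = closed_Collect_eq closed_Collect_le continuous_intros continuous_on_product_coordinates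
  obtain T where T: "\<And>a b. L (a, b) = cinner a (T \<cdot> b)"
  proof (rule bounded_form_operator[of L K])
    have "L \<in> {l. cmod (l (a, b)) \<le> K * norm a * norm b}" for a b
      by (rule cluster, intro ci) (simp add: Yb)
    then show "cmod (L (a, b)) \<le> K * norm a * norm b" for a b by simp
    have "L \<in> {l. l (a + b, c) = l (a, c) + l (b, c)}" for a b c
      by (rule cluster, intro ci) (simp add: Y cinner_simps)
    then show "L (a + b, c) = L (a, c) + L (b, c)" for a b c by simp
    have "L \<in> {l. l (a, b + c) = l (a, b) + l (a, c)}" for a b c
      by (rule cluster, intro ci) (simp add: Y cinner_simps bop_add_right)
    then show "L (a, b + c) = L (a, b) + L (a, c)" for a b c by simp
    have "L \<in> {l. l (c *\<^sub>C a, b) = cnj c * l (a, b)}" for a b c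
      by (rule cluster, intro ci) (simp add: Y cinner_simps)
    then show "L (c *\<^sub>C a, b) = cnj c * L (a, b)" for a b c by simp
    have "L \<in> {l. l (a, c *\<^sub>C b) = c * l (a, b)}" for a b c
      by (rule cluster, intro ci) (simp add: Y cinner_simps bop_scaleC)
    then show "L (a, c *\<^sub>C b) = c * L (a, b)" for a b c by simp
  qed (rule that, assumption)
  have "T * s = s * T" if s: "s \<in> S" for s
  proof (rule bop_cinner_eqI)
    fix a b
    have "L \<in> {l. l (a, s \<cdot> b) = l (s\<^sup>\<dagger> \<cdot> a, b)}"
    proof (rule cluster)
      show "closed {l::'h \<times> 'h \<Rightarrow> complex. l (a, s \<cdot> b) = l (s\<^sup>\<dagger> \<cdot> a, b)}" by (intro ci)
      show "eventually (\<lambda>N. Y N \<in> {l. l (a, s \<cdot> b) = l (s\<^sup>\<dagger> \<cdot> a, b)}) F"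
        using evF[OF asym[OF s]]
      proof eventually_elim
        case (elim N)
        have "X N \<cdot> s \<cdot> b = s \<cdot> X N \<cdot> b" by (metis alg_bop_apply(2) elim)
        then show ?case by (simp add: Y cinner_star_left)
      qed
    qed
    then show "cinner a ((T * s) \<cdot> b) = cinner a ((s * T) \<cdot> b)"
      by (simp add: T bop_simps cinner_star_left)
  qed
  then obtain c where c: "T = c *\<^sub>C 1" using irr by blast
  \<comment> \<open>The value of \<phi> is compared through an approximant \<open>f\<close>, which
    is continuous at the cluster point; the approximation error is uniform because the norms of the
    \<open>X N\<close> are bounded by \<open>K\<close>.\<close>
  have "cmod (c - c\<^sub>0) \<le> d * (cmod c + K)" if d: "0 < d" for d
  proof -
    obtain f where f: "wot_functional f" "\<And>T. cmod (\<phi> T - f T) \<le> d * norm T" using normal[OF d] by blast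
    obtain g :: "('h \<times> 'h \<Rightarrow> complex) \<Rightarrow> complex" where
      g: "continuous_on UNIV g" "\<And>T. g (\<lambda>p. cinner (fst p) (T \<cdot> snd p)) = f T"
      using wot_functional_continuous[OF f(1)] by blast
    have "L \<in> {l. cmod (c\<^sub>0 - g l) \<le> d * K}"
    proof (rule cluster)
      show "closed {l. cmod (c\<^sub>0 - g l) \<le> d * K}" by (intro ci g)
      have "cmod (c\<^sub>0 - g (Y N)) \<le> d * K" for N
        using f(2)[of "X N"] mult_left_mono[OF bound[of N] less_imp_le[OF d]] by (simp add: Y_def g \<phi>)
      then show "\<forall>\<^sub>F N in F. Y N \<in> {l. cmod (c\<^sub>0 - g l) \<le> d * K}" by simp
    qed
    moreover have "g L = f T" 
    proof -
      have "L = (\<lambda>p. cinner (fst p) (T \<cdot> snd p))" by (auto simp: fun_eq_iff T)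
      then show ?thesis using g(2) by simp
    qed
    ultimately have "cmod (c\<^sub>0 - f T) \<le> d * K" by simp
    moreover have "cmod (c - f T) \<le> d * cmod c" using f(2)[of T] by (simp add: c \<phi> cstar_norm_scaleC)
    moreover have "cmod (c - c\<^sub>0) \<le> cmod (c - f T) + cmod (c\<^sub>0 - f T)"
      using dist_triangle2[of c c\<^sub>0 "f T"] unfolding dist_norm .
    ultimately show ?thesis unfolding distrib_left by linarith
  qed
  note le = this
  have "cmod (c - c\<^sub>0) \<le> 0"
  proof (rule field_le_epsilon)
    fix r :: real assume r: "0 < r"
    have q: "0 < cmod c + K + 1" using K by (simp add: add_nonneg_pos)
    then have "r / (cmod c + K + 1) * (cmod c + K) \<le> r" using r by (simp add: field_simps)
    then show "cmod (c - c\<^sub>0) \<le> 0 + r" using le[of "r / (cmod c + K + 1)"] r q by simp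
  qed
  then have "c = c\<^sub>0" by simp
  moreover have "L \<in> {l. e \<le> dist (l (v, w)) (c\<^sub>0 * cinner v w)}"
  proof (rule cluster)
    show "closed {l::'h \<times> 'h \<Rightarrow> complex. e \<le> dist (l (v, w)) (c\<^sub>0 * cinner v w)}" by (intro ci)
    show "\<forall>\<^sub>F N in F. Y N \<in> {l. e \<le> dist (l (v, w)) (c\<^sub>0 * cinner v w)}"
      unfolding F_def by (simp add: eventually_inf_principal Y)
  qed
  ultimately show False using e(1) by (simp add: T c bop_simps cinner_simps)
qed

text \<open>Tannery's theorem, with a summable majorant that is uniform in \<open>N\<close>,
  exchanges the limit and the series.\<close>

lemma sigma_weak_limitI:
  fixes X :: "nat \<Rightarrow> 'h::chilbert bop"
  assumes bound: "\<And>N. norm (X N) \<le> K"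
    and lim: "\<And>v w. (\<lambda>N. cinner v (X N \<cdot> w)) \<longlonglongrightarrow> cinner v (T \<cdot> w)"
  shows "sigma_weak_limit X T"
  unfolding sigma_weak_limit_def
proof (intro allI impI, elim conjE)
  fix \<xi> \<eta> :: "nat \<Rightarrow> 'h"
  assume sq: "summable (\<lambda>k. (norm (\<xi> k))\<^sup>2)" "summable (\<lambda>k. (norm (\<eta> k))\<^sup>2)"
  have K: "0 \<le> K" using order_trans[OF norm_ge_zero bound[of 0]] .
  have b: "cmod (cinner (\<xi> k) (X N \<cdot> \<eta> k)) \<le> K * ((norm (\<xi> k))\<^sup>2 + (norm (\<eta> k))\<^sup>2)" for k N
  proof -
    have "cmod (cinner (\<xi> k) (X N \<cdot> \<eta> k)) \<le> norm (\<xi> k) * (norm (X N) * norm (\<eta> k))"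
      by (intro order_trans[OF cinner_cauchy_schwarz] mult_left_mono norm_bop_apply) simp
    also have "\<dots> \<le> norm (\<xi> k) * (K * norm (\<eta> k))" by (intro mult_left_mono mult_right_mono bound) auto
    also have "\<dots> = K * (norm (\<xi> k) * norm (\<eta> k))" by simp
    also have "\<dots> \<le> K * ((norm (\<xi> k))\<^sup>2 + (norm (\<eta> k))\<^sup>2)"
    proof (intro mult_left_mono K)
      show "norm (\<xi> k) * norm (\<eta> k) \<le> (norm (\<xi> k))\<^sup>2 + (norm (\<eta> k))\<^sup>2"
        using sum_squares_bound[of "norm (\<xi> k)" "norm (\<eta> k)"]
          mult_nonneg_nonneg[OF norm_ge_zero[of "\<xi> k"] norm_ge_zero[of "\<eta> k"]] by linarith
    qed
    finally show ?thesis .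
  qed
  have "\<forall>\<^sub>F (k, N) in sequentially \<times>\<^sub>F sequentially.
      cmod (cinner (\<xi> k) (X N \<cdot> \<eta> k)) \<le> K * ((norm (\<xi> k))\<^sup>2 + (norm (\<eta> k))\<^sup>2)"
    by (rule always_eventually) (auto simp: b)
  then show "(\<lambda>N. \<Sum>k. cinner (\<xi> k) (X N \<cdot> \<eta> k)) \<longlonglongrightarrow> (\<Sum>k. cinner (\<xi> k) (T \<cdot> \<eta> k))"
    using tannerys_theorem[of "\<lambda>k N. cinner (\<xi> k) (X N \<cdot> \<eta> k)" "\<lambda>k. cinner (\<xi> k) (T \<cdot> \<eta> k)" sequentially
        "\<lambda>k. K * ((norm (\<xi> k))\<^sup>2 + (norm (\<eta> k))\<^sup>2)"] lim
    by (simp add: summable_add summable_mult sq)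
qed

section \<open>Normality of isomorphisms\<close>

text \<open>The commutator applied to \<open>v\<close> lies in \<open>N\<close>, and it is the
  difference of \<open>x \<cdot> (v - z \<cdot> v)\<close> and the residual of
  \<open>x \<cdot> v\<close>. Both are orthogonal to \<open>N\<close>, the first after
  \<open>x\<close> is moved to the other side as its adjoint.\<close>

lemma projection_commutes:
  fixes N :: "'h::chilbert set"
  assumes z: "\<And>v. z \<cdot> v \<in> N" "\<And>v y. y \<in> N \<Longrightarrow> cinner y (v - z \<cdot> v) = 0"
    and diff: "\<And>x y. x \<in> N \<Longrightarrow> y \<in> N \<Longrightarrow> x - y \<in> N"
    and x: "\<And>v. v \<in> N \<Longrightarrow> x \<cdot> v \<in> N" "\<And>v. v \<in> N \<Longrightarrow> x\<^sup>\<dagger> \<cdot> v \<in> N"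
  shows "z * x = x * z"
proof (rule bop_eqI)
  fix v
  let ?d = "z \<cdot> x \<cdot> v - x \<cdot> z \<cdot> v"
  have d: "?d \<in> N" by (intro diff z x)
  have "?d = x \<cdot> (v - z \<cdot> v) - (x \<cdot> v - z \<cdot> x \<cdot> v)" by (simp add: bop_diff_right)
  then have "cinner ?d ?d = cinner (x\<^sup>\<dagger> \<cdot> ?d) (v - z \<cdot> v) - cinner ?d (x \<cdot> v - z \<cdot> x \<cdot> v)"
    by (metis cinner_diff_right cinner_star_left)
  also have "\<dots> = 0" by (simp only: z(2)[OF x(2)[OF d]] z(2)[OF d]) simp
  finally show "(z * x) \<cdot> v = (x * z) \<cdot> v" by (simp add: bop_simps)
qed

text \<open>The linear span of the vectors \<open>j y \<cdot> q \<cdot> v\<close>, scalars being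
  absorbed into \<open>v\<close>.\<close>

inductive_set orbit :: "('b \<Rightarrow> 'h::chilbert bop) \<Rightarrow> 'h bop \<Rightarrow> 'h set" for j q where
  zero: "0 \<in> orbit j q"
| add: "u \<in> orbit j q \<Longrightarrow> j y \<cdot> q \<cdot> v + u \<in> orbit j q"

lemma orbit_add: "u \<in> orbit j q \<Longrightarrow> u' \<in> orbit j q \<Longrightarrow> u + u' \<in> orbit j q"
  by (induction rule: orbit.induct) (simp_all add: add.assoc orbit.add)

lemma orbit_base: "j y \<cdot> q \<cdot> v \<in> orbit j q"
  using orbit.add[OF orbit.zero, of j y q v] by simp

text \<open>With \<open>q\<close> the image of a rank-one projection, \<open>j\<close> acts on the
  span of the vectors \<open>j y \<cdot> q \<cdot> v\<close> as a multiple of the identity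
  representation: matrix elements of \<open>j T\<close> between them are multiples of matrix
  elements of \<open>T\<close>. The span is dense because the projection onto its closure is central
  and nonzero. Approximating \<Omega> from the span costs an error proportional to
  \<open>norm T\<close>.\<close>

lemma star_iso_normal:
  fixes j :: "'k::chilbert bop \<Rightarrow> 'h::chilbert bop"
  assumes j: "star_iso False UNIV M j" and M: "bicommutant M = M" and e: "0 < e"
  shows "\<exists>f. wot_functional f \<and> (\<forall>T. cmod (cinner \<Omega> (j T \<cdot> \<Omega>) - f T) \<le> e * norm T)"
proof -
  note [simp] = bop_simps
  have hom: "star_hom False UNIV j" and ran: "range j = M" and inj: "inj j"
    using j by (auto simp: star_iso_def bij_betw_def)
  have jh: "j (x + y) = j x + j y" "j (x * y) = j x * j y" "j (x\<^sup>\<dagger>) = (j x)\<^sup>\<dagger>" "j 1 = 1"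
    "j (c *\<^sub>C x) = c *\<^sub>C j x" for x y c
    using hom by (auto simp: star_hom_def)
  obtain \<xi> :: 'k where \<xi>: "cinner \<xi> \<xi> = 1" by (rule exists_unit_vector)
  define q where "q = j (butterfly \<xi> \<xi>)"
  have qq: "q * q = q" "q\<^sup>\<dagger> = q"
    by (simp_all add: q_def jh(2)[symmetric] jh(3)[symmetric] butterfly_butterfly \<xi> star_butterfly)
  have "q \<noteq> 0" using butterfly_unit_nonzero[OF \<xi>] inj jh(5)[of 0 0] unfolding q_def by (metis injD scaleC_zero_left)
  then obtain w where w: "q \<cdot> w \<noteq> 0" using bop_eqI[of q 0] by auto
  define D where "D = orbit j q"
  define N where "N = closure D"
  \<comment> \<open>An element of \<open>M\<close> is absorbed into \<open>y\<close>; an element of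
    the commutant passes \<open>j y\<close> and \<open>q\<close> and is absorbed into
    \<open>v\<close>.\<close>
  have D_inv: "x \<cdot> u \<in> D" if x: "x \<in> M \<or> x \<in> commutant M" and u: "u \<in> D" for x u
    using u unfolding D_def
  proof induction
    case (add u y v)
    have "x \<cdot> j y \<cdot> q \<cdot> v \<in> orbit j q"
    proof (cases "x \<in> M")
      case True
      then obtain x' where "x = j x'" using ran by auto
      then have "x \<cdot> j y \<cdot> q \<cdot> v = j (x' * y) \<cdot> q \<cdot> v" by (simp add: jh)
      then show ?thesis using orbit_base by metis
    next
      case False
      then have "x * j y = j y * x" "x * q = q * x" using x ran by (auto simp: commutant_def q_def)
      then have "x \<cdot> j y \<cdot> q \<cdot> v = j y \<cdot> q \<cdot> x \<cdot> v" by (metis alg_bop_apply(2))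
      then show ?thesis using orbit_base by metis
    qed
    then show ?case using add.IH by (simp add: bop_add_right orbit_add)
  qed (simp add: orbit.zero)
  have inv: "x \<cdot> u \<in> N" if x: "x \<in> M \<or> x \<in> commutant M" and u: "u \<in> N" for x u
  proof -
    have "bop_apply x ` closure D \<subseteq> closure (bop_apply x ` D)"
      using linear_continuous_on[OF bop_bounded_linear] by (intro image_closure_subset)
        (auto intro: closure_subset[THEN subsetD])
    also have "\<dots> \<subseteq> closure D" using D_inv[OF x] by (intro closure_mono) auto
    finally show ?thesis using u unfolding N_def by blast
  qed
  have Nadd: "x + y \<in> N" if xy: "x \<in> N" "y \<in> N" for x y
  proof -
    obtain X Y where "\<And>n. X n \<in> D" "X \<longlonglongrightarrow> x" "\<And>n. Y n \<in> D" "Y \<longlonglongrightarrow> y"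
      using xy unfolding N_def closure_sequential by blast
    then have "\<forall>n. X n + Y n \<in> D" "(\<lambda>n. X n + Y n) \<longlonglongrightarrow> x + y"
      by (auto simp: D_def intro: orbit_add tendsto_add)
    then show ?thesis unfolding N_def closure_sequential by (intro exI[of _ "\<lambda>n. X n + Y n"]) simp
  qed
  have Msc: "c *\<^sub>C 1 \<in> M" for c using jh(4) jh(5)[of c 1] ran by (metis rangeI)
  have Nsc: "c *\<^sub>C x \<in> N" if "x \<in> N" for c x using inv[of "c *\<^sub>C 1" x] Msc that by simp
  have Ndiff: "x - y \<in> N" if "x \<in> N" "y \<in> N" for x y
    using Nadd[OF that(1) Nsc[OF that(2), of "-1"]] by (simp add: scaleC_minus_left)
  have qw: "q \<cdot> w \<in> N"
    using orbit_base[of j 1 q w] closure_subset[of D] by (auto simp: N_def D_def jh)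
  obtain z :: "'h bop" where z: "\<And>v. z \<cdot> v \<in> N" "\<And>v y. y \<in> N \<Longrightarrow> cinner y (v - z \<cdot> v) = 0"
    using projection_exists[of N] qw Nadd Nsc unfolding N_def by (metis closed_closure empty_iff)
  have comm: "z * x = x * z" if "x \<in> M \<or> x \<in> commutant M" for x
  proof (rule projection_commutes[OF z Ndiff])
    have "x\<^sup>\<dagger> \<in> M \<or> x\<^sup>\<dagger> \<in> commutant M"
      using that ran jh(3) cstar_subalgebra_commutant[of M]
      by (auto simp: cstar_subalgebra_def image_iff) metis+
    then show "x\<^sup>\<dagger> \<cdot> v \<in> N" if "v \<in> N" for v using that by (rule inv)
    show "x \<cdot> v \<in> N" if "v \<in> N" for v using \<open>x \<in> M \<or> x \<in> commutant M\<close> that by (rule inv)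
  qed
  \<comment> \<open>As \<open>M\<close> is its own bicommutant, \<open>z\<close> has a preimage
    under \<open>j\<close>. The preimage commutes with every operator, so it is a scalar, and the
    nonzero vector \<open>q \<cdot> w\<close> fixed by \<open>z\<close> makes it 1.\<close>
  have "z \<in> bicommutant M" using comm by (auto simp: commutant_def[of "commutant M"])
  then obtain y where y: "z = j y" using M ran by auto
  have "y * x = x * y" for x
    using comm[of "j x"] ran inj by (auto simp: y jh(2)[symmetric] dest: injD)
  then obtain c where "y = c *\<^sub>C 1" using commutant_UNIV_scalar by blast
  then have zc: "z = c *\<^sub>C 1" by (simp add: y jh)
  have "z \<cdot> q \<cdot> w - q \<cdot> w = 0"
  proof -
    have "q \<cdot> w - z \<cdot> q \<cdot> w \<in> N" by (intro Ndiff qw z)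
    then have "cinner (q \<cdot> w - z \<cdot> q \<cdot> w) (q \<cdot> w - z \<cdot> q \<cdot> w) = 0" by (rule z(2))
    then show ?thesis by simp
  qed
  then have "(c - 1) *\<^sub>C q \<cdot> w = 0" by (simp add: zc scaleC_diff_left)
  then have "c = 1" using w by (simp add: scaleC_eq_0_iff)
  then have NU: "\<Omega> \<in> closure D" using z(1)[of \<Omega>] by (simp add: zc N_def)
  \<comment> \<open>Minimality of the rank-one projection collapses what stands between the two
    copies of \<open>q\<close> to a number.\<close>
  have base: "cinner (j y \<cdot> q \<cdot> v) (j T \<cdot> j y' \<cdot> q \<cdot> v') = cinner v (q \<cdot> v') * cinner (y \<cdot> \<xi>) (T \<cdot> y' \<cdot> \<xi>)"
    for y v y' v' T
  proof -
    have "cinner (j y \<cdot> q \<cdot> v) (j T \<cdot> j y' \<cdot> q \<cdot> v') = cinner v ((q * (j (y\<^sup>\<dagger>) * j T * j y') * q) \<cdot> v')"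
      by (metis (no_types, lifting) alg_bop_apply(2) cinner_star_right jh(3) qq(2))
    also have "q * (j (y\<^sup>\<dagger>) * j T * j y') * q = j (butterfly \<xi> \<xi> * (y\<^sup>\<dagger> * T * y') * butterfly \<xi> \<xi>)"
      by (simp add: q_def jh(2))
    also have "butterfly \<xi> \<xi> * (y\<^sup>\<dagger> * T * y') * butterfly \<xi> \<xi> = cinner (y \<cdot> \<xi>) (T \<cdot> y' \<cdot> \<xi>) *\<^sub>C butterfly \<xi> \<xi>"
      by (simp add: mult.assoc mult_butterfly butterfly_apply butterfly_scaleC_left cinner_star_right)
    finally show ?thesis by (simp add: jh q_def cinner_simps)
  qed
  have half: "wot_functional (\<lambda>T. cinner (j y \<cdot> q \<cdot> v) (j T \<cdot> u))" if "u \<in> D" for y v u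
    using that unfolding D_def
  proof induction
    case (add u y' v')
    then show ?case
      using wot_functional.add[of _ "cinner v (q \<cdot> v')" "y \<cdot> \<xi>" "y' \<cdot> \<xi>"]
      by (simp add: bop_add_right cinner_add_right base)
  qed (simp add: wot_functional.zero)
  have full: "wot_functional (\<lambda>T. cinner u (j T \<cdot> u'))" if "u \<in> D" "u' \<in> D" for u u'
    using that(1) unfolding D_def
  proof induction
    case (add u y v)
    then show ?case using wot_functional_add[OF half[OF that(2)] add.IH] by (simp add: cinner_add_left)
  qed (simp add: wot_functional.zero)
  \<comment> \<open>The denominator is \<open>norm \<Omega> + (norm \<Omega> + 1)\<close>, from the
    two error terms below; the cap at 1 yields
    \<open>norm u \<le> norm \<Omega> + 1\<close>.\<close>
  define d where "d = min 1 (e / (2 * norm \<Omega> + 1))"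
  have r: "0 < 2 * norm \<Omega> + 1" by (simp add: add_nonneg_pos)
  have d: "0 < d" "d \<le> 1" using e r by (auto simp: d_def)
  have d3: "d * (2 * norm \<Omega> + 1) \<le> e"
    using r unfolding d_def pos_le_divide_eq[OF r, symmetric] by simp
  obtain u where u: "u \<in> D" "dist u \<Omega> < d" using NU d(1) unfolding closure_approachable by blast
  have nu: "norm (\<Omega> - u) \<le> d" "norm u \<le> norm \<Omega> + 1"
    using u(2) d(2) norm_triangle_sub[of u \<Omega>] by (auto simp: dist_norm norm_minus_commute)
  have "cmod (cinner \<Omega> (j T \<cdot> \<Omega>) - cinner u (j T \<cdot> u)) \<le> e * norm T" for T
  proof -
    have nT: "norm (j T \<cdot> v) \<le> norm T * norm v" for v
      using norm_bop_apply[of "j T" v] star_hom_contractive[OF hom cstar_subalgebra_UNIV, of T]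
      by (meson UNIV_I mult_right_mono norm_ge_zero order_trans)
    have "cinner \<Omega> (j T \<cdot> \<Omega>) - cinner u (j T \<cdot> u) = cinner (\<Omega> - u) (j T \<cdot> \<Omega>) + cinner u (j T \<cdot> (\<Omega> - u))"
      by (simp add: cinner_simps bop_diff_right)
    also have "cmod \<dots> \<le> norm (\<Omega> - u) * (norm T * norm \<Omega>) + norm u * (norm T * norm (\<Omega> - u))"
      by (intro order_trans[OF norm_triangle_ineq] add_mono order_trans[OF cinner_cauchy_schwarz]
          mult_left_mono nT) auto
    also have "\<dots> \<le> d * (norm T * norm \<Omega>) + (norm \<Omega> + 1) * (norm T * d)"
      using nu d by (intro add_mono mult_mono) auto
    also have "\<dots> = d * (2 * norm \<Omega> + 1) * norm T" by (simp add: algebra_simps)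
    also have "\<dots> \<le> e * norm T" by (intro mult_right_mono d3) simp
    finally show ?thesis .
  qed
  then show ?thesis using full[OF u(1) u(1)] by blast
qed

section \<open>Endomorphisms with a graded system of matrix units\<close>

lemma parity_empty [simp]: "parity {} = 0"
  by (simp add: parity_def)

lemma power_commute_sign:
  fixes x y :: "'a::cstar_algebra"
  assumes "y * x = ((-1) ^ k) *\<^sub>C (x * y)"
  shows "y ^ n * x = ((-1) ^ (n * k)) *\<^sub>C (x * y ^ n)"
proof (induction n)
  case (Suc n)
  have "y ^ Suc n * x = y * (y ^ n * x)" by (simp add: mult.assoc)
  also have "\<dots> = ((-1) ^ (n * k)) *\<^sub>C (y * x * y ^ n)" by (simp add: Suc scaleC_mult_right mult.assoc)
  also have "\<dots> = ((-1) ^ (Suc n * k)) *\<^sub>C (x * y ^ Suc n)"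
    using assms by (simp add: scaleC_mult_left scaleC_scaleC power_add mult.assoc mult.commute)
  finally show ?case .
qed simp

text \<open>\<open>S n\<close> stands for the creation and annihilation operators of the site
  \<open>n\<close>, and \<open>e\<close> for the matrix units of the site 0. Odd matrix units
  anticommute with odd elements of later sites; the power of \<Gamma> in \<open>e_\<rho>\<close>
  compensates this sign, so that the twisted unit commutes with the whole range of \<rho>.\<close>

locale graded_translation =
  fixes \<rho> :: "'h::chilbert bop \<Rightarrow> 'h bop" and \<Gamma> :: "'h bop"
    and e :: "'d::finite set \<Rightarrow> 'd set \<Rightarrow> 'h bop" and S :: "nat \<Rightarrow> 'h bop set"
  assumes \<Gamma>_star: "\<Gamma>\<^sup>\<dagger> = \<Gamma>" and \<Gamma>_square: "\<Gamma> * \<Gamma> = 1"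
    and \<rho>_hom: "star_hom False UNIV \<rho>" and \<rho>_inj: "inj \<rho>"
    and e_mult: "e \<mu> \<nu> * e \<kappa> \<eta> = (if \<nu> = \<kappa> then e \<mu> \<eta> else 0)"
    and e_star: "(e \<mu> \<nu>)\<^sup>\<dagger> = e \<nu> \<mu>"
    and e_sum: "(\<Sum>\<mu>\<in>UNIV. e \<mu> \<mu>) = 1"
    and e_parity: "\<Gamma> * e \<mu> \<nu> * \<Gamma> = ((-1) ^ (parity \<mu> + parity \<nu>)) *\<^sub>C e \<mu> \<nu>"
    and e_\<rho>: "e \<mu> \<nu> * \<Gamma> ^ (parity \<mu> + parity \<nu>) * \<rho> y = \<rho> y * (e \<mu> \<nu> * \<Gamma> ^ (parity \<mu> + parity \<nu>))"
    and S_odd: "s \<in> S n \<Longrightarrow> \<Gamma> * s * \<Gamma> = - s"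
    and S_Suc: "S (Suc n) = \<rho> ` S n"
    and S_zero: "s \<in> S 0 \<Longrightarrow> \<exists>c. s = (\<Sum>\<mu>\<in>UNIV. \<Sum>\<nu>\<in>UNIV. c \<mu> \<nu> *\<^sub>C e \<mu> \<nu>)"
    and irreducible: "(\<And>n s. s \<in> S n \<Longrightarrow> x * s = s * x) \<Longrightarrow> \<exists>c. x = c *\<^sub>C 1"
begin

lemma \<rho>_simps:
  "\<rho> 1 = 1" "\<rho> (x + y) = \<rho> x + \<rho> y" "\<rho> (x * y) = \<rho> x * \<rho> y" "\<rho> (x\<^sup>\<dagger>) = (\<rho> x)\<^sup>\<dagger>"
  "\<rho> (c *\<^sub>C x) = c *\<^sub>C \<rho> x"
  using \<rho>_hom by (auto simp: star_hom_def)

lemma \<Gamma>_cancel [simp]: "\<Gamma> * (\<Gamma> * x) = x"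
  by (simp add: \<Gamma>_square flip: mult.assoc)

lemma \<Gamma>_power_square: "\<Gamma> ^ n * \<Gamma> ^ n = 1"
  by (simp add: power_add[symmetric] mult_2[symmetric] power_mult power2_eq_square \<Gamma>_square)

lemma \<Gamma>_power_cancel [simp]: "\<Gamma> ^ n * (\<Gamma> ^ n * x) = x"
  by (simp add: \<Gamma>_power_square flip: mult.assoc)

lemma \<Gamma>_power_star [simp]: "(\<Gamma> ^ n)\<^sup>\<dagger> = \<Gamma> ^ n"
  by (simp add: star_power \<Gamma>_star)

text \<open>Only \<open>k\<close> modulo 2 matters; as a natural number it simply adds up along
  products.\<close>

definition homogeneous :: "nat \<Rightarrow> 'h bop \<Rightarrow> bool" where
  "homogeneous k x \<longleftrightarrow> \<Gamma> * x = ((-1) ^ k) *\<^sub>C (x * \<Gamma>)"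

lemma homogeneous_conj: "homogeneous k x \<longleftrightarrow> \<Gamma> * x * \<Gamma> = ((-1) ^ k) *\<^sub>C x"
proof
  assume "homogeneous k x"
  then show "\<Gamma> * x * \<Gamma> = ((-1) ^ k) *\<^sub>C x"
    by (simp add: homogeneous_def scaleC_mult_left mult.assoc \<Gamma>_square)
next
  assume "\<Gamma> * x * \<Gamma> = ((-1) ^ k) *\<^sub>C x"
  then have "\<Gamma> * x * \<Gamma> * \<Gamma> = ((-1) ^ k) *\<^sub>C (x * \<Gamma>)" by (simp add: scaleC_mult_left)
  then show "homogeneous k x" by (simp add: homogeneous_def mult.assoc \<Gamma>_square)
qed

lemma homogeneous_mult:
  assumes "homogeneous k x" "homogeneous l y"
  shows "homogeneous (k + l) (x * y)"
proof -
  have "\<Gamma> * (x * y) = \<Gamma> * x * y" by (simp add: mult.assoc)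
  also have "\<dots> = ((-1) ^ k) *\<^sub>C (x * (\<Gamma> * y))"
    using assms(1) by (simp add: homogeneous_def scaleC_mult_left mult.assoc)
  also have "\<dots> = ((-1) ^ (k + l)) *\<^sub>C (x * y * \<Gamma>)"
    using assms(2) by (simp add: homogeneous_def scaleC_mult_right scaleC_scaleC power_add mult.assoc)
  finally show ?thesis by (simp add: homogeneous_def)
qed

lemma homogeneous_star:
  assumes "homogeneous k x" shows "homogeneous k (x\<^sup>\<dagger>)"
proof -
  have "(\<Gamma> * x * \<Gamma>)\<^sup>\<dagger> = (((-1) ^ k) *\<^sub>C x)\<^sup>\<dagger>" using assms by (simp add: homogeneous_conj)
  then show ?thesis by (simp add: homogeneous_conj star_mult star_scaleC \<Gamma>_star mult.assoc)
qed

lemma homogeneous_one: "homogeneous 0 1"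
  by (simp add: homogeneous_def)

lemma homogeneous_prod_list:
  assumes "\<And>i. homogeneous (k i) (f i)"
  shows "homogeneous (sum_list (map k xs)) (prod_list (map f xs))"
  by (induction xs) (auto simp: homogeneous_one intro: homogeneous_mult assms)

lemma homogeneous_power: "homogeneous k x \<Longrightarrow> \<Gamma> ^ n * x = ((-1) ^ (n * k)) *\<^sub>C (x * \<Gamma> ^ n)"
  unfolding homogeneous_def by (rule power_commute_sign)

lemma homogeneous_power_conj:
  assumes "homogeneous k x"
  shows "\<Gamma> ^ n * (x * \<Gamma> ^ n) = ((-1) ^ (n * k)) *\<^sub>C x"
proof -
  have "\<Gamma> ^ n * (x * \<Gamma> ^ n) = \<Gamma> ^ n * x * \<Gamma> ^ n" by (simp only: mult.assoc)
  then show ?thesis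
    unfolding homogeneous_power[OF assms] by (simp add: scaleC_mult_left mult.assoc \<Gamma>_power_square)
qed

lemma e_homogeneous: "homogeneous (parity \<mu> + parity \<nu>) (e \<mu> \<nu>)"
  by (simp add: homogeneous_conj e_parity)

lemma S_homogeneous: "s \<in> S n \<Longrightarrow> homogeneous 1 s"
  by (simp add: homogeneous_conj S_odd scaleC_minus_left)

lemma \<rho>_S: "s \<in> S n \<Longrightarrow> \<rho> s \<in> S (Suc n)"
  by (simp add: S_Suc)

lemma e_\<rho>_odd:
  assumes "s \<in> S n"
  shows "e \<mu> \<nu> * \<rho> s = ((-1) ^ (parity \<mu> + parity \<nu>)) *\<^sub>C (\<rho> s * e \<mu> \<nu>)"
proof -
  let ?k = "parity \<mu> + parity \<nu>"
  have "\<rho> s * e \<mu> \<nu> = \<rho> s * (e \<mu> \<nu> * \<Gamma> ^ ?k) * \<Gamma> ^ ?k" by (simp add: mult.assoc \<Gamma>_power_square)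
  also have "\<dots> = e \<mu> \<nu> * (\<Gamma> ^ ?k * (\<rho> s * \<Gamma> ^ ?k))"
    by (simp add: e_\<rho>[symmetric] mult.assoc)
  also have "\<dots> = ((-1) ^ ?k) *\<^sub>C (e \<mu> \<nu> * \<rho> s)"
    using homogeneous_power_conj[OF S_homogeneous[OF \<rho>_S[OF assms]], of ?k]
    by (simp add: scaleC_mult_right)
  finally show ?thesis by (simp add: scaleC_scaleC flip: power_mult_distrib)
qed

text \<open>Generators of the site 0 are combinations of the matrix units, and those of every later
  site are images under \<rho>.\<close>

lemma irreducible_units:
  assumes e: "\<And>\<mu> \<nu>. x * e \<mu> \<nu> = e \<mu> \<nu> * x" and s: "\<And>n s. s \<in> S n \<Longrightarrow> x * \<rho> s = \<rho> s * x"
  shows "\<exists>c. x = c *\<^sub>C 1"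
proof (rule irreducible)
  fix n s assume "s \<in> S n"
  then show "x * s = s * x"
  proof (cases n)
    case 0
    then obtain c where "s = (\<Sum>\<mu>\<in>UNIV. \<Sum>\<nu>\<in>UNIV. c \<mu> \<nu> *\<^sub>C e \<mu> \<nu>)"
      using \<open>s \<in> S n\<close> S_zero by blast
    then show ?thesis
      by (simp add: sum_distrib_left sum_distrib_right scaleC_mult_left scaleC_mult_right e)
  qed (use \<open>s \<in> S n\<close> s in \<open>auto simp: S_Suc\<close>)
qed

text \<open>The map \<open>b\<close> is isometric because \<rho> respects products of rank-one
  operators and \<open>q\<close> fixes \<eta>; it intertwines because
  \<open>y * butterfly v \<xi> = butterfly (y \<cdot> v) \<xi>\<close>.\<close>

lemma exists_vacuum_isometry:
  obtains B\<^sub>0 where "B\<^sub>0\<^sup>\<dagger> * B\<^sub>0 = 1" "\<And>y. B\<^sub>0 * y = \<rho> y * B\<^sub>0" "e {} {} * B\<^sub>0 = B\<^sub>0"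
proof -
  note [simp] = bop_simps
  obtain \<xi> :: 'h where \<xi>: "cinner \<xi> \<xi> = 1" by (rule exists_unit_vector)
  define q where "q = \<rho> (butterfly \<xi> \<xi>)"
  have qq: "q * q = q" by (simp add: q_def \<rho>_simps(3)[symmetric] butterfly_butterfly \<xi>)
  have e0: "e {} {} * \<rho> y = \<rho> y * e {} {}" for y using e_\<rho>[of "{}" "{}" y] by simp
  \<comment> \<open>The twisted units commute with \<open>q\<close> and connect the vacuum with
    every \<mu>. If \<open>q\<close> vanished on the vacuum projection, it would vanish on every
    \<open>e \<mu> \<mu>\<close> and so be zero, against injectivity of \<rho>.\<close>
  have "q * e {} {} \<noteq> 0"
  proof
    assume 0: "q * e {} {} = 0"
    have "q * e \<mu> \<mu> = 0" for \<mu>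
    proof -
      let ?k = "parity \<mu>"
      have c: "q * (e \<mu> {} * \<Gamma> ^ ?k) = e \<mu> {} * \<Gamma> ^ ?k * q"
        using e_\<rho>[of \<mu> "{}" "butterfly \<xi> \<xi>"] by (simp add: q_def)
      have "q * e \<mu> \<mu> = q * (e \<mu> {} * \<Gamma> ^ ?k) * (\<Gamma> ^ ?k * e {} \<mu>)"
        by (simp add: mult.assoc e_mult)
      also have "\<dots> = e \<mu> {} * \<Gamma> ^ ?k * (q * (\<Gamma> ^ ?k * e {} \<mu>))"
        unfolding c by (simp only: mult.assoc)
      also have "e \<mu> {} * \<Gamma> ^ ?k = e \<mu> {} * \<Gamma> ^ ?k * e {} {}"
        using homogeneous_power[OF e_homogeneous[of "{}" "{}"], of ?k] by (simp add: mult.assoc e_mult flip: mult.assoc[of "e \<mu> {}"])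
      also have "e \<mu> {} * \<Gamma> ^ ?k * e {} {} * (q * (\<Gamma> ^ ?k * e {} \<mu>)) =
          e \<mu> {} * \<Gamma> ^ ?k * (e {} {} * q) * (\<Gamma> ^ ?k * e {} \<mu>)" by (simp add: mult.assoc)
      also have "e {} {} * q = 0" using 0 e0 by (simp add: q_def)
      finally show ?thesis by simp
    qed
    then have "q * (\<Sum>\<mu>\<in>UNIV. e \<mu> \<mu>) = 0" by (simp add: sum_distrib_left)
    then have "q = \<rho> 0" using \<rho>_simps(5)[of 0 0] by (simp add: e_sum)
    then have "butterfly \<xi> \<xi> = 0" using \<rho>_inj by (auto simp: q_def dest: injD)
    then show False using butterfly_unit_nonzero[OF \<xi>] by simp
  qed
  then obtain w where w: "(q * e {} {}) \<cdot> w \<noteq> 0" using bop_eqI[of "q * e {} {}" 0] by auto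
  define \<eta> where "\<eta> = complex_of_real (1 / norm ((q * e {} {}) \<cdot> w)) *\<^sub>C ((q * e {} {}) \<cdot> w)"
  have n\<eta>: "cinner \<eta> \<eta> = 1" using w by (simp add: cinner_self \<eta>_def norm_scaleC norm_divide)
  have "q * (q * e {} {}) = q * e {} {}" by (simp add: qq flip: mult.assoc)
  moreover have "e {} {} * (q * e {} {}) = q * (e {} {} * e {} {})"
    using e0[of "butterfly \<xi> \<xi>"] unfolding q_def[symmetric] mult.assoc[symmetric] by simp
  then have "e {} {} * (q * e {} {}) = q * e {} {}" by (simp add: e_mult)
  ultimately have \<eta>: "q \<cdot> \<eta> = \<eta>" "e {} {} \<cdot> \<eta> = \<eta>"
    unfolding \<eta>_def bop_scaleC alg_bop_apply(2)[symmetric] by simp_all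
  define b where "b v = \<rho> (butterfly v \<xi>) \<cdot> \<eta>" for v
  have b_inner: "cinner (b v) (b w) = cinner v w" for v w
  proof -
    have "cinner (b v) (b w) = cinner \<eta> (\<rho> ((butterfly v \<xi>)\<^sup>\<dagger> * butterfly w \<xi>) \<cdot> \<eta>)"
      unfolding b_def by (metis \<rho>_simps(3,4) alg_bop_apply(2) cinner_star_right)
    also have "\<dots> = cinner v w"
      by (simp add: star_butterfly butterfly_butterfly \<rho>_simps q_def[symmetric] \<eta> cinner_simps n\<eta>)
    finally show ?thesis .
  qed
  have bC: "b (c *\<^sub>C v) = c *\<^sub>C b v" for c v
    by (simp add: b_def butterfly_scaleC_left \<rho>_simps)
  have "bounded_linear b"
  proof (rule bounded_linear_intro[of _ 1])
    show "b (v + w) = b v + b w" for v w by (simp add: b_def butterfly_add_left \<rho>_simps)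
    show "b (r *\<^sub>R v) = r *\<^sub>R b v" for r v by (simp add: scaleR_eq_scaleC bC)
    have "(norm (b v))\<^sup>2 = (norm v)\<^sup>2" for v by (simp add: norm_sq_cinner b_inner)
    then show "norm (b v) \<le> norm v * 1" for v by simp
  qed
  then obtain B where B: "bop_apply B = b" using bop_exists[of b] bC by blast
  show ?thesis
  proof (rule that[of B])
    show "B\<^sup>\<dagger> * B = 1" by (rule bop_cinner_eqI) (simp add: cinner_star_right B b_inner)
    show "B * y = \<rho> y * B" for y
      by (rule bop_eqI) (simp add: B b_def mult_butterfly[symmetric] \<rho>_simps)
    show "e {} {} * B = B"
    proof (rule bop_eqI)
      fix v
      have "(e {} {} * \<rho> (butterfly v \<xi>)) \<cdot> \<eta> = (\<rho> (butterfly v \<xi>) * e {} {}) \<cdot> \<eta>" by (simp only: e0)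
      then show "(e {} {} * B) \<cdot> v = B \<cdot> v" by (simp add: B b_def \<eta>)
    qed
  qed
qed

end

section \<open>The isometries \<open>B \<mu>\<close>: completeness, parity and the formula for
  \<rho>\<close>

locale cuntz_isometries = graded_translation +
  fixes B\<^sub>0
  assumes B\<^sub>0_isometry: "B\<^sub>0\<^sup>\<dagger> * B\<^sub>0 = 1" and B\<^sub>0_intertwines: "B\<^sub>0 * y = \<rho> y * B\<^sub>0"
    and e_B\<^sub>0: "e {} {} * B\<^sub>0 = B\<^sub>0"
begin

definition B where "B \<mu> = e \<mu> {} * B\<^sub>0"

definition T where "T y = (\<Sum>\<mu>\<in>UNIV. B \<mu> * y * (B \<mu>)\<^sup>\<dagger>)"

lemma B\<^sub>0_star_\<rho>: "B\<^sub>0\<^sup>\<dagger> * \<rho> y = y * B\<^sub>0\<^sup>\<dagger>"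
  using arg_cong[OF B\<^sub>0_intertwines[of "y\<^sup>\<dagger>"], of star] by (simp add: star_mult star_star \<rho>_simps)

lemma B_empty: "B {} = B\<^sub>0"
  by (simp add: B_def e_B\<^sub>0)

lemma B_star: "(B \<mu>)\<^sup>\<dagger> = B\<^sub>0\<^sup>\<dagger> * e {} \<mu>"
  by (simp add: B_def star_mult e_star)

lemma B_orthogonal: "(B \<nu>)\<^sup>\<dagger> * B \<mu> = (if \<mu> = \<nu> then 1 else 0)"
proof -
  have "(B \<nu>)\<^sup>\<dagger> * B \<mu> = B\<^sub>0\<^sup>\<dagger> * (e {} \<nu> * e \<mu> {}) * B\<^sub>0"
    unfolding B_star unfolding B_def by (simp only: mult.assoc)
  then show ?thesis by (auto simp: e_mult mult.assoc e_B\<^sub>0 B\<^sub>0_isometry)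
qed

text \<open>The sum commutes with the matrix units, and with each \<open>\<rho> s\<close> because
  the signs from \<open>e \<kappa> {}\<close> and \<open>e {} \<kappa>\<close> cancel. By
  irreducibility it is a scalar, and its action on \<open>B {}\<close> identifies the
  scalar.\<close>

lemma B_sum: "(\<Sum>\<mu>\<in>UNIV. B \<mu> * (B \<mu>)\<^sup>\<dagger>) = 1"
proof -
  define P where "P = (\<Sum>\<mu>\<in>UNIV. B \<mu> * (B \<mu>)\<^sup>\<dagger>)"
  have P: "P = (\<Sum>\<kappa>\<in>UNIV. e \<kappa> {} * (B\<^sub>0 * B\<^sub>0\<^sup>\<dagger>) * e {} \<kappa>)"
    unfolding P_def B_star unfolding B_def by (simp only: mult.assoc)
  have "P * e \<mu> \<nu> = e \<mu> \<nu> * P" for \<mu> \<nu>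
  proof -
    have "P * e \<mu> \<nu> = (\<Sum>\<kappa>\<in>UNIV. if \<kappa> = \<mu> then e \<mu> {} * (B\<^sub>0 * B\<^sub>0\<^sup>\<dagger>) * e {} \<nu> else 0)"
      unfolding P sum_distrib_right by (intro sum.cong) (auto simp: mult.assoc e_mult)
    moreover have "e \<mu> \<nu> * P = (\<Sum>\<kappa>\<in>UNIV. if \<kappa> = \<nu> then e \<mu> {} * (B\<^sub>0 * B\<^sub>0\<^sup>\<dagger>) * e {} \<nu> else 0)"
      unfolding P sum_distrib_left by (intro sum.cong) (auto simp: e_mult simp flip: mult.assoc)
    ultimately show ?thesis by simp
  qed
  moreover have "P * \<rho> s = \<rho> s * P" if s: "s \<in> S n" for n s
  proof -
    have "e \<kappa> {} * (B\<^sub>0 * B\<^sub>0\<^sup>\<dagger>) * e {} \<kappa> * \<rho> s = \<rho> s * (e \<kappa> {} * (B\<^sub>0 * B\<^sub>0\<^sup>\<dagger>) * e {} \<kappa>)" for \<kappa>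
    proof -
      let ?c = "(-1) ^ parity \<kappa> :: complex"
      have "e \<kappa> {} * (B\<^sub>0 * B\<^sub>0\<^sup>\<dagger>) * e {} \<kappa> * \<rho> s = e \<kappa> {} * B\<^sub>0 * (B\<^sub>0\<^sup>\<dagger> * (e {} \<kappa> * \<rho> s))"
        by (simp add: mult.assoc)
      also have "\<dots> = ?c *\<^sub>C (e \<kappa> {} * B\<^sub>0 * (B\<^sub>0\<^sup>\<dagger> * \<rho> s * e {} \<kappa>))"
        using e_\<rho>_odd[OF s, of "{}" \<kappa>] by (simp add: scaleC_mult_right mult.assoc)
      also have "\<dots> = ?c *\<^sub>C (e \<kappa> {} * (B\<^sub>0 * s) * B\<^sub>0\<^sup>\<dagger> * e {} \<kappa>)"
        unfolding B\<^sub>0_star_\<rho> by (simp add: mult.assoc)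
      also have "\<dots> = ?c *\<^sub>C (e \<kappa> {} * \<rho> s * (B\<^sub>0 * (B\<^sub>0\<^sup>\<dagger> * e {} \<kappa>)))"
        unfolding B\<^sub>0_intertwines[of s] by (simp add: mult.assoc)
      also have "\<dots> = \<rho> s * (e \<kappa> {} * (B\<^sub>0 * B\<^sub>0\<^sup>\<dagger>) * e {} \<kappa>)"
        using e_\<rho>_odd[OF s, of \<kappa> "{}"]
        by (simp add: scaleC_mult_left scaleC_scaleC mult.assoc flip: power_mult_distrib)
      finally show ?thesis .
    qed
    then show ?thesis unfolding P sum_distrib_left sum_distrib_right by simp
  qed
  ultimately obtain c where c: "P = c *\<^sub>C 1" using irreducible_units by blast
  have "B \<mu> * (B \<mu>)\<^sup>\<dagger> * B {} = (if \<mu> = {} then B {} else 0)" for \<mu>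
    by (simp add: mult.assoc B_orthogonal)
  then have "P * B {} = B {}" by (simp add: P_def sum_distrib_right)
  then have "c *\<^sub>C B {} = B {}" by (simp add: c scaleC_mult_left)
  then have "c *\<^sub>C (B {})\<^sup>\<dagger> * B {} = (B {})\<^sup>\<dagger> * B {}" by (simp add: scaleC_mult_left flip: scaleC_mult_right)
  then have "(c - 1) *\<^sub>C (1::'a bop) = 0" by (simp add: B_orthogonal scaleC_diff_left scaleC_mult_left)
  then show ?thesis using c by (simp add: scaleC_eq_0_iff P_def)
qed

text \<open>Multiplicity one: multiplying the completeness relation by \<open>e {} {}\<close> keeps
  only the term of the empty set, so \<open>B\<^sub>0\<close> fills the whole range of the vacuum
  projection.\<close>

lemma B\<^sub>0_B\<^sub>0_star: "B\<^sub>0 * B\<^sub>0\<^sup>\<dagger> = e {} {}"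
proof -
  have "e {} {} * B \<mu> = (if \<mu> = {} then B\<^sub>0 else 0)" for \<mu>
    by (simp add: B_def e_mult e_B\<^sub>0 flip: mult.assoc)
  then have "e {} {} * (B \<mu> * (B \<mu>)\<^sup>\<dagger>) = (if \<mu> = {} then B\<^sub>0 * B\<^sub>0\<^sup>\<dagger> else 0)" for \<mu>
    by (simp add: B_empty flip: mult.assoc)
  then have "e {} {} * (\<Sum>\<mu>\<in>UNIV. B \<mu> * (B \<mu>)\<^sup>\<dagger>) = B\<^sub>0 * B\<^sub>0\<^sup>\<dagger>"
    unfolding sum_distrib_left by simp
  then show ?thesis by (simp add: B_sum)
qed

lemma B_B_star: "B \<mu> * (B \<nu>)\<^sup>\<dagger> = e \<mu> \<nu>"
proof -
  have "B \<mu> * (B \<nu>)\<^sup>\<dagger> = e \<mu> {} * (B\<^sub>0 * B\<^sub>0\<^sup>\<dagger>) * e {} \<nu>"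
    unfolding B_star unfolding B_def by (simp only: mult.assoc)
  then show ?thesis by (simp add: B\<^sub>0_B\<^sub>0_star e_mult)
qed

text \<open>\<open>\<Gamma> * B\<^sub>0 * \<Gamma>\<close> intertwines like \<open>B\<^sub>0\<close>, so by irreducibility the two differ by a scalar.\<close>

lemma exists_parity: "\<exists>\<sigma>\<in>{0, 1}. \<forall>\<mu>. homogeneous (parity \<mu> + \<sigma>) (B \<mu>)"
proof -
  define X where "X = B\<^sub>0\<^sup>\<dagger> * \<Gamma> * B\<^sub>0 * \<Gamma>"
  have "X * s = s * X" if s: "s \<in> S n" for n s
  proof -
    have 1: "\<Gamma> * s = - (s * \<Gamma>)" "\<Gamma> * \<rho> s = - (\<rho> s * \<Gamma>)"
      using S_homogeneous[OF s] S_homogeneous[OF \<rho>_S[OF s]]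
      by (simp_all add: homogeneous_def scaleC_minus_left)
    have "X * s = - (B\<^sub>0\<^sup>\<dagger> * \<Gamma> * (B\<^sub>0 * s) * \<Gamma>)" unfolding X_def mult.assoc 1 by simp
    also have "\<dots> = - (B\<^sub>0\<^sup>\<dagger> * (\<Gamma> * \<rho> s) * B\<^sub>0 * \<Gamma>)" unfolding B\<^sub>0_intertwines by (simp add: mult.assoc)
    also have "\<dots> = (B\<^sub>0\<^sup>\<dagger> * \<rho> s) * \<Gamma> * B\<^sub>0 * \<Gamma>" unfolding 1 by (simp add: mult.assoc)
    also have "\<dots> = s * X" unfolding B\<^sub>0_star_\<rho> by (simp add: X_def mult.assoc)
    finally show ?thesis .
  qed
  then obtain x where x: "X = x *\<^sub>C 1" using irreducible by blast
  have "\<Gamma> * B\<^sub>0 * \<Gamma> = x *\<^sub>C B\<^sub>0"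
  proof -
    have "x *\<^sub>C B\<^sub>0 = B\<^sub>0 * X" by (simp add: x scaleC_mult_right)
    also have "\<dots> = e {} {} * \<Gamma> * B\<^sub>0 * \<Gamma>" by (simp add: X_def B\<^sub>0_B\<^sub>0_star flip: mult.assoc)
    also have "e {} {} * \<Gamma> = \<Gamma> * e {} {}" using e_homogeneous[of "{}" "{}"] by (simp add: homogeneous_def)
    finally show ?thesis by (simp add: mult.assoc) (simp add: e_B\<^sub>0 flip: mult.assoc)
  qed
  note gb = this
  have "B\<^sub>0 = \<Gamma> * (\<Gamma> * B\<^sub>0 * \<Gamma>) * \<Gamma>" by (simp add: mult.assoc \<Gamma>_square)
  also have "\<dots> = (x * x) *\<^sub>C B\<^sub>0" by (simp add: gb scaleC_mult_left scaleC_mult_right scaleC_scaleC)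
  finally have "(x * x - 1) *\<^sub>C B\<^sub>0 = 0" by (simp add: scaleC_diff_left)
  moreover have "B\<^sub>0 \<noteq> 0" using B\<^sub>0_isometry by auto
  ultimately have "x * x = 1" by (simp add: scaleC_eq_0_iff)
  \<comment> \<open>Conjugation by \<Gamma> is an involution, which is why the scalar squares to 1;
    its sign is the common parity \<sigma>.\<close>
  then have "x = 1 \<or> x = -1" using square_eq_1_iff by blast
  then obtain \<sigma> where \<sigma>: "\<sigma> \<in> {0, 1}" "x = (-1) ^ \<sigma>" by fastforce
  then have "homogeneous \<sigma> B\<^sub>0" using gb by (simp add: homogeneous_conj)
  then have "homogeneous (parity \<mu> + \<sigma>) (B \<mu>)" for \<mu>
    unfolding B_def using homogeneous_mult[OF e_homogeneous[of \<mu> "{}"]] by simp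
  then show ?thesis using \<sigma> by blast
qed

text \<open>The twisted unit passes \<open>\<rho> y\<close> freely. The compensating powers of
  \<Gamma> are moved through \<open>B\<^sub>0\<close> before and after the intertwining relation is
  used, so the sign from the parity of \<open>B\<^sub>0\<close> occurs twice.\<close>

lemma \<rho>_B: "\<rho> y * B \<nu> = B \<nu> * (\<Gamma> ^ parity \<nu> * y * \<Gamma> ^ parity \<nu>)"
proof -
  obtain \<sigma> where B: "\<And>\<mu>. homogeneous (parity \<mu> + \<sigma>) (B \<mu>)" using exists_parity by blast
  have \<sigma>: "\<Gamma> ^ n * B\<^sub>0 = ((-1) ^ (n * \<sigma>)) *\<^sub>C (B\<^sub>0 * \<Gamma> ^ n)" for n
    using homogeneous_power[OF B[of "{}"]] by (simp add: B_empty)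
  let ?k = "parity \<nu>" let ?c = "(-1) ^ (?k * \<sigma>) :: complex"
  have "\<rho> y * B \<nu> = \<rho> y * (e \<nu> {} * \<Gamma> ^ ?k) * (\<Gamma> ^ ?k * B\<^sub>0)"
    by (simp add: B_def mult.assoc)
  also have "\<dots> = e \<nu> {} * \<Gamma> ^ ?k * \<rho> y * (\<Gamma> ^ ?k * B\<^sub>0)"
    using e_\<rho>[of \<nu> "{}" y] by simp
  also have "\<dots> = ?c *\<^sub>C (e \<nu> {} * \<Gamma> ^ ?k * (\<rho> y * B\<^sub>0) * \<Gamma> ^ ?k)"
    unfolding \<sigma> by (simp add: scaleC_mult_right mult.assoc)
  also have "\<dots> = ?c *\<^sub>C (e \<nu> {} * (\<Gamma> ^ ?k * B\<^sub>0) * y * \<Gamma> ^ ?k)"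
    unfolding B\<^sub>0_intertwines[symmetric] by (simp add: mult.assoc)
  also have "\<dots> = B \<nu> * (\<Gamma> ^ ?k * y * \<Gamma> ^ ?k)"
    unfolding \<sigma> by (simp add: B_def scaleC_mult_left scaleC_mult_right scaleC_scaleC mult.assoc flip: power_mult_distrib)
  finally show ?thesis .
qed

lemma B_star_\<rho>: "(B \<nu>)\<^sup>\<dagger> * \<rho> y = \<Gamma> ^ parity \<nu> * y * \<Gamma> ^ parity \<nu> * (B \<nu>)\<^sup>\<dagger>"
  using arg_cong[OF \<rho>_B[of "y\<^sup>\<dagger>" \<nu>], of star]
  by (simp add: star_mult star_star \<rho>_simps mult.assoc)

lemma \<rho>_eq: "\<rho> y = (\<Sum>\<mu>\<in>UNIV. Ad (B \<mu> * \<Gamma> ^ parity \<mu>) y)"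
proof -
  have "\<rho> y = \<rho> y * (\<Sum>\<mu>\<in>UNIV. B \<mu> * (B \<mu>)\<^sup>\<dagger>)" by (simp add: B_sum)
  also have "\<dots> = (\<Sum>\<mu>\<in>UNIV. \<rho> y * B \<mu> * (B \<mu>)\<^sup>\<dagger>)" by (simp add: sum_distrib_left mult.assoc)
  also have "\<dots> = (\<Sum>\<mu>\<in>UNIV. Ad (B \<mu> * \<Gamma> ^ parity \<mu>) y)"
    unfolding \<rho>_B by (simp add: Ad_def star_mult mult.assoc)
  finally show ?thesis .
qed

text \<open>Exchanging the two factors costs a sign, which \<open>Ad\<close> does not see.\<close>

lemma \<rho>_eq': "\<rho> y = (\<Sum>\<mu>\<in>UNIV. Ad (\<Gamma> ^ parity \<mu> * B \<mu>) y)"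
proof -
  obtain \<sigma> where \<sigma>: "\<And>\<mu>. homogeneous (parity \<mu> + \<sigma>) (B \<mu>)" using exists_parity by blast
  have "Ad (\<Gamma> ^ parity \<mu> * B \<mu>) y = Ad (B \<mu> * \<Gamma> ^ parity \<mu>) y" for \<mu>
    unfolding homogeneous_power[OF \<sigma>]
    by (simp add: Ad_def star_scaleC scaleC_mult_left scaleC_mult_right scaleC_scaleC flip: power_mult_distrib)
  then show ?thesis by (simp add: \<rho>_eq)
qed

section \<open>The map \<open>T\<close>: asymptotic commutation, contractivity and mixing\<close>

lemma T_B: "T y * B \<mu> = B \<mu> * y"
proof -
  have "T y * B \<mu> = (\<Sum>\<nu>\<in>UNIV. if \<nu> = \<mu> then B \<mu> * y else 0)"
    unfolding T_def sum_distrib_right by (intro sum.cong) (auto simp: mult.assoc B_orthogonal)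
  then show ?thesis by simp
qed

lemma B_star_T: "(B \<mu>)\<^sup>\<dagger> * T y = y * (B \<mu>)\<^sup>\<dagger>"
proof -
  have "(B \<mu>)\<^sup>\<dagger> * T y = (\<Sum>\<nu>\<in>UNIV. if \<nu> = \<mu> then y * (B \<mu>)\<^sup>\<dagger> else 0)"
    unfolding T_def sum_distrib_left by (intro sum.cong) (auto simp: B_orthogonal simp flip: mult.assoc)
  then show ?thesis by simp
qed

lemma T_commutes_e: "T y * e \<mu> \<nu> = e \<mu> \<nu> * T y"
proof -
  have "T y * e \<mu> \<nu> = B \<mu> * y * (B \<nu>)\<^sup>\<dagger>" by (simp add: B_B_star[symmetric] T_B flip: mult.assoc)
  also have "\<dots> = B \<mu> * ((B \<nu>)\<^sup>\<dagger> * T y)" by (simp add: B_star_T mult.assoc)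
  finally show ?thesis by (simp add: B_B_star flip: mult.assoc)
qed

text \<open>Values of \<open>T\<close> commute with the matrix units of the site 0. For later sites,
  \<open>\<rho> s'\<close> passes each summand of \<open>T z\<close> from the left and from the
  right with the same sign, so every application of \<open>T\<close> adds one site to what its
  values commute with.\<close>

lemma T_power_commutes: "s \<in> S n \<Longrightarrow> n < N \<Longrightarrow> (T ^^ N) y * s = s * (T ^^ N) y"
proof (induction n arbitrary: s N)
  case 0
  then obtain m where "N = Suc m" by (cases N) auto
  moreover obtain c where "s = (\<Sum>\<mu>\<in>UNIV. \<Sum>\<nu>\<in>UNIV. c \<mu> \<nu> *\<^sub>C e \<mu> \<nu>)" using S_zero 0 by blast
  ultimately show ?case
    by (simp add: sum_distrib_left sum_distrib_right scaleC_mult_left scaleC_mult_right T_commutes_e)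
next
  case (Suc n)
  then obtain m where m: "N = Suc m" "n < m" by (cases N) auto
  obtain s' where s': "s' \<in> S n" "s = \<rho> s'" using Suc.prems by (auto simp: S_Suc)
  define z where "z = (T ^^ m) y"
  have z: "z * s' = s' * z" using Suc.IH[OF s'(1) m(2)] by (simp add: z_def)
  have k: "\<Gamma> ^ k * s' * \<Gamma> ^ k = ((-1) ^ k) *\<^sub>C s'" for k
    using homogeneous_power_conj[OF S_homogeneous[OF s'(1)], of k] by (simp add: mult.assoc)
  have k': "\<Gamma> ^ k * (s' * (\<Gamma> ^ k * x)) = ((-1) ^ k) *\<^sub>C (s' * x)" for k x
    using arg_cong[OF k[of k], of "\<lambda>u. u * x"] by (simp add: scaleC_mult_left mult.assoc)
  have "T z * \<rho> s' = (\<Sum>\<mu>\<in>UNIV. ((-1) ^ parity \<mu>) *\<^sub>C (B \<mu> * (z * s') * (B \<mu>)\<^sup>\<dagger>))"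
    unfolding T_def sum_distrib_right
    by (intro sum.cong refl) (simp add: mult.assoc B_star_\<rho> k' scaleC_mult_right)
  moreover have "\<rho> s' * T z = (\<Sum>\<mu>\<in>UNIV. ((-1) ^ parity \<mu>) *\<^sub>C (B \<mu> * (s' * z) * (B \<mu>)\<^sup>\<dagger>))"
    unfolding T_def sum_distrib_left mult.assoc[symmetric] \<rho>_B
    by (intro sum.cong refl) (simp add: k' scaleC_mult_left scaleC_mult_right mult.assoc)
  ultimately show ?case using s' m z by (simp add: z_def)
qed

text \<open>The ranges of the \<open>B \<mu>\<close> decompose the space orthogonally, and
  \<open>T y\<close> acts as a copy of \<open>y\<close> on each.\<close>

lemma norm_T: "norm (T y) \<le> norm y"
proof (rule norm_bop_bound)
  fix v
  note [simp] = bop_simps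
  have sq: "(norm (\<Sum>\<mu>\<in>UNIV. B \<mu> \<cdot> f \<mu>))\<^sup>2 = (\<Sum>\<mu>\<in>UNIV. (norm (f \<mu>))\<^sup>2)" for f
  proof -
    have "cinner (B \<mu> \<cdot> f \<mu>) (B \<nu> \<cdot> f \<nu>) = (if \<nu> = \<mu> then cinner (f \<mu>) (f \<mu>) else 0)" for \<mu> \<nu>
    proof -
      have "cinner (B \<mu> \<cdot> f \<mu>) (B \<nu> \<cdot> f \<nu>) = cinner (f \<mu>) (((B \<mu>)\<^sup>\<dagger> * B \<nu>) \<cdot> f \<nu>)"
        by (simp add: cinner_star_right)
      then show ?thesis by (simp add: B_orthogonal)
    qed
    then show ?thesis unfolding norm_sq_cinner cinner_sum_left cinner_sum_right by simp
  qed
  have v: "(\<Sum>\<mu>\<in>UNIV. B \<mu> \<cdot> (B \<mu>)\<^sup>\<dagger> \<cdot> v) = v"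
    using arg_cong[OF B_sum, of "\<lambda>x. x \<cdot> v"] by (simp add: bop_sum_left)
  have "(norm (T y \<cdot> v))\<^sup>2 = (\<Sum>\<mu>\<in>UNIV. (norm (y \<cdot> (B \<mu>)\<^sup>\<dagger> \<cdot> v))\<^sup>2)"
    unfolding T_def using sq[of "\<lambda>\<mu>. y \<cdot> (B \<mu>)\<^sup>\<dagger> \<cdot> v"] by (simp add: bop_sum_left)
  also have "\<dots> \<le> (\<Sum>\<mu>\<in>UNIV. (norm y)\<^sup>2 * (norm ((B \<mu>)\<^sup>\<dagger> \<cdot> v))\<^sup>2)"
    by (intro sum_mono) (simp add: norm_bop_apply flip: power_mult_distrib)
  also have "\<dots> = (norm y)\<^sup>2 * (norm (\<Sum>\<mu>\<in>UNIV. B \<mu> \<cdot> (B \<mu>)\<^sup>\<dagger> \<cdot> v))\<^sup>2"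
    by (simp add: sq sum_distrib_left)
  also have "\<dots> = (norm y * norm v)\<^sup>2" unfolding v by (simp only: power_mult_distrib)
  finally have "(norm (T y \<cdot> v))\<^sup>2 \<le> (norm y * norm v)\<^sup>2" .
  then show "norm (T y \<cdot> v) \<le> norm y * norm v" by (rule power2_le_imp_le) simp
qed simp

lemma norm_T_power: "norm ((T ^^ N) y) \<le> norm y"
  by (induction N) (auto intro: order_trans[OF norm_T])

lemma T_parity: "\<Gamma> * T y * \<Gamma> = T (\<Gamma> * y * \<Gamma>)"
proof -
  obtain \<sigma> where \<sigma>: "\<And>\<mu>. homogeneous (parity \<mu> + \<sigma>) (B \<mu>)" using exists_parity by blast
  have "\<Gamma> * (B \<mu> * y * (B \<mu>)\<^sup>\<dagger>) * \<Gamma> = B \<mu> * (\<Gamma> * y * \<Gamma>) * (B \<mu>)\<^sup>\<dagger>" for \<mu>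
  proof -
    let ?c = "(-1) ^ (parity \<mu> + \<sigma>) :: complex"
    have 1: "\<Gamma> * B \<mu> = ?c *\<^sub>C (B \<mu> * \<Gamma>)" using \<sigma> by (simp add: homogeneous_def)
    have 2: "(B \<mu>)\<^sup>\<dagger> * \<Gamma> = ?c *\<^sub>C (\<Gamma> * (B \<mu>)\<^sup>\<dagger>)"
      using arg_cong[OF 1, of star] by (simp add: star_mult star_scaleC \<Gamma>_star)
    have "\<Gamma> * (B \<mu> * y * (B \<mu>)\<^sup>\<dagger>) * \<Gamma> = (\<Gamma> * B \<mu>) * y * ((B \<mu>)\<^sup>\<dagger> * \<Gamma>)" by (simp add: mult.assoc)
    then show ?thesis unfolding 1 2
      by (simp add: scaleC_mult_left scaleC_mult_right scaleC_scaleC mult.assoc flip: power_mult_distrib)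
  qed
  then show ?thesis by (simp add: T_def sum_distrib_left sum_distrib_right)
qed

lemma T_even: "\<Gamma> * y * \<Gamma> = y \<Longrightarrow> T y = \<rho> y"
proof -
  assume "\<Gamma> * y * \<Gamma> = y"
  then have "homogeneous 0 y" by (simp add: homogeneous_conj)
  then have "\<Gamma> ^ k * (y * \<Gamma> ^ k) = y" for k using homogeneous_power_conj by force
  moreover have "Ad (B \<mu> * \<Gamma> ^ parity \<mu>) y = B \<mu> * (\<Gamma> ^ parity \<mu> * (y * \<Gamma> ^ parity \<mu>)) * (B \<mu>)\<^sup>\<dagger>" for \<mu>
    by (simp add: Ad_def star_mult mult.assoc)
  ultimately have "Ad (B \<mu> * \<Gamma> ^ parity \<mu>) y = B \<mu> * y * (B \<mu>)\<^sup>\<dagger>" for \<mu> by simp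
  then show ?thesis by (simp add: \<rho>_eq T_def)
qed

text \<open>Invariance is given for \<rho> but needed for \<open>T\<close>. The two maps agree on
  even elements, and as \<open>T\<close> commutes with the parity and \<phi> is invariant under it,
  only even parts matter.\<close>

lemma T_mixing:
  assumes \<phi>: "\<And>x y. \<phi> (x + y) = \<phi> x + \<phi> y" "\<And>c. \<phi> (c *\<^sub>C 1) = (c::complex)"
    and \<phi>_\<Gamma>: "\<And>y. \<phi> (\<Gamma> * y * \<Gamma>) = \<phi> y" and \<phi>_\<rho>: "\<And>y. \<phi> (\<rho> y) = \<phi> y"
    and normal: "\<And>r. 0 < r \<Longrightarrow> \<exists>f. wot_functional f \<and> (\<forall>x. cmod (\<phi> x - f x) \<le> r * norm x)"
  shows "sigma_weak_limit (\<lambda>N. (T ^^ N) y) (\<phi> y *\<^sub>C 1)"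
proof -
  have Tadd: "T (x + y) = T x + T y" for x y
    by (simp add: T_def distrib_left distrib_right sum.distrib)
  have \<phi>T: "\<phi> (T y) = \<phi> y" for y
  proof -
    \<comment> \<open>Twice the even part of \<open>y\<close>.\<close>
    let ?z = "y + \<Gamma> * y * \<Gamma>"
    have "\<Gamma> * ?z * \<Gamma> = ?z" by (simp add: distrib_left distrib_right mult.assoc \<Gamma>_square add.commute)
    then have "\<phi> (T ?z) = \<phi> ?z" by (simp add: T_even \<phi>_\<rho>)
    then have "2 * \<phi> (T y) = 2 * \<phi> y"
      by (simp add: Tadd \<phi>(1) \<phi>_\<Gamma> flip: T_parity)
    then show ?thesis by simp
  qed
  have \<phi>N: "\<phi> ((T ^^ N) y) = \<phi> y" for N by (induction N) (simp_all add: \<phi>T)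
  have "(\<lambda>N. cinner v ((T ^^ N) y \<cdot> w)) \<longlonglongrightarrow> \<phi> y * cinner v w" for v w
  proof (rule wot_limit_scalar[where S = "\<Union>n. S n" and \<phi> = \<phi>])
    show "\<forall>\<^sub>F N in sequentially. (T ^^ N) y * s = s * (T ^^ N) y" if s: "s \<in> (\<Union>n. S n)" for s
    proof -
      obtain n where n: "s \<in> S n" using s by blast
      show ?thesis using eventually_gt_at_top[of n]
        by eventually_elim (rule T_power_commutes[OF n])
    qed
    show "\<exists>c. x = c *\<^sub>C 1" if "\<And>s. s \<in> (\<Union>n. S n) \<Longrightarrow> x * s = s * x" for x
      using that by (intro irreducible) auto
  qed (use \<phi> \<phi>N normal norm_T_power in auto)
  then show ?thesis
    by (intro sigma_weak_limitI[of _ "norm y"] norm_T_power) (simp add: bop_simps cinner_simps)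
qed

lemma \<rho>_prod_list: "\<rho> (prod_list xs) = prod_list (map \<rho> xs)"
  by (induction xs) (simp_all add: \<rho>_simps)

text \<open>The site 0 is split off on the left and the rest is \<rho> of a shifted product, hence
  the induction over all \<mu> and \<nu>. Moving \<open>(B (\<nu> 0))\<^sup>\<dagger>\<close>
  through \<rho> of the rest conjugates the rest by a power of \<Gamma>, which costs
  \<open>(-1) ^ (parity (\<nu> 0) * m)\<close> with \<open>m\<close> its degree.\<close>

lemma matrix_unit_product:
  "prod_list (map (\<lambda>x. (\<rho> ^^ x) (e (\<mu> x) (\<nu> x))) [0..<Suc N]) =
    ((-1) ^ (\<Sum>k=1..N. (parity (\<mu> k) + parity (\<nu> k)) * (\<Sum>j<k. parity (\<nu> j)))) *\<^sub>C
      (prod_list (map (\<lambda>x. B (\<mu> x)) [0..<Suc N]) *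
       prod_list (map (\<lambda>x. (B (\<nu> x))\<^sup>\<dagger>) (rev [0..<Suc N])))"
proof (induction N arbitrary: \<mu> \<nu>)
  case 0
  show ?case by (simp add: B_B_star)
next
  case (Suc N)
  obtain \<sigma> where \<sigma>: "\<And>\<mu>. homogeneous (parity \<mu> + \<sigma>) (B \<mu>)" using exists_parity by blast
  let ?I = "[0..<Suc N]"
  have up: "[0..<Suc (Suc N)] = 0 # map Suc ?I" unfolding map_Suc_upt by (rule upt_conv_Cons) simp
  define P where "P = prod_list (map (\<lambda>x. B (\<mu> (Suc x))) ?I)"
  define Q where "Q = prod_list (map (\<lambda>x. (B (\<nu> (Suc x)))\<^sup>\<dagger>) (rev ?I))"
  define E where "E = (\<Sum>k=1..N. (parity (\<mu> (Suc k)) + parity (\<nu> (Suc k))) * (\<Sum>j<k. parity (\<nu> (Suc j))))"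
  define m where "m = (\<Sum>x<Suc N. parity (\<mu> (Suc x)) + parity (\<nu> (Suc x)))"
  have "homogeneous (sum_list (map (\<lambda>x. parity (\<mu> (Suc x)) + \<sigma>) ?I) +
      sum_list (map (\<lambda>x. parity (\<nu> (Suc x)) + \<sigma>) (rev ?I))) (P * Q)"
    unfolding P_def Q_def by (intro homogeneous_mult homogeneous_prod_list homogeneous_star \<sigma>)
  \<comment> \<open>The common parity \<sigma> occurs once in each of the \<open>2 * Suc N\<close>
    factors, hence drops out of the degree.\<close>
  also have "sum_list (map (\<lambda>x. parity (\<mu> (Suc x)) + \<sigma>) ?I) +
      sum_list (map (\<lambda>x. parity (\<nu> (Suc x)) + \<sigma>) (rev ?I)) = m + 2 * (Suc N * \<sigma>)"
    unfolding rev_map[symmetric] sum_list_rev m_def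
    by (simp add: sum_list_addf sum_list_triv interv_sum_list_conv_sum_set_nat atLeast0LessThan sum.distrib)
  finally have "homogeneous m (P * Q)" by (simp add: homogeneous_def power_add)
  then have hom: "\<Gamma> ^ n * (P * Q) * \<Gamma> ^ n = ((-1) ^ (n * m)) *\<^sub>C (P * Q)" for n
    using homogeneous_power_conj[of m "P * Q" n] by (simp add: mult.assoc)
  have exponent: "(\<Sum>k=1..Suc N. (parity (\<mu> k) + parity (\<nu> k)) * (\<Sum>j<k. parity (\<nu> j))) = parity (\<nu> 0) * m + E"
  proof -
    have "(\<Sum>k=1..Suc N. (parity (\<mu> k) + parity (\<nu> k)) * (\<Sum>j<k. parity (\<nu> j)))
      = (\<Sum>k<Suc N. (parity (\<mu> (Suc k)) + parity (\<nu> (Suc k))) * (\<Sum>j<Suc k. parity (\<nu> j)))"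
      by (rule sum.reindex_bij_witness[of _ Suc "\<lambda>k. k - 1"]) auto
    \<comment> \<open>The summand \<open>j = 0\<close> of the inner sum produces \<open>m\<close>;
      the others form the exponent of the shifted sequences, whose term \<open>k = 0\<close> is zero
      because its inner sum is empty.\<close>
    also have "\<dots> = (\<Sum>k<Suc N. parity (\<nu> 0) * (parity (\<mu> (Suc k)) + parity (\<nu> (Suc k))) +
        (parity (\<mu> (Suc k)) + parity (\<nu> (Suc k))) * (\<Sum>j<k. parity (\<nu> (Suc j))))"
      by (intro sum.cong refl) (simp add: sum.lessThan_Suc_shift algebra_simps del: sum.lessThan_Suc)
    also have "\<dots> = parity (\<nu> 0) * m +
        (\<Sum>k<Suc N. (parity (\<mu> (Suc k)) + parity (\<nu> (Suc k))) * (\<Sum>j<k. parity (\<nu> (Suc j))))"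
      by (simp only: sum.distrib m_def flip: sum_distrib_left)
    also have "(\<Sum>k<Suc N. (parity (\<mu> (Suc k)) + parity (\<nu> (Suc k))) * (\<Sum>j<k. parity (\<nu> (Suc j)))) = E"
      unfolding E_def by (rule sum.mono_neutral_right) (auto simp: not_le)
    finally show ?thesis .
  qed
  have "prod_list (map (\<lambda>x. (\<rho> ^^ x) (e (\<mu> x) (\<nu> x))) [0..<Suc (Suc N)]) =
      e (\<mu> 0) (\<nu> 0) * \<rho> (prod_list (map (\<lambda>x. (\<rho> ^^ x) (e (\<mu> (Suc x)) (\<nu> (Suc x)))) ?I))"
    unfolding up \<rho>_prod_list by (simp add: comp_def del: upt_Suc)
  also have "\<dots> = B (\<mu> 0) * ((B (\<nu> 0))\<^sup>\<dagger> * \<rho> (((-1) ^ E) *\<^sub>C (P * Q)))"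
    unfolding Suc.IH P_def Q_def E_def by (simp add: B_B_star flip: mult.assoc)
  also have "\<dots> = ((-1) ^ (parity (\<nu> 0) * m + E)) *\<^sub>C (B (\<mu> 0) * P * (Q * (B (\<nu> 0))\<^sup>\<dagger>))"
    unfolding \<rho>_simps(5) scaleC_mult_right B_star_\<rho> hom
    by (simp add: scaleC_mult_left scaleC_mult_right scaleC_scaleC power_add mult.assoc mult.commute)
  also have "B (\<mu> 0) * P = prod_list (map (\<lambda>x. B (\<mu> x)) [0..<Suc (Suc N)])"
    unfolding up P_def by (simp add: comp_def del: upt_Suc)
  also have "Q * (B (\<nu> 0))\<^sup>\<dagger> = prod_list (map (\<lambda>x. (B (\<nu> x))\<^sup>\<dagger>) (rev [0..<Suc (Suc N)]))"
    unfolding up Q_def by (simp add: comp_def rev_map del: upt_Suc)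
  finally show ?case unfolding exponent .
qed

text \<open>The isometries rotated by \<open>D\<close> and the images
  \<open>\<theta> (B \<nu>)\<close> have the same products with adjoints, namely
  \<open>\<theta> (e \<mu> \<nu>)\<close>. Since \<open>D\<close> fixes the vacuum, the rotated
  \<open>B {}\<close> is \<open>B\<^sub>0\<close>, and multiplication by
  \<open>B\<^sub>0\<^sup>\<dagger> * \<theta> B\<^sub>0\<close> takes one family to the other. This
  factor commutes with the generators, so it is a scalar, of modulus 1.\<close>

lemma covariance:
  assumes \<theta>: "star_hom al UNIV \<theta>"
    and \<theta>_S: "\<And>n s. s \<in> S n \<Longrightarrow> \<exists>s'\<in>S n. \<theta> s' = s \<and> \<theta> (\<rho> s') = \<rho> s"
    and \<theta>_e: "\<And>\<mu> \<nu>. \<theta> (e \<mu> \<nu>) = (\<Sum>\<kappa>\<in>UNIV. \<Sum>\<eta>\<in>UNIV. (D \<kappa> \<mu> * cnj (D \<eta> \<nu>)) *\<^sub>C e \<kappa> \<eta>)"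
    and D: "\<And>\<kappa>. D \<kappa> {} = (if \<kappa> = {} then 1 else 0)"
  shows "\<exists>c. cmod c = 1 \<and> (\<forall>\<nu>. (\<Sum>\<mu>\<in>UNIV. D \<mu> \<nu> *\<^sub>C B \<mu>) = c *\<^sub>C \<theta> (B \<nu>))"
proof -
  have hom: "\<theta> (x * y) = \<theta> x * \<theta> y" "\<theta> (x\<^sup>\<dagger>) = (\<theta> x)\<^sup>\<dagger>" "\<theta> 1 = 1" for x y
    using \<theta> by (auto simp: star_hom_def)
  define B' where "B' \<nu> = (\<Sum>\<mu>\<in>UNIV. D \<mu> \<nu> *\<^sub>C B \<mu>)" for \<nu>
  have B'0: "B' {} = B\<^sub>0"
  proof -
    have "D \<mu> {} *\<^sub>C B \<mu> = (if \<mu> = {} then B\<^sub>0 else 0)" for \<mu> by (simp add: D B_empty)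
    then show ?thesis by (simp add: B'_def)
  qed
  have eq: "B' \<mu> * (B' \<nu>)\<^sup>\<dagger> = \<theta> (B \<mu>) * (\<theta> (B \<nu>))\<^sup>\<dagger>" for \<mu> \<nu>
  proof -
    have "\<theta> (B \<mu>) * (\<theta> (B \<nu>))\<^sup>\<dagger> = \<theta> (e \<mu> \<nu>)" by (simp add: B_B_star[symmetric] hom)
    also have "\<dots> = B' \<mu> * (B' \<nu>)\<^sup>\<dagger>"
      unfolding \<theta>_e B'_def star_sum sum_distrib_left sum_distrib_right
      by (subst sum.swap)
        (simp add: star_scaleC scaleC_mult_left scaleC_mult_right scaleC_scaleC B_B_star mult.commute)
    finally show ?thesis by simp
  qed
  have iso: "(\<theta> (B \<nu>))\<^sup>\<dagger> * \<theta> (B \<nu>) = 1" for \<nu>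
    by (simp add: B_orthogonal hom(3) flip: hom(1,2))
  define X where "X = B\<^sub>0\<^sup>\<dagger> * \<theta> B\<^sub>0"
  have B'X: "B' \<nu> * X = \<theta> (B \<nu>)" for \<nu>
  proof -
    have "B' \<nu> * X = B' \<nu> * (B' {})\<^sup>\<dagger> * \<theta> (B {})" by (simp add: X_def B'0 B_empty mult.assoc)
    also have "\<dots> = \<theta> (B \<nu>) * ((\<theta> (B {}))\<^sup>\<dagger> * \<theta> (B {}))" by (simp only: eq mult.assoc)
    finally show ?thesis by (simp add: iso)
  qed
  have "X * s = s * X" if "s \<in> S n" for n s
  proof -
    \<comment> \<open>One preimage serves both \<open>s\<close> and \<open>\<rho> s\<close>, so
      \<theta> transports the intertwining relation of \<open>B\<^sub>0\<close>.\<close>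
    obtain s' where s': "\<theta> s' = s" "\<theta> (\<rho> s') = \<rho> s" using \<theta>_S \<open>s \<in> S n\<close> by blast
    have "\<theta> B\<^sub>0 * s = \<rho> s * \<theta> B\<^sub>0"
      using arg_cong[OF B\<^sub>0_intertwines[of s'], of \<theta>] by (simp add: hom s')
    then have "X * s = B\<^sub>0\<^sup>\<dagger> * \<rho> s * \<theta> B\<^sub>0" by (simp add: X_def mult.assoc)
    then show ?thesis by (simp add: B\<^sub>0_star_\<rho> X_def mult.assoc)
  qed
  then obtain x where x: "X = x *\<^sub>C 1" using irreducible by blast
  have "B' {} * X * (B' {} * X)\<^sup>\<dagger> = B' {} * (B' {})\<^sup>\<dagger>" by (simp add: B'X eq)
  then have "(x * cnj x) *\<^sub>C (B\<^sub>0 * B\<^sub>0\<^sup>\<dagger>) = B\<^sub>0 * B\<^sub>0\<^sup>\<dagger>"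
    by (simp add: x B'0 star_scaleC star_mult scaleC_mult_left scaleC_mult_right scaleC_scaleC mult.commute)
  then have "(x * cnj x - 1) *\<^sub>C (B\<^sub>0 * B\<^sub>0\<^sup>\<dagger>) = 0" by (simp add: scaleC_diff_left)
  moreover have "B\<^sub>0 * B\<^sub>0\<^sup>\<dagger> \<noteq> 0"
  proof
    assume "B\<^sub>0 * B\<^sub>0\<^sup>\<dagger> = 0"
    then have "B\<^sub>0\<^sup>\<dagger> * B\<^sub>0 * (B\<^sub>0\<^sup>\<dagger> * B\<^sub>0) = 0" by (simp add: mult.assoc) (simp flip: mult.assoc)
    then show False by (simp add: B\<^sub>0_isometry)
  qed
  ultimately have xx: "x * cnj x = 1" by (simp add: scaleC_eq_0_iff)
  then have "cmod (cnj x) = 1"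
    by (metis complex_mod_cnj complex_mod_mult_cnj norm_one power2_eq_1_iff norm_ge_zero not_one_le_zero neg_0_le_iff_le)
  moreover have "B' \<nu> = cnj x *\<^sub>C \<theta> (B \<nu>)" for \<nu>
    using xx by (simp add: B'X[symmetric] x scaleC_mult_right scaleC_scaleC mult.commute)
  ultimately show ?thesis unfolding B'_def by blast
qed

end

section \<open>The CAR algebra of the half-line\<close>

definition site :: "int \<Rightarrow> complex ^ 'd::finite \<Rightarrow> int \<Rightarrow> complex ^ 'd" where
  "site x v = (\<lambda>y. if y = x then v else 0)"

lemma l2Z_finite_support:
  assumes "finite F" "\<And>x. x \<notin> F \<Longrightarrow> f x = 0"
  shows "f \<in> l2Z"
proof -
  have "(\<lambda>x. (norm (f x))\<^sup>2) summable_on UNIV \<longleftrightarrow> (\<lambda>x. (norm (f x))\<^sup>2) summable_on F"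
    using assms(2) by (intro summable_on_cong_neutral) auto
  then show ?thesis using assms(1) by (simp add: l2Z_def)
qed

lemma site_l2Z: "site x v \<in> l2Z"
  by (rule l2Z_finite_support[of "{x}"]) (auto simp: site_def)

lemma l2inner_site: "l2inner (site x v) (site y w) = (if x = y then cinner v w else 0)"
proof -
  have "l2inner (site x v) (site y w) = infsum (\<lambda>z. cinner (site x v z) (site y w z)) {x}"
    unfolding l2inner_def by (intro infsum_cong_neutral) (auto simp: site_def)
  then show ?thesis by (simp add: site_def)
qed

lemma shift_site: "shift x (site y v) = site (y + x) v"
  by (auto simp: shift_def site_def fun_eq_iff)

lemma sitewise_site: "u 0 = 0 \<Longrightarrow> sitewise u (site x v) = site x (u v)"
  by (auto simp: sitewise_def site_def fun_eq_iff)

lemma l2inner_self: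
  assumes "h \<in> l2Z"
  shows "l2inner h h = complex_of_real (\<Sum>\<^sub>\<infinity>x. (norm (h x))\<^sup>2)"
proof -
  have "(\<lambda>x. (norm (h x))\<^sup>2) summable_on UNIV" using assms by (simp add: l2Z_def)
  then have "((\<lambda>x. (norm (h x))\<^sup>2) has_sum (\<Sum>\<^sub>\<infinity>x. (norm (h x))\<^sup>2)) UNIV" by simp
  then have "((\<lambda>x. complex_of_real ((norm (h x))\<^sup>2)) has_sum complex_of_real (\<Sum>\<^sub>\<infinity>x. (norm (h x))\<^sup>2)) UNIV"
    by (rule has_sum_of_real)
  then show ?thesis unfolding l2inner_def cinner_self by (rule infsumI)
qed

context
  fixes a :: "(int \<Rightarrow> complex ^ 'd::finite) \<Rightarrow> 'a::cstar_algebra"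
  assumes car: "car_algebra a"
begin

lemma car_add: "f \<in> l2Z \<Longrightarrow> g \<in> l2Z \<Longrightarrow> a (\<lambda>x. f x + g x) = a f + a g"
  and car_scaleC: "f \<in> l2Z \<Longrightarrow> a (\<lambda>x. c *\<^sub>C f x) = cnj c *\<^sub>C a f"
  and car_anticommute: "f \<in> l2Z \<Longrightarrow> g \<in> l2Z \<Longrightarrow> a f * a g + a g * a f = 0"
  and car_anticommute_star: "f \<in> l2Z \<Longrightarrow> g \<in> l2Z \<Longrightarrow> a f * (a g)\<^sup>\<dagger> + (a g)\<^sup>\<dagger> * a f = l2inner f g *\<^sub>C 1"
  using car unfolding car_algebra_def by blast+

text \<open>Since \<open>a h * a h = 0\<close>, the element \<open>x = (a h)\<^sup>\<dagger> * a h\<close> satisfies \<open>x\<^sup>\<dagger> * x = l2inner h h *\<^sub>C x\<close>.\<close>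

lemma car_norm_le:
  assumes h: "h \<in> l2Z"
  shows "(norm (a h))\<^sup>2 \<le> (\<Sum>\<^sub>\<infinity>x. (norm (h x))\<^sup>2)"
proof -
  define A where "A = a h"
  define r where "r = (\<Sum>\<^sub>\<infinity>x. (norm (h x))\<^sup>2)"
  have r0: "0 \<le> r" unfolding r_def by (rule infsum_nonneg) simp
  have "A * A + A * A = 0" using car_anticommute[OF h h] by (simp add: A_def)
  then have "(2::real) *\<^sub>R (A * A) = 0" by (simp add: scaleR_2)
  then have AA: "A * A = 0" by simp
  have "A * A\<^sup>\<dagger> + A\<^sup>\<dagger> * A = complex_of_real r *\<^sub>C 1"
    using car_anticommute_star[OF h h] by (simp add: A_def r_def l2inner_self[OF h])
  then have A1: "A * A\<^sup>\<dagger> = complex_of_real r *\<^sub>C 1 - A\<^sup>\<dagger> * A" by (simp add: eq_diff_eq)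
  define x where "x = A\<^sup>\<dagger> * A"
  have "x\<^sup>\<dagger> * x = A\<^sup>\<dagger> * (A * A\<^sup>\<dagger>) * A" by (simp add: x_def star_mult star_star mult.assoc)
  also have "\<dots> = complex_of_real r *\<^sub>C x"
    unfolding A1 by (simp add: x_def algebra_simps scaleC_mult_left scaleC_mult_right)
      (simp add: AA flip: mult.assoc)
  finally have "(norm x)\<^sup>2 = r * norm x" using r0 by (simp add: cstar_norm_scaleC flip: cstar_identity)
  then have "norm x \<le> r" using r0 by (auto simp: power2_eq_square)
  then show ?thesis by (simp add: x_def cstar_identity A_def r_def)
qed

lemma car_zero: "a (\<lambda>x. 0) = 0"
  using car_scaleC[of "\<lambda>x. 0" 0] l2Z_finite_support[of "{}" "\<lambda>x. 0"] by simp

lemma car_finite_support: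
  assumes "finite F"
  shows "a (\<lambda>x. if x \<in> F then f x else 0) = (\<Sum>x\<in>F. a (site x (f x)))"
  using assms
proof (induction F)
  case (insert y F)
  have "(\<lambda>x. if x \<in> insert y F then f x else 0) = (\<lambda>x. site y (f y) x + (if x \<in> F then f x else 0))"
    using insert by (auto simp: fun_eq_iff site_def)
  moreover have "(\<lambda>x. if x \<in> F then f x else 0) \<in> l2Z"
    using insert by (intro l2Z_finite_support[of F]) auto
  ultimately show ?case using insert car_add[OF site_l2Z] by simp
qed (simp add: car_zero)

lemma car_right_site: "0 \<le> x \<Longrightarrow> a (site x v) \<in> car_right a"
  unfolding car_local_def
  by (intro cstar_generated_incl imageI) (simp add: site_l2Z, simp add: site_def)

text \<open>A square-summable function is approximated by finite truncations, and
  \<open>car_norm_le\<close> turns its small tail into a small element of the algebra.\<close>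

lemma car_right_subset:
  assumes D: "cstar_subalgebra D" and gen: "\<And>n v. a (site (int n) v) \<in> D"
  shows "car_right a \<subseteq> D"
  unfolding car_local_def
proof (rule cstar_generated_minimal[OF D], clarify)
  fix f :: "int \<Rightarrow> complex ^ 'd"
  assume f: "f \<in> l2Z" and supp: "\<forall>x. x \<notin> {0..} \<longrightarrow> f x = 0"
  have siteD: "a (site x (f x)) \<in> D" for x
  proof (cases "0 \<le> x")
    case True
    then show ?thesis using gen[of "nat x"] by simp
  next
    case False
    then have "site x (f x) = site (int 0) 0" using supp by (auto simp: site_def fun_eq_iff)
    then show ?thesis using gen by metis
  qed
  have sm: "(\<lambda>x. (norm (f x))\<^sup>2) summable_on UNIV" using f by (simp add: l2Z_def)
  have "\<exists>y\<in>D. dist y (a f) < e" if e: "0 < e" for e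
  proof -
    obtain F where F: "finite F" "dist (\<Sum>x\<in>F. (norm (f x))\<^sup>2) (\<Sum>\<^sub>\<infinity>x. (norm (f x))\<^sup>2) \<le> e\<^sup>2 / 2"
      using infsum_finite_approximation[OF sm, of "e\<^sup>2 / 2"] e by auto
    define h where "h x = (if x \<in> F then 0 else f x)" for x
    have smF: "(\<lambda>x. (norm (f x))\<^sup>2) summable_on (UNIV - F)"
      using sm by (rule summable_on_subset_banach) simp
    have eq: "(\<lambda>x. (norm (h x))\<^sup>2) summable_on UNIV \<longleftrightarrow> (\<lambda>x. (norm (f x))\<^sup>2) summable_on (UNIV - F)"
      by (intro summable_on_cong_neutral) (auto simp: h_def)
    then have h: "h \<in> l2Z" using smF by (simp add: l2Z_def)
    have "(\<Sum>\<^sub>\<infinity>x. (norm (h x))\<^sup>2) = (\<Sum>\<^sub>\<infinity>x\<in>UNIV - F. (norm (f x))\<^sup>2)"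
      by (intro infsum_cong_neutral) (auto simp: h_def)
    also have "\<dots> = (\<Sum>\<^sub>\<infinity>x. (norm (f x))\<^sup>2) - (\<Sum>x\<in>F. (norm (f x))\<^sup>2)"
    proof -
      have "(\<Sum>\<^sub>\<infinity>x\<in>UNIV - F \<union> F. (norm (f x))\<^sup>2) =
          (\<Sum>\<^sub>\<infinity>x\<in>UNIV - F. (norm (f x))\<^sup>2) + (\<Sum>\<^sub>\<infinity>x\<in>F. (norm (f x))\<^sup>2)"
        using F(1) by (intro infsum_Un_disjoint smF summable_on_finite) auto
      then show ?thesis using F(1) by simp
    qed
    also have "\<dots> \<le> e\<^sup>2 / 2" using F(2) unfolding dist_real_def by linarith
    also have "\<dots> < e\<^sup>2" using e by simp
    finally have "(norm (a h))\<^sup>2 < e\<^sup>2" using car_norm_le[OF h] by linarith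
    then have small: "norm (a h) < e" using e by (simp add: power_less_imp_less_base)
    have "(\<lambda>x. if x \<in> F then f x else 0) \<in> l2Z" using F by (intro l2Z_finite_support[of F]) auto
    then have "a (\<lambda>x. (if x \<in> F then f x else 0) + h x) = (\<Sum>x\<in>F. a (site x (f x))) + a h"
      using car_add[OF _ h] car_finite_support[OF F(1)] by simp
    moreover have "(\<lambda>x. (if x \<in> F then f x else 0) + h x) = f" by (auto simp: h_def)
    ultimately have "dist (\<Sum>x\<in>F. a (site x (f x))) (a f) < e" using small by (simp add: dist_norm)
    moreover have "(\<Sum>x\<in>F. a (site x (f x))) \<in> D" using siteD by (intro cstar_subalgebra_sum[OF D])
    ultimately show ?thesis by blast
  qed
  then have "a f \<in> closure D" unfolding closure_approachable by blast
  then show "a f \<in> D" using D by (simp add: cstar_subalgebra_def)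
qed

end

section \<open>Matrix units as words in creation and annihilation operators\<close>

definition creation_word :: "('d::{finite,linorder} \<Rightarrow> 'a::cstar_algebra) \<Rightarrow> 'd set \<Rightarrow> 'a" where
  "creation_word u \<mu> = prod_list (map (\<lambda>i. (u i)\<^sup>\<dagger>) (sorted_list_of_set \<mu>))"

definition vacuum_word :: "('d::{finite,linorder} \<Rightarrow> 'a::cstar_algebra) \<Rightarrow> 'a" where
  "vacuum_word u = prod_list (map (\<lambda>i. u i * (u i)\<^sup>\<dagger>) (sorted_list_of_set UNIV))"

text \<open>The rank-one operator from \<psi>_\<nu> to \<psi>_\<mu> as a word in the annihilation
  operators and their adjoints. In this form every homomorphism acts on it through the generators,
  which yields its translates and its behaviour under parity and symmetry.\<close>

definition matrix_unit_word :: "('d::{finite,linorder} \<Rightarrow> 'a::cstar_algebra) \<Rightarrow> 'd set \<Rightarrow> 'd set \<Rightarrow> 'a" where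
  "matrix_unit_word u \<mu> \<nu> = creation_word u \<mu> * vacuum_word u * (creation_word u \<nu>)\<^sup>\<dagger>"

lemma prod_list_subalgebra:
  assumes "cstar_subalgebra D" "\<And>i. f i \<in> D"
  shows "prod_list (map f xs) \<in> D"
  using assms by (induction xs) (auto simp: cstar_subalgebra_def)

lemma matrix_unit_word_subalgebra:
  assumes D: "cstar_subalgebra D" "\<And>i. u i \<in> D"
  shows "matrix_unit_word u \<mu> \<nu> \<in> D"
proof -
  have "(u i)\<^sup>\<dagger> \<in> D" "u i * (u i)\<^sup>\<dagger> \<in> D" for i using D by (auto simp: cstar_subalgebra_def)
  then have "creation_word u \<mu> \<in> D" "vacuum_word u \<in> D" for \<mu>
    unfolding creation_word_def vacuum_word_def by (auto intro: prod_list_subalgebra D)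
  then show ?thesis using D by (simp add: matrix_unit_word_def cstar_subalgebra_def)
qed

lemma star_hom_prod_list:
  assumes f: "star_hom al UNIV f"
  shows "f (prod_list xs) = prod_list (map f xs)"
  using f by (induction xs) (auto simp: star_hom_def)

lemma star_hom_matrix_unit_word:
  assumes f: "star_hom al UNIV f"
  shows "f (matrix_unit_word u \<mu> \<nu>) = matrix_unit_word (\<lambda>i. f (u i)) \<mu> \<nu>"
proof -
  have hom: "f (x * y) = f x * f y" "f (x\<^sup>\<dagger>) = (f x)\<^sup>\<dagger>" for x y using f by (auto simp: star_hom_def)
  show ?thesis
    by (simp add: matrix_unit_word_def creation_word_def vacuum_word_def hom star_hom_prod_list[OF f] comp_def)
qed

lemma minus_one_power_card: "(-1 :: complex) ^ card \<mu> = (-1) ^ parity \<mu>"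
  by (cases "even (card \<mu>)") (auto simp: parity_def even_iff_mod_2_eq_zero odd_iff_mod_2_eq_one)

text \<open>Each creation or annihilation operator outside the vacuum word contributes one sign;
  inside it they come in pairs.\<close>

lemma matrix_unit_word_anticommute:
  fixes b :: "'a::cstar_algebra"
  assumes u: "\<And>i. b * u i = - (u i * b)" "\<And>i. b * (u i)\<^sup>\<dagger> = - ((u i)\<^sup>\<dagger> * b)"
  shows "b * matrix_unit_word u \<mu> \<nu> = ((-1) ^ (parity \<mu> + parity \<nu>)) *\<^sub>C (matrix_unit_word u \<mu> \<nu> * b)"
proof -
  have 1: "b * prod_list (map f xs) = ((-1) ^ (k * length xs)) *\<^sub>C (prod_list (map f xs) * b)"
    if "\<And>i. b * f i = ((-1) ^ k) *\<^sub>C (f i * b)" for f k and xs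
  proof (induction xs)
    case (Cons x xs)
    have "b * prod_list (map f (x # xs)) = b * f x * prod_list (map f xs)" by (simp add: mult.assoc)
    also have "\<dots> = ((-1) ^ k) *\<^sub>C (f x * (b * prod_list (map f xs)))"
      by (simp add: that scaleC_mult_left mult.assoc)
    finally show ?case
      by (simp add: Cons scaleC_mult_right scaleC_scaleC power_add mult.assoc)
  qed simp
  have sq: "b * u i * (u i)\<^sup>\<dagger> = u i * (u i)\<^sup>\<dagger> * b" for i by (simp add: u mult.assoc)
  have C: "b * creation_word u \<mu> = ((-1) ^ parity \<mu>) *\<^sub>C (creation_word u \<mu> * b)" for \<mu>
    unfolding creation_word_def using 1[of "\<lambda>i. (u i)\<^sup>\<dagger>" 1] u(2)
    by (simp add: scaleC_minus_left minus_one_power_card)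
  have V: "b * vacuum_word u = vacuum_word u * b"
    unfolding vacuum_word_def using 1[of "\<lambda>i. u i * (u i)\<^sup>\<dagger>" 0] sq by (simp add: mult.assoc)
  have S: "b * (creation_word u \<mu>)\<^sup>\<dagger> = ((-1) ^ parity \<mu>) *\<^sub>C ((creation_word u \<mu>)\<^sup>\<dagger> * b)" for \<mu>
  proof -
    have st: "(prod_list (map (\<lambda>i. (u i)\<^sup>\<dagger>) xs))\<^sup>\<dagger> = prod_list (map u (rev xs))" for xs
      by (induction xs) (simp_all add: star_mult star_star)
    show ?thesis
      unfolding creation_word_def st using 1[of u 1] u(1)
      by (simp add: scaleC_minus_left minus_one_power_card)
  qed
  have "b * matrix_unit_word u \<mu> \<nu> = b * creation_word u \<mu> * vacuum_word u * (creation_word u \<nu>)\<^sup>\<dagger>"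
    by (simp add: matrix_unit_word_def mult.assoc)
  also have "\<dots> = ((-1) ^ parity \<mu>) *\<^sub>C (creation_word u \<mu> * (b * vacuum_word u) * (creation_word u \<nu>)\<^sup>\<dagger>)"
    unfolding C by (simp add: scaleC_mult_left mult.assoc)
  also have "\<dots> = ((-1) ^ parity \<mu>) *\<^sub>C (creation_word u \<mu> * vacuum_word u * (b * (creation_word u \<nu>)\<^sup>\<dagger>))"
    unfolding V by (simp add: mult.assoc)
  also have "\<dots> = ((-1) ^ (parity \<mu> + parity \<nu>)) *\<^sub>C (matrix_unit_word u \<mu> \<nu> * b)"
    unfolding S by (simp add: matrix_unit_word_def scaleC_mult_right scaleC_scaleC power_add mult.assoc)
  finally show ?thesis .
qed

lemma matrix_unit_word_minus:
  "matrix_unit_word (\<lambda>i. - u i) \<mu> \<nu> = ((-1) ^ (parity \<mu> + parity \<nu>)) *\<^sub>C matrix_unit_word u \<mu> \<nu>"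
proof -
  have 1: "prod_list (map (\<lambda>i. - (u i)\<^sup>\<dagger>) xs) = ((-1) ^ length xs) *\<^sub>C prod_list (map (\<lambda>i. (u i)\<^sup>\<dagger>) xs)" for xs
    by (induction xs) (simp_all add: scaleC_mult_right scaleC_minus_left scaleC_minus_right)
  have "creation_word (\<lambda>i. - u i) \<mu> = ((-1) ^ parity \<mu>) *\<^sub>C creation_word u \<mu>" for \<mu>
    by (simp add: creation_word_def star_minus 1 minus_one_power_card)
  moreover have "vacuum_word (\<lambda>i. - u i) = vacuum_word u" by (simp add: vacuum_word_def star_minus)
  ultimately show ?thesis
    by (simp add: matrix_unit_word_def star_scaleC scaleC_mult_left scaleC_mult_right scaleC_scaleC
        power_add mult.commute)
qed

section \<open>Fock space\<close>

lemma cinner_axis: "cinner (axis \<mu> 1) w = (w :: (complex, 'b::finite) vec) $ \<mu>"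
proof -
  have "cinner (axis \<mu> 1 $ i) (w $ i) = (if i = \<mu> then w $ i else 0)" for i
    by (simp add: axis_def cinner_complex_def)
  then show ?thesis by (simp add: cinner_vec_def)
qed

lemma vec_expansion: "(w :: (complex, 'b::finite) vec) = (\<Sum>\<mu>\<in>UNIV. (w $ \<mu>) *\<^sub>C axis \<mu> 1)"
proof -
  have "((w $ \<mu>) *\<^sub>C axis \<mu> 1 :: (complex, 'b) vec) $ i = (if \<mu> = i then w $ i else 0)" for \<mu> i
    by (simp add: scaleC_vec_def axis_def scaleC_complex_def)
  then show ?thesis by (simp add: vec_eq_iff sum_component)
qed

lemma cinner_fock_basis: "cinner (fock_basis \<mu>) w = w $ \<mu>"
  by (simp add: fock_basis_eq cinner_axis)

lemma fock_expansion: "w = (\<Sum>\<mu>\<in>UNIV. cinner (fock_basis \<mu>) w *\<^sub>C fock_basis \<mu>)"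
  unfolding cinner_fock_basis unfolding fock_basis_eq by (rule vec_expansion)

lemma fock_operator_expansion:
  "X = (\<Sum>\<mu>\<in>UNIV. \<Sum>\<nu>\<in>UNIV. cinner (fock_basis \<mu>) (X \<cdot> fock_basis \<nu>) *\<^sub>C
    butterfly (fock_basis \<mu>) (fock_basis \<nu>))"
proof (rule bop_eqI)
  fix v
  have "X \<cdot> v = X \<cdot> (\<Sum>\<nu>\<in>UNIV. cinner (fock_basis \<nu>) v *\<^sub>C fock_basis \<nu>)"
    by (rule arg_cong[OF fock_expansion])
  also have "\<dots> = (\<Sum>\<nu>\<in>UNIV. cinner (fock_basis \<nu>) v *\<^sub>C (X \<cdot> fock_basis \<nu>))"
    by (simp add: bop_sum_right bop_scaleC)
  also have "\<dots> = (\<Sum>\<nu>\<in>UNIV. cinner (fock_basis \<nu>) v *\<^sub>C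
      (\<Sum>\<mu>\<in>UNIV. cinner (fock_basis \<mu>) (X \<cdot> fock_basis \<nu>) *\<^sub>C fock_basis \<mu>))"
    by (simp only: fock_expansion[symmetric])
  also have "\<dots> = (\<Sum>\<mu>\<in>UNIV. \<Sum>\<nu>\<in>UNIV. cinner (fock_basis \<mu>) (X \<cdot> fock_basis \<nu>) *\<^sub>C
      cinner (fock_basis \<nu>) v *\<^sub>C fock_basis \<mu>)"
    unfolding scaleC_sum_right by (subst sum.swap) (simp add: scaleC_scaleC mult.commute)
  finally show "X \<cdot> v = (\<Sum>\<mu>\<in>UNIV. \<Sum>\<nu>\<in>UNIV. cinner (fock_basis \<mu>) (X \<cdot> fock_basis \<nu>) *\<^sub>C
    butterfly (fock_basis \<mu>) (fock_basis \<nu>)) \<cdot> v"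
    by (simp add: bop_sum_left bop_simps butterfly_apply)
qed

lemma fock_basis_identity: "(\<Sum>\<mu>\<in>UNIV. butterfly (fock_basis \<mu>) (fock_basis \<mu>)) = 1"
  by (rule bop_eqI) (simp only: bop_sum_left alg_bop_apply butterfly_apply fock_expansion[symmetric])

lemma cinner_fock_basis_basis: "cinner (fock_basis \<mu>) (fock_basis \<nu>) = (if \<mu> = \<nu> then 1 else 0)"
  by (simp add: cinner_fock_basis) (simp add: fock_basis_eq axis_def)

lemma fock_vacuum_eq: "fock_vacuum = fock_basis {}"
  by (simp add: fock_vacuum_def fock_basis_eq)

lemma fock_annihilate_star: "(fock_annihilate v)\<^sup>\<dagger> = fock_create v"
  by (simp add: fock_annihilate_def star_star)

lemma fock_annihilate_sum: "fock_annihilate (\<Sum>i\<in>I. c i *\<^sub>C u i) = (\<Sum>i\<in>I. cnj (c i) *\<^sub>C fock_annihilate (u i))"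
proof -
  have "fock_create (\<Sum>i\<in>I. c i *\<^sub>C u i) = (\<Sum>i\<in>I. c i *\<^sub>C fock_create (u i))"
    unfolding fock_create_def sum_component scaleC_sum_left scaleC_sum_right
    by (subst sum.swap) (simp add: scaleC_vec_def scaleC_complex_def scaleC_scaleC)
  then show ?thesis by (simp add: fock_annihilate_def star_sum star_scaleC)
qed

lemma fock_annihilate_vacuum: "fock_annihilate v \<cdot> fock_vacuum = 0"
proof -
  have "(fock_create v \<cdot> \<phi>) $ {} = 0" for \<phi>
    by (simp add: fock_create_def bop_sum_left sum_component scaleC_bop_apply scaleC_vec_def
        fock_create_basis_apply)
  then have "cinner fock_vacuum (fock_create v \<cdot> \<phi>) = 0" for \<phi>
    by (simp add: fock_vacuum_eq cinner_fock_basis)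
  then have "cinner (fock_annihilate v \<cdot> fock_vacuum) \<phi> = 0" for \<phi>
    by (simp add: fock_annihilate_def cinner_star_left)
  then show ?thesis using cinner_eq_zero_iff by blast
qed

text \<open>A basis vector other than the vacuum begins with a creation operator, so its coefficient
  in \<open>w\<close> is a matrix element of an annihilation operator applied to
  \<open>w\<close>.\<close>

lemma fock_joint_kernel:
  assumes "\<And>i. fock_annihilate (axis i 1) \<cdot> w = 0"
  shows "w = (w $ {}) *\<^sub>C fock_vacuum"
proof -
  have "w $ \<mu> = 0" if \<mu>: "\<mu> \<noteq> {}" for \<mu>
  proof -
    obtain i xs where xs: "sorted_list_of_set \<mu> = i # xs"
      using \<mu> by (cases "sorted_list_of_set \<mu>") auto
    have "w $ \<mu> = cinner (fock_create (axis i 1) \<cdot> fock_word (map (\<lambda>i. axis i 1) xs)) w"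
      unfolding cinner_fock_basis[symmetric] fock_basis_def xs by (simp add: fock_word_def)
    also have "\<dots> = 0" using assms[of i] by (simp add: cinner_star_right[symmetric] flip: fock_annihilate_def)
    finally show ?thesis .
  qed
  then have "(w $ \<mu>) *\<^sub>C axis \<mu> 1 = (if \<mu> = {} then (w $ {}) *\<^sub>C fock_vacuum else 0)" for \<mu>
    by (simp add: fock_vacuum_def)
  then show ?thesis using vec_expansion[of w] by simp
qed

lemma second_quantization_basis:
  "second_quantization al u (fock_basis \<nu>) = fock_word (map (\<lambda>i. u (axis i 1)) (sorted_list_of_set \<nu>))"
proof -
  have "(if al then cnj (cinner (fock_basis \<mu>) (fock_basis \<nu>)) else cinner (fock_basis \<mu>) (fock_basis \<nu>)) *\<^sub>C
      fock_word (map (\<lambda>i. u (axis i 1)) (sorted_list_of_set \<mu>)) =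
    (if \<mu> = \<nu> then fock_word (map (\<lambda>i. u (axis i 1)) (sorted_list_of_set \<nu>)) else 0)" for \<mu>
    by (simp add: cinner_fock_basis_basis)
  then show ?thesis by (simp add: second_quantization_def)
qed

lemma second_quantization_vacuum:
  "cinner (fock_basis \<kappa>) (second_quantization al V (fock_basis {})) = (if \<kappa> = {} then 1 else 0)"
  by (simp add: second_quantization_basis fock_word_def fock_vacuum_eq cinner_fock_basis_basis)

text \<open>
  For an orthonormal basis \<open>u\<close> the word \<open>vacuum_word\<close> is the projection onto the joint kernel of the
  annihilation operators, which is spanned by the vacuum.
\<close>

lemma matrix_unit_word_fock:
  fixes u :: "'d::{finite,linorder} \<Rightarrow> (complex, 'd) vec"
  assumes car1: "\<And>f g :: (complex, 'd) vec. fock_annihilate f * fock_annihilate g + fock_annihilate g * fock_annihilate f = 0"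
    and car2: "\<And>f g :: (complex, 'd) vec. fock_annihilate f * fock_create g + fock_create g * fock_annihilate f = cinner f g *\<^sub>C 1"
    and orth: "\<And>i j. cinner (u i) (u j) = (if i = j then 1 else 0)"
    and span: "\<And>v. \<exists>c. v = (\<Sum>i\<in>UNIV. c i *\<^sub>C u i)"
  shows "matrix_unit_word (\<lambda>i. fock_annihilate (u i)) \<mu> \<nu> =
    butterfly (fock_word (map u (sorted_list_of_set \<mu>))) (fock_word (map u (sorted_list_of_set \<nu>)))"
proof -
  define Q where "Q xs = prod_list (map (\<lambda>i. fock_annihilate (u i) * fock_create (u i)) xs)" for xs
  define P where "P = butterfly fock_vacuum (fock_vacuum :: 'd fock)"
  have sq: "fock_annihilate (u i) * fock_annihilate (u i) = 0" for i
  proof -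
    have "(2::real) *\<^sub>R (fock_annihilate (u i) * fock_annihilate (u i)) = 0"
      using car1[of "u i" "u i"] by (simp add: scaleR_2)
    then show ?thesis by simp
  qed
  \<comment> \<open>The operator passes factors of other indices with two cancelling signs and dies
    at its own factor, where its square appears.\<close>
  have kill: "fock_annihilate (u j) * Q xs = 0" if "j \<in> set xs" for j xs
    using that
  proof (induction xs)
    case (Cons i xs)
    show ?case
    proof (cases "i = j")
      case True
      then show ?thesis by (simp add: Q_def sq flip: mult.assoc)
    next
      case False
      have 1: "fock_annihilate (u j) * fock_annihilate (u i) = - (fock_annihilate (u i) * fock_annihilate (u j))"
        using car1[of "u j" "u i"] by (simp add: eq_neg_iff_add_eq_0)
      have 2: "fock_annihilate (u j) * fock_create (u i) = - (fock_create (u i) * fock_annihilate (u j))"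
        using car2[of "u j" "u i"] False by (simp add: eq_neg_iff_add_eq_0 orth)
      have "fock_annihilate (u j) * Q (i # xs) =
          fock_annihilate (u j) * fock_annihilate (u i) * fock_create (u i) * Q xs"
        by (simp add: Q_def mult.assoc)
      also have "\<dots> = - (fock_annihilate (u i) * (fock_annihilate (u j) * fock_create (u i)) * Q xs)"
        unfolding 1 by (simp add: mult.assoc)
      also have "\<dots> = fock_annihilate (u i) * fock_create (u i) * (fock_annihilate (u j) * Q xs)"
        unfolding 2 by (simp add: mult.assoc)
      finally show ?thesis using Cons False by simp
    qed
  qed simp
  define Q0 where "Q0 = Q (sorted_list_of_set UNIV)"
  have "fock_annihilate v * Q0 = 0" for v
  proof -
    obtain c where "v = (\<Sum>i\<in>UNIV. c i *\<^sub>C u i)" using span by blast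
    then show ?thesis
      by (simp add: fock_annihilate_sum sum_distrib_right scaleC_mult_left Q0_def kill)
  qed
  then have "fock_annihilate v \<cdot> Q0 \<cdot> w = 0" for v w
    by (metis alg_bop_apply(2) real_bop_apply(1))
  then have Qw: "Q0 \<cdot> w = ((Q0 \<cdot> w) $ {}) *\<^sub>C fock_vacuum" for w by (rule fock_joint_kernel)
  have PQ: "P * Q0 = Q0"
  proof (rule bop_eqI)
    fix w
    have "P \<cdot> (c *\<^sub>C fock_vacuum) = c *\<^sub>C fock_vacuum" for c
      by (simp add: P_def bop_scaleC butterfly_apply fock_vacuum_eq cinner_fock_basis_basis)
    then show "(P * Q0) \<cdot> w = Q0 \<cdot> w" using Qw[of w] by (metis alg_bop_apply(2))
  qed
  \<comment> \<open>\<open>P\<close> absorbs each factor on its right because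
    \<open>P * fock_create (u i)\<close> is zero. So \<open>P * Q0\<close> equals \<open>P\<close>,
    while by \<open>PQ\<close> it equals \<open>Q0\<close>.\<close>
  have Pn: "P * (fock_annihilate (u i) * fock_create (u i)) = P" for i
  proof -
    have "P * fock_create (u i) = 0"
      by (simp add: P_def butterfly_mult flip: fock_annihilate_def)
        (simp add: fock_annihilate_vacuum butterfly_scaleC_right[of _ 0, simplified])
    moreover have "fock_annihilate (u i) * fock_create (u i) = 1 - fock_create (u i) * fock_annihilate (u i)"
      using car2[of "u i" "u i"] by (simp add: orth eq_diff_eq)
    ultimately show ?thesis by (simp add: right_diff_distrib flip: mult.assoc)
  qed
  have "P * Q xs = P" for xs
  proof (induction xs)
    case (Cons i xs)
    have "P * Q (i # xs) = P * (fock_annihilate (u i) * fock_create (u i)) * Q xs"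
      by (simp add: Q_def mult.assoc)
    then show ?case by (simp only: Pn Cons)
  qed (simp add: Q_def)
  then have Q0: "Q0 = P" using PQ by (simp add: Q0_def)
  have V: "vacuum_word (\<lambda>i. fock_annihilate (u i)) = P"
    using Q0 by (simp add: vacuum_word_def Q0_def Q_def fock_annihilate_star)
  have C: "creation_word (\<lambda>i. fock_annihilate (u i)) \<mu> \<cdot> fock_vacuum =
      fock_word (map u (sorted_list_of_set \<mu>))" for \<mu>
  proof -
    have "prod_list (map (\<lambda>i. fock_create (u i)) xs) \<cdot> w = foldr (\<lambda>f v. fock_create f \<cdot> v) (map u xs) w"
      for xs w by (induction xs) (simp_all add: alg_bop_apply)
    then show ?thesis by (simp add: creation_word_def fock_word_def fock_annihilate_star)
  qed
  show ?thesis
    unfolding matrix_unit_word_def V P_def mult_butterfly butterfly_mult star_star C ..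
qed

section \<open>The half-line algebra of a translation invariant pure state\<close>

lemma star_hom_compose:
  assumes "star_hom al D f" "star_hom bl E g" "\<And>x. x \<in> D \<Longrightarrow> f x \<in> E"
  shows "star_hom (al \<noteq> bl) D (\<lambda>x. g (f x))"
  unfolding star_hom_def using assms by (cases al; cases bl) (simp_all add: star_hom_def)

lemma star_iso_inverse:
  assumes f: "star_iso False D UNIV f" and D: "cstar_subalgebra D"
  shows "star_iso False UNIV D (inv_into D f)"
proof -
  let ?g = "inv_into D f"
  have bij: "bij_betw f D UNIV" and hom: "star_hom False D f" using f by (auto simp: star_iso_def)
  have g: "?g y \<in> D" "f (?g y) = y" for y
    using bij by (auto simp: bij_betw_def inv_into_into f_inv_into_f)
  have gf: "?g (f x) = x" if "x \<in> D" for x using bij that by (simp add: bij_betw_def)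
  have fh: "f 1 = 1" "f (?g x + ?g y) = x + y" "f (?g x * ?g y) = x * y" "f ((?g x)\<^sup>\<dagger>) = x\<^sup>\<dagger>"
    "f (c *\<^sub>C ?g x) = c *\<^sub>C x" for x y c
    using hom g by (simp_all add: star_hom_def)
  have Dh: "1 \<in> D" "?g x + ?g y \<in> D" "?g x * ?g y \<in> D" "(?g x)\<^sup>\<dagger> \<in> D" "c *\<^sub>C ?g x \<in> D" for x y c
    using D g by (simp_all add: cstar_subalgebra_def)
  have "?g 1 = 1" "?g (x + y) = ?g x + ?g y" "?g (x * y) = ?g x * ?g y" "?g (x\<^sup>\<dagger>) = (?g x)\<^sup>\<dagger>"
    "?g (c *\<^sub>C x) = c *\<^sub>C ?g x" for x y c
    using Dh[THEN gf] unfolding fh by blast+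
  then have "star_hom False UNIV ?g" by (simp add: star_hom_def)
  moreover have "bij_betw ?g UNIV D" using bij by (rule bij_betw_inv_into)
  ultimately show ?thesis by (simp add: star_iso_def)
qed

lemma grading_star: "grading\<^sup>\<dagger> = (grading :: ('k::chilbert \<times> 'k) bop)"
proof (rule bop_cinner_eqI)
  fix x y :: "'k \<times> 'k"
  show "cinner x (grading\<^sup>\<dagger> \<cdot> y) = cinner x (grading \<cdot> y)"
    unfolding cinner_star_right by (cases x; cases y) (simp add: grading_apply cinner_prod_def cinner_simps)
qed

lemma grading_square: "grading * grading = (1 :: ('k::chilbert \<times> 'k) bop)"
proof (rule bop_eqI)
  fix x :: "'k \<times> 'k"
  show "(grading * grading) \<cdot> x = 1 \<cdot> x" by (cases x) (simp add: bop_simps grading_apply)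
qed

text \<open>The elements whose image commutes with \<open>x\<close> and with its adjoint form a
  C*-algebra, so the generators decide. The second premise, after taking adjoints, supplies
  commutation with \<open>x\<^sup>\<dagger>\<close>.\<close>

lemma car_hom_commute:
  fixes f :: "'a::cstar_algebra \<Rightarrow> 'h::chilbert bop"
  assumes car: "car_algebra a" and f: "star_hom False (car_right a) f"
    and x: "\<And>n v. x * f (a (site (int n) v)) = f (a (site (int n) v)) * x"
      "\<And>n v. x * (f (a (site (int n) v)))\<^sup>\<dagger> = (f (a (site (int n) v)))\<^sup>\<dagger> * x"
    and A: "A \<in> car_right a"
  shows "x * f A = f A * x"
proof -
  let ?C = "commutant {x, x\<^sup>\<dagger>}"
  have R: "cstar_subalgebra (car_right a)" unfolding car_local_def by (rule cstar_subalgebra_generated)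
  have C: "cstar_subalgebra ?C" by (rule cstar_subalgebra_commutant) (auto simp: star_star)
  have "car_right a \<subseteq> {A \<in> car_right a. f A \<in> ?C}"
  proof (rule car_right_subset[OF car star_hom_preimage_subalgebra[OF f R C]])
    fix n v
    have "f (a (site (int n) v)) * x\<^sup>\<dagger> = x\<^sup>\<dagger> * f (a (site (int n) v))"
      using arg_cong[OF x(2)[of n v], of star] by (simp add: star_mult star_star)
    then show "a (site (int n) v) \<in> {A \<in> car_right a. f A \<in> ?C}"
      using x(1)[of n v] car_right_site[OF car, of "int n" v] by (simp add: commutant_def)
  qed
  then show ?thesis using A by (auto simp: commutant_def)
qed

lemma car_hom_unique:
  fixes f g :: "'a::cstar_algebra \<Rightarrow> 'h::chilbert bop"
  assumes car: "car_algebra a" and f: "star_hom False UNIV f" and g: "star_hom False UNIV g"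
    and eq: "\<And>h. h \<in> l2Z \<Longrightarrow> f (a h) = g (a h)"
  shows "f A = g A"
proof -
  have "closed {A. f A = g A}"
    using star_hom_continuous[OF f cstar_subalgebra_UNIV] star_hom_continuous[OF g cstar_subalgebra_UNIV]
    by (rule closed_Collect_eq)
  then have "cstar_subalgebra {A. f A = g A}"
    using f g by (auto simp: cstar_subalgebra_def star_hom_def)
  then have "cstar_generated (a ` l2Z) \<subseteq> {A. f A = g A}"
    using eq by (intro cstar_generated_minimal) auto
  then show ?thesis using car by (auto simp: car_algebra_def)
qed

text \<open>The part of the situation that does not involve the symmetry group, with
  \<open>grading\<close> replaced by an arbitrary self-adjoint unitary \<Gamma>.\<close>

locale half_line_system =
  fixes a :: "(int \<Rightarrow> (complex, 'd::{finite,linorder}) vec) \<Rightarrow> 'a::cstar_algebra"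
    and \<tau> :: "int \<Rightarrow> 'a \<Rightarrow> 'a" and \<Theta> :: "'a \<Rightarrow> 'a" and E :: "'d set \<Rightarrow> 'd set \<Rightarrow> 'a"
    and \<omega> :: "'a \<Rightarrow> complex" and \<pi> :: "'a \<Rightarrow> 'h::chilbert bop" and \<Omega> :: 'h
    and M :: "'h bop set" and \<Gamma>\<omega> :: "'h bop" and \<tau>\<omega> :: "'h bop \<Rightarrow> 'h bop"
    and \<Gamma> :: "'b::chilbert bop" and \<iota> :: "'h bop \<Rightarrow> 'b bop" and \<rho> :: "'b bop \<Rightarrow> 'b bop"
  assumes car: "car_algebra a"
    and \<tau>: "\<And>x. bogoliubov a False (shift x) (\<tau> x)"
    and \<Theta>: "bogoliubov a False (\<lambda>f x. - f x) \<Theta>"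
    and E: "site_matrix_units a E"
    and pure: "pure_state \<omega>"
    and translation_invariant: "\<And>x A. \<omega> (\<tau> x A) = \<omega> A"
    and gns: "gns UNIV \<omega> \<pi> \<Omega>"
    and M: "M = bicommutant (\<pi> ` car_right a)"
    and \<Gamma>\<omega>: "\<And>A. \<Gamma>\<omega> \<cdot> \<pi> A \<cdot> \<Omega> = \<pi> (\<Theta> A) \<cdot> \<Omega>"
    and \<Gamma>\<omega>_M: "star_iso False M M (Ad \<Gamma>\<omega>)"
    and M_vN: "bicommutant M = M"
    and \<tau>\<omega>: "star_iso False (bicommutant (range \<pi>)) (bicommutant (range \<pi>)) \<tau>\<omega>"
    and \<tau>\<omega>_\<pi>: "\<And>A. \<tau>\<omega> (\<pi> A) = \<pi> (\<tau> 1 A)"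
    and \<Gamma>: "\<Gamma>\<^sup>\<dagger> = \<Gamma>" "\<Gamma> * \<Gamma> = 1"
    and \<iota>: "star_iso False M UNIV \<iota>"
    and \<iota>_\<Gamma>: "\<And>x. x \<in> M \<Longrightarrow> \<iota> (Ad \<Gamma>\<omega> x) = Ad \<Gamma> (\<iota> x)"
    and \<rho>: "\<rho> = \<iota> \<circ> \<tau>\<omega> \<circ> inv_into M \<iota>"
begin

definition j where "j = inv_into M \<iota>"

definition R where "R A = \<iota> (\<pi> A)"

definition e where "e \<mu> \<nu> = R (E \<mu> \<nu>)"

definition S :: "nat \<Rightarrow> 'b bop set" where
  "S n = (\<Union>v. {R (a (site (int n) v)), (R (a (site (int n) v)))\<^sup>\<dagger>})"

lemma \<pi>_hom: "star_hom False UNIV \<pi>"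
  using gns by (simp add: gns_def)

lemma \<pi>_simps: "\<pi> 1 = 1" "\<pi> (x + y) = \<pi> x + \<pi> y" "\<pi> (x * y) = \<pi> x * \<pi> y" "\<pi> (x\<^sup>\<dagger>) = (\<pi> x)\<^sup>\<dagger>"
  "\<pi> (c *\<^sub>C x) = c *\<^sub>C \<pi> x"
  using \<pi>_hom by (auto simp: star_hom_def)

text \<open>Purity makes the commutant trivial. Hence \<open>\<tau>\<omega>\<close> is an
  automorphism of all bounded operators, and its surjectivity can be used.\<close>

lemma bicommutant_range: "bicommutant (range \<pi>) = UNIV"
proof -
  have "x * y = y * x" if "y \<in> commutant (range \<pi>)" for x y
    using pure_commutant[OF pure gns that] by (auto simp: scaleC_mult_left scaleC_mult_right)
  then show ?thesis by (auto simp: commutant_def[of "commutant _"])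
qed

lemma car_right_subalgebra: "cstar_subalgebra (car_right a)"
  unfolding car_local_def by (rule cstar_subalgebra_generated)

lemma M_subalgebra: "cstar_subalgebra M"
proof -
  have "cstar_subalgebra (commutant (\<pi> ` car_right a))"
    using car_right_subalgebra
    by (intro cstar_subalgebra_commutant) (auto simp: cstar_subalgebra_def simp flip: \<pi>_simps)
  then show ?thesis unfolding M by (intro cstar_subalgebra_commutant) (auto simp: cstar_subalgebra_def)
qed

lemma \<pi>_M: "A \<in> car_right a \<Longrightarrow> \<pi> A \<in> M"
  unfolding M by (auto simp: commutant_def)

lemma commutant_M: "c \<in> commutant (\<pi> ` car_right a) \<Longrightarrow> x \<in> M \<Longrightarrow> x * c = c * x"
  unfolding M by (auto simp: commutant_def[of "commutant _"])

lemma \<iota>_simps: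
  "\<iota> 1 = 1" "x \<in> M \<Longrightarrow> y \<in> M \<Longrightarrow> \<iota> (x + y) = \<iota> x + \<iota> y"
  "x \<in> M \<Longrightarrow> y \<in> M \<Longrightarrow> \<iota> (x * y) = \<iota> x * \<iota> y" "x \<in> M \<Longrightarrow> \<iota> (x\<^sup>\<dagger>) = (\<iota> x)\<^sup>\<dagger>"
  "x \<in> M \<Longrightarrow> \<iota> (c *\<^sub>C x) = c *\<^sub>C \<iota> x"
  using \<iota> by (auto simp: star_iso_def star_hom_def)

lemma j_iso: "star_iso False UNIV M j"
  unfolding j_def by (rule star_iso_inverse[OF \<iota> M_subalgebra])

lemma j_simps:
  "j 1 = 1" "j (x + y) = j x + j y" "j (x * y) = j x * j y" "j (x\<^sup>\<dagger>) = (j x)\<^sup>\<dagger>"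
  "j (c *\<^sub>C x) = c *\<^sub>C j x"
  using j_iso by (auto simp: star_iso_def star_hom_def)

lemma j_M: "j y \<in> M" and \<iota>_j: "\<iota> (j y) = y" and j_\<iota>: "x \<in> M \<Longrightarrow> j (\<iota> x) = x"
  using \<iota> unfolding j_def star_iso_def bij_betw_def by (auto simp: inv_into_into f_inv_into_f)

lemma j_R: "A \<in> car_right a \<Longrightarrow> j (R A) = \<pi> A"
  by (simp add: R_def j_\<iota> \<pi>_M)

lemma R_hom: "star_hom False (car_right a) R"
proof -
  have "star_hom False (car_right a) \<pi>" using \<pi>_hom by (simp add: star_hom_def)
  from star_hom_compose[OF this, of False M \<iota>] show ?thesis
    using \<iota> \<pi>_M by (simp add: R_def[abs_def] star_iso_def)
qed

lemma R_simps:
  "A \<in> car_right a \<Longrightarrow> A' \<in> car_right a \<Longrightarrow> R (A + A') = R A + R A'"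
  "A \<in> car_right a \<Longrightarrow> A' \<in> car_right a \<Longrightarrow> R (A * A') = R A * R A'"
  "A \<in> car_right a \<Longrightarrow> R (A\<^sup>\<dagger>) = (R A)\<^sup>\<dagger>" "A \<in> car_right a \<Longrightarrow> R (c *\<^sub>C A) = c *\<^sub>C R A" "R 1 = 1"
  using R_hom by (auto simp: star_hom_def)

lemma site_right: "a (site (int n) v) \<in> car_right a"
  by (rule car_right_site[OF car]) simp

text \<open>If \<open>x\<close> commutes with the generators, \<open>j x\<close> lies in the
  commutant of the half-line algebra and so commutes with \<open>M\<close>. Since \<iota> maps
  \<open>M\<close> onto all bounded operators, \<open>x\<close> commutes with all of them.\<close>

lemma R_irreducible:
  assumes x: "\<And>n s. s \<in> S n \<Longrightarrow> x * s = s * x"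
  shows "\<exists>c. x = c *\<^sub>C 1"
proof -
  have xR: "x * R A = R A * x" if "A \<in> car_right a" for A
  proof (rule car_hom_commute[OF car R_hom _ _ that])
    fix n v
    show "x * R (a (site (int n) v)) = R (a (site (int n) v)) * x"
      by (rule x[of _ n]) (auto simp: S_def)
    show "x * (R (a (site (int n) v)))\<^sup>\<dagger> = (R (a (site (int n) v)))\<^sup>\<dagger> * x"
      by (rule x[of _ n]) (auto simp: S_def)
  qed
  have "j x * \<pi> A = \<pi> A * j x" if "A \<in> car_right a" for A
    using arg_cong[OF xR[OF that], of j] that by (simp add: j_simps j_R)
  then have "j x \<in> commutant (\<pi> ` car_right a)" by (auto simp: commutant_def)
  then have "j y * j x = j x * j y" for y using commutant_M j_M by blast
  then have "x * y = y * x" for y by (metis \<iota>_j j_simps(3))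
  then show ?thesis by (metis commutant_UNIV_scalar)
qed

lemma \<Theta>_site: "\<Theta> (a (site x v)) = - a (site x v)"
proof -
  have "\<Theta> (a (site x v)) = a (\<lambda>y. - site x v y)"
    using \<Theta> site_l2Z by (auto simp: bogoliubov_def)
  also have "\<dots> = a (\<lambda>y. (-1) *\<^sub>C site x v y)" by (simp add: scaleC_minus_left)
  also have "\<dots> = - a (site x v)"
    using car_scaleC[OF car site_l2Z, of "-1"] by (simp add: scaleC_minus_left)
  finally show ?thesis .
qed

lemma \<Theta>_hom: "star_hom False UNIV \<Theta>"
  using \<Theta> by (simp add: bogoliubov_def star_iso_def)

lemma \<pi>_\<Theta>_\<Theta>: "\<pi> (\<Theta> (\<Theta> A)) = \<pi> A"
proof (rule car_hom_unique[OF car])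
  show "star_hom False UNIV (\<lambda>A. \<pi> (\<Theta> (\<Theta> A)))"
    using star_hom_compose[OF star_hom_compose[OF \<Theta>_hom \<Theta>_hom] \<pi>_hom] by simp
  show "\<pi> (\<Theta> (\<Theta> (a h))) = \<pi> (a h)" if h: "h \<in> l2Z" for h
  proof -
    have "(\<lambda>x. - h x) \<in> l2Z" using h by (simp add: l2Z_def)
    then show ?thesis using h \<Theta> by (simp add: bogoliubov_def)
  qed
qed (rule \<pi>_hom)

lemma dense: "closure (range (\<lambda>A. \<pi> A \<cdot> \<Omega>)) = UNIV"
  by (rule gns_dense[OF pure gns])

lemma \<Gamma>\<omega>_square: "\<Gamma>\<omega> * \<Gamma>\<omega> = 1"
  by (rule bop_eq_on_dense[OF dense]) (auto simp: bop_simps \<Gamma>\<omega> \<pi>_\<Theta>_\<Theta>)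

text \<open>That \<open>Ad \<Gamma>\<omega>\<close> preserves 1 makes
  \<open>\<Gamma>\<omega>\<close> a coisometry; since it is also its own inverse, it is
  self-adjoint.\<close>

lemma \<Gamma>\<omega>_star: "\<Gamma>\<omega>\<^sup>\<dagger> = \<Gamma>\<omega>"
proof -
  have "\<Gamma>\<omega> * \<Gamma>\<omega>\<^sup>\<dagger> = 1" using \<Gamma>\<omega>_M by (simp add: star_iso_def star_hom_def Ad_def)
  then have "\<Gamma>\<omega> * \<Gamma>\<omega> * \<Gamma>\<omega>\<^sup>\<dagger> = \<Gamma>\<omega>" by (simp add: mult.assoc)
  then show ?thesis by (simp add: \<Gamma>\<omega>_square)
qed

lemma \<Gamma>\<omega>_\<pi>: "\<Gamma>\<omega> * \<pi> A * \<Gamma>\<omega> = \<pi> (\<Theta> A)"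
proof (rule bop_eq_on_dense[OF dense], clarify)
  fix B
  have "(\<Gamma>\<omega> * \<pi> A * \<Gamma>\<omega>) \<cdot> \<pi> B \<cdot> \<Omega> = \<Gamma>\<omega> \<cdot> \<pi> (A * \<Theta> B) \<cdot> \<Omega>" by (simp add: bop_simps \<Gamma>\<omega> \<pi>_simps)
  also have "\<dots> = \<pi> (\<Theta> A * \<Theta> (\<Theta> B)) \<cdot> \<Omega>" using \<Theta>_hom by (simp add: \<Gamma>\<omega> star_hom_def)
  also have "\<dots> = \<pi> (\<Theta> A) \<cdot> \<pi> B \<cdot> \<Omega>" by (simp add: \<pi>_simps \<pi>_\<Theta>_\<Theta> bop_simps)
  finally show "(\<Gamma>\<omega> * \<pi> A * \<Gamma>\<omega>) \<cdot> \<pi> B \<cdot> \<Omega> = \<pi> (\<Theta> A) \<cdot> \<pi> B \<cdot> \<Omega>" .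
qed

lemma R_\<Theta>: "A \<in> car_right a \<Longrightarrow> \<Gamma> * R A * \<Gamma> = R (\<Theta> A)"
  using \<iota>_\<Gamma>[OF \<pi>_M] by (simp add: R_def Ad_def \<Gamma>\<omega>_star \<Gamma> \<Gamma>\<omega>_\<pi>)

lemma R_minus: "A \<in> car_right a \<Longrightarrow> R (- A) = - R A"
  using R_simps(4)[of A "-1"] by (simp add: scaleC_minus_left)

lemma \<tau>_hom: "star_hom False UNIV (\<tau> x)"
  using \<tau> by (simp add: bogoliubov_def star_iso_def)

lemma \<tau>_site: "\<tau> x (a (site y v)) = a (site (y + x) v)"
proof -
  have "\<tau> x (a (site y v)) = a (shift x (site y v))"
    using \<tau>[of x] site_l2Z unfolding bogoliubov_def by blast
  then show ?thesis by (simp add: shift_site)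
qed

lemma \<pi>_\<tau>_hom: "star_hom False UNIV (\<lambda>A. \<pi> (\<tau> 1 A))"
  using star_hom_compose[OF \<tau>_hom \<pi>_hom] by simp

lemma \<tau>\<omega>_simps: "\<tau>\<omega> (x * y) = \<tau>\<omega> x * \<tau>\<omega> y" "\<tau>\<omega> x = \<tau>\<omega> y \<longleftrightarrow> x = y"
  and \<tau>\<omega>_surj: "\<exists>x. \<tau>\<omega> x = y" and \<tau>\<omega>_hom: "star_hom False UNIV \<tau>\<omega>"
proof -
  have "bij \<tau>\<omega>" and hom: "star_hom False UNIV \<tau>\<omega>"
    using \<tau>\<omega> unfolding bicommutant_range star_iso_def by auto
  then show "\<tau>\<omega> x = \<tau>\<omega> y \<longleftrightarrow> x = y" "\<exists>x. \<tau>\<omega> x = y"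
    by (auto simp: bij_def inj_eq dest: surjD[of _ y])
  show "star_hom False UNIV \<tau>\<omega>" by (rule hom)
  then show "\<tau>\<omega> (x * y) = \<tau>\<omega> x * \<tau>\<omega> y" by (simp add: star_hom_def)
qed

lemma \<pi>_\<tau>_M: "A \<in> car_right a \<Longrightarrow> \<pi> (\<tau> 1 A) \<in> M"
proof -
  have "star_hom False (car_right a) (\<lambda>A. \<pi> (\<tau> 1 A))" using \<pi>_\<tau>_hom by (simp add: star_hom_def)
  then have "cstar_subalgebra {A \<in> car_right a. \<pi> (\<tau> 1 A) \<in> M}"
    by (rule star_hom_preimage_subalgebra[OF _ car_right_subalgebra M_subalgebra])
  moreover have "a (site (int n) v) \<in> {A \<in> car_right a. \<pi> (\<tau> 1 A) \<in> M}" for n v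
    using site_right[of "Suc n" v] site_right[of n v] by (simp add: \<tau>_site \<pi>_M add.commute)
  ultimately show "A \<in> car_right a \<Longrightarrow> \<pi> (\<tau> 1 A) \<in> M" using car_right_subset[OF car] by blast
qed

text \<open>Surjectivity of \<open>\<tau>\<omega>\<close> provides a preimage of \<open>x\<close>,
  and injectivity pulls the commutation relations back from the translated algebra.\<close>

lemma \<tau>\<omega>_commutant:
  assumes "\<And>A. A \<in> car_right a \<Longrightarrow> x * \<pi> (\<tau> 1 A) = \<pi> (\<tau> 1 A) * x"
  obtains x' where "x = \<tau>\<omega> x'" "x' \<in> commutant (\<pi> ` car_right a)"
proof -
  obtain x' where x': "\<tau>\<omega> x' = x" using \<tau>\<omega>_surj by blast
  have "x' * \<pi> A = \<pi> A * x'" if "A \<in> car_right a" for A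
  proof -
    have "\<tau>\<omega> (x' * \<pi> A) = \<tau>\<omega> (\<pi> A * x')"
      by (simp only: \<tau>\<omega>_simps(1) x' \<tau>\<omega>_\<pi> assms[OF that])
    then show ?thesis by (simp only: \<tau>\<omega>_simps(2))
  qed
  then show ?thesis using that[of x'] x' by (auto simp: commutant_def)
qed

text \<open>An element commuting with the half-line algebra commutes with its translate, so it is
  the image under \<open>\<tau>\<omega>\<close> of an element commuting with \<open>x\<close>. Thus
  \<open>\<tau>\<omega> x\<close> commutes with it and lies in the bicommutant.\<close>

lemma \<tau>\<omega>_M: "x \<in> M \<Longrightarrow> \<tau>\<omega> x \<in> M"
proof -
  assume x: "x \<in> M"
  have "\<tau>\<omega> x * c = c * \<tau>\<omega> x" if c: "c \<in> commutant (\<pi> ` car_right a)" for c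
  proof -
    have "c * \<pi> (\<tau> 1 A) = \<pi> (\<tau> 1 A) * c" if "A \<in> car_right a" for A
      using commutant_M[OF c \<pi>_\<tau>_M[OF that]] by simp
    then obtain c' where "c = \<tau>\<omega> c'" "c' \<in> commutant (\<pi> ` car_right a)" using \<tau>\<omega>_commutant by blast
    then show ?thesis using commutant_M[of c' x] x by (simp flip: \<tau>\<omega>_simps(1))
  qed
  then show "\<tau>\<omega> x \<in> M" unfolding M by (auto simp: commutant_def[of "commutant _"])
qed

lemma \<rho>_def': "\<rho> y = \<iota> (\<tau>\<omega> (j y))"
  by (simp add: \<rho> j_def)

lemma \<rho>_hom: "star_hom False UNIV \<rho>"
proof -
  have "star_hom False UNIV (\<lambda>y. \<tau>\<omega> (j y))"
    using star_hom_compose[of False UNIV j False UNIV \<tau>\<omega>] j_iso \<tau>\<omega>_hom by (simp add: star_iso_def)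
  from star_hom_compose[OF this, of False M \<iota>] show ?thesis
    using \<iota> j_M \<tau>\<omega>_M by (simp add: \<rho>_def'[abs_def] star_iso_def)
qed

lemma \<rho>_inj: "inj \<rho>"
proof (rule injI)
  fix x y assume "\<rho> x = \<rho> y"
  then have "j (\<iota> (\<tau>\<omega> (j x))) = j (\<iota> (\<tau>\<omega> (j y)))" by (simp add: \<rho>_def')
  then have "j x = j y" by (simp add: j_\<iota> \<tau>\<omega>_M j_M \<tau>\<omega>_simps)
  then show "x = y" by (metis \<iota>_j)
qed

lemma \<rho>_R: "A \<in> car_right a \<Longrightarrow> \<rho> (R A) = R (\<tau> 1 A)"
  by (simp add: \<rho>_def' j_R \<tau>\<omega>_\<pi>) (simp add: R_def)

lemma \<rho>_site: "\<rho> (R (a (site (int n) v))) = R (a (site (int (Suc n)) v))"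
  by (simp add: \<rho>_R site_right \<tau>_site add.commute)

lemma \<rho>_star: "\<rho> (x\<^sup>\<dagger>) = (\<rho> x)\<^sup>\<dagger>"
  using \<rho>_hom by (simp add: star_hom_def)

section \<open>The algebra of the site 0 as the operators on Fock space\<close>

definition j0 where
  "j0 = (SOME j. star_iso False UNIV (car_local a {0}) j \<and>
        (\<forall>v. j (fock_annihilate v) = a (\<lambda>x. if x = 0 then v else 0)) \<and>
        (\<forall>\<mu> \<nu>. E \<mu> \<nu> = j (butterfly (fock_basis \<mu>) (fock_basis \<nu>))))"

lemma j0: "star_iso False UNIV (car_local a {0}) j0"
  "j0 (fock_annihilate v) = a (site 0 v)"
  "E \<mu> \<nu> = j0 (butterfly (fock_basis \<mu>) (fock_basis \<nu>))"
  using someI_ex[OF E[unfolded site_matrix_units_def]] unfolding j0_def[symmetric] site_def by blast+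

lemma j0_hom: "star_hom False UNIV j0"
  using j0(1) by (simp add: star_iso_def)

lemma j0_simps: "j0 1 = 1" "j0 (x + y) = j0 x + j0 y" "j0 (x * y) = j0 x * j0 y" "j0 (x\<^sup>\<dagger>) = (j0 x)\<^sup>\<dagger>"
  "j0 (c *\<^sub>C x) = c *\<^sub>C j0 x" "j0 0 = 0"
  using j0_hom star_hom_zero[OF j0_hom] by (auto simp: star_hom_def)

lemma j0_right: "j0 X \<in> car_right a"
proof -
  have "j0 X \<in> car_local a {0}" using j0(1) by (auto simp: star_iso_def bij_betw_def)
  moreover have "car_local a {0} \<subseteq> car_right a"
    unfolding car_local_def by (intro cstar_generated_minimal cstar_subalgebra_generated)
      (auto intro!: cstar_generated_incl)
  ultimately show ?thesis by blast
qed

lemma j0_eq: "j0 x = j0 y \<longleftrightarrow> x = y"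
  using j0(1) by (auto simp: star_iso_def bij_betw_def inj_eq)

text \<open>The relations are pulled back from those of \<open>a\<close> at the site 0 along the
  injective homomorphism \<open>j0\<close>.\<close>

lemma fock_car:
  "fock_annihilate f * fock_annihilate g + fock_annihilate g * fock_annihilate f = (0 :: 'd fock bop)"
  "fock_annihilate f * fock_create g + fock_create g * fock_annihilate f = cinner f g *\<^sub>C (1 :: 'd fock bop)"
  unfolding j0_eq[symmetric]
  using car_anticommute[OF car site_l2Z site_l2Z, of 0 f 0 g]
    car_anticommute_star[OF car site_l2Z site_l2Z, of 0 f 0 g]
  by (simp_all add: j0_simps j0(2) l2inner_site flip: fock_annihilate_star)

text \<open>Unitary and anti-unitary maps preserve orthonormal bases, so
  \<open>matrix_unit_word_fock\<close> applies. The identity map recovers the given matrix units, a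
  symmetry yields their transforms.\<close>

lemma frame_matrix_unit_word:
  assumes V: "unitary_map al (V :: (complex, 'd) vec \<Rightarrow> (complex, 'd) vec)"
  shows "matrix_unit_word (\<lambda>i. a (site 0 (V (axis i 1)))) \<mu> \<nu> =
    j0 (butterfly (fock_word (map (\<lambda>i. V (axis i 1)) (sorted_list_of_set \<mu>)))
      (fock_word (map (\<lambda>i. V (axis i 1)) (sorted_list_of_set \<nu>))))"
proof -
  have V': "surj V" "V (x + y) = V x + V y" "V (c *\<^sub>C x) = (if al then cnj c else c) *\<^sub>C V x"
    "cinner (V x) (V y) = (if al then cnj (cinner x y) else cinner x y)" for x y c
    using V by (auto simp: unitary_map_def)
  have V0: "V 0 = 0" using V'(3)[of 0 0] by (cases al) simp_all
  have orth: "cinner (V (axis i 1)) (V (axis j 1)) = (if i = j then 1 else 0)" for i j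
    by (simp add: V' cinner_axis) (simp add: axis_def)
  have span: "\<exists>c. v = (\<Sum>i\<in>UNIV. c i *\<^sub>C V (axis i 1))" for v
  proof -
    obtain w where "v = V w" using V'(1) by blast
    also have "V w = V (\<Sum>i\<in>UNIV. (w $ i) *\<^sub>C axis i 1)" by (rule arg_cong[OF vec_expansion])
    also have "\<dots> = (\<Sum>i\<in>UNIV. (if al then cnj (w $ i) else w $ i) *\<^sub>C V (axis i 1))"
    proof -
      have "V (\<Sum>i\<in>I. f i) = (\<Sum>i\<in>I. V (f i))" for I :: "'d set" and f
        by (induction I rule: infinite_finite_induct) (simp_all add: V' V0)
      then show ?thesis by (simp only: V')
    qed
    finally show ?thesis by (rule exI[of _ "\<lambda>i. if al then cnj (w $ i) else w $ i"])
  qed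
  have "matrix_unit_word (\<lambda>i. a (site 0 (V (axis i 1)))) \<mu> \<nu> =
      j0 (matrix_unit_word (\<lambda>i. fock_annihilate (V (axis i 1))) \<mu> \<nu>)"
    by (simp add: star_hom_matrix_unit_word[OF j0_hom] j0(2))
  also have "\<dots> = j0 (butterfly (fock_word (map (\<lambda>i. V (axis i 1)) (sorted_list_of_set \<mu>)))
      (fock_word (map (\<lambda>i. V (axis i 1)) (sorted_list_of_set \<nu>))))"
    by (subst matrix_unit_word_fock[OF fock_car orth span]) simp
  finally show ?thesis .
qed

lemma E_word: "E \<mu> \<nu> = matrix_unit_word (\<lambda>i. a (site 0 (axis i 1))) \<mu> \<nu>"
proof -
  have "unitary_map False (\<lambda>v::(complex, 'd) vec. v)" by (simp add: unitary_map_def surj_def)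
  from frame_matrix_unit_word[OF this] show ?thesis by (simp add: j0(3) fock_basis_def)
qed

lemma \<tau>_E: "\<tau> x (E \<mu> \<nu>) = matrix_unit_word (\<lambda>i. a (site x (axis i 1))) \<mu> \<nu>"
  by (simp add: E_word star_hom_matrix_unit_word[OF \<tau>_hom] \<tau>_site)

lemma \<tau>_E_right: "\<tau> (int n) (E \<mu> \<nu>) \<in> car_right a"
  unfolding \<tau>_E by (rule matrix_unit_word_subalgebra[OF car_right_subalgebra site_right])

lemma E_right: "E \<mu> \<nu> \<in> car_right a"
  unfolding E_word using matrix_unit_word_subalgebra[OF car_right_subalgebra site_right[of 0]] by simp

lemma \<rho>_\<tau>_E: "R (\<tau> (int n) (E \<mu> \<nu>)) = (\<rho> ^^ n) (e \<mu> \<nu>)"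
proof (induction n)
  case 0
  show ?case using \<tau>_E[of 0 \<mu> \<nu>] E_word[of \<mu> \<nu>] by (simp add: e_def)
next
  case (Suc n)
  have "(\<rho> ^^ Suc n) (e \<mu> \<nu>) = \<rho> (R (\<tau> (int n) (E \<mu> \<nu>)))" by (simp add: Suc)
  also have "\<dots> = R (\<tau> (int (Suc n)) (E \<mu> \<nu>))"
    by (simp add: \<rho>_R \<tau>_E_right) (simp add: \<tau>_E star_hom_matrix_unit_word[OF \<tau>_hom] \<tau>_site add.commute)
  finally show ?case by simp
qed

lemma R_j0_sum: "R (j0 (\<Sum>i\<in>I. f i)) = (\<Sum>i\<in>I. R (j0 (f i)))"
proof -
  have "j0 (\<Sum>i\<in>I. f i) = (\<Sum>i\<in>I. j0 (f i))" by (rule star_hom_sum[OF j0_hom]) auto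
  then show ?thesis
    using star_hom_sum[OF R_hom car_right_subalgebra, of I "\<lambda>i. j0 (f i)"] j0_right by simp
qed

lemma R_j0_scaleC: "R (j0 (c *\<^sub>C X)) = c *\<^sub>C R (j0 X)"
  by (simp add: j0_simps R_simps j0_right)

lemma R_j0_butterfly: "R (j0 (butterfly (fock_basis \<mu>) (fock_basis \<nu>))) = e \<mu> \<nu>"
  by (simp add: e_def j0(3))

lemma R_j0_expansion:
  "R (j0 X) = (\<Sum>\<mu>\<in>UNIV. \<Sum>\<nu>\<in>UNIV. cinner (fock_basis \<mu>) (X \<cdot> fock_basis \<nu>) *\<^sub>C e \<mu> \<nu>)"
  by (subst fock_operator_expansion[of X]) (simp add: R_j0_sum R_j0_scaleC R_j0_butterfly)

text \<open>Two signs cancel: one from anticommuting the generator through the word of the matrix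
  unit, and one from moving it, as an odd element, through the power of \<Gamma>.\<close>

lemma e_site_commute:
  assumes "s = R (a (site (int (Suc n)) v)) \<or> s = (R (a (site (int (Suc n)) v)))\<^sup>\<dagger>"
  shows "e \<mu> \<nu> * \<Gamma> ^ (parity \<mu> + parity \<nu>) * s = s * (e \<mu> \<nu> * \<Gamma> ^ (parity \<mu> + parity \<nu>))"
proof -
  define b where "b = (if s = R (a (site (int (Suc n)) v)) then a (site (int (Suc n)) v)
    else (a (site (int (Suc n)) v))\<^sup>\<dagger>)"
  let ?k = "parity \<mu> + parity \<nu>"
  have b: "b \<in> car_right a" "R b = s"
    using assms site_right[of "Suc n" v] car_right_subalgebra R_simps(3)[OF site_right[of "Suc n" v]]
    by (auto simp: b_def cstar_subalgebra_def)
  have anti: "a (site (int (Suc n)) v) * a (site 0 w) = - (a (site 0 w) * a (site (int (Suc n)) v))"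
    "a (site (int (Suc n)) v) * (a (site 0 w))\<^sup>\<dagger> = - ((a (site 0 w))\<^sup>\<dagger> * a (site (int (Suc n)) v))" for w
    using car_anticommute[OF car site_l2Z site_l2Z, of "int (Suc n)" v 0 w]
      car_anticommute_star[OF car site_l2Z site_l2Z, of "int (Suc n)" v 0 w]
    by (simp_all add: l2inner_site eq_neg_iff_add_eq_0)
  have anti': "(a (site (int (Suc n)) v))\<^sup>\<dagger> * a (site 0 w) = - (a (site 0 w) * (a (site (int (Suc n)) v))\<^sup>\<dagger>)"
    "(a (site (int (Suc n)) v))\<^sup>\<dagger> * (a (site 0 w))\<^sup>\<dagger> = - ((a (site 0 w))\<^sup>\<dagger> * (a (site (int (Suc n)) v))\<^sup>\<dagger>)" for w
    using arg_cong[OF anti(1)[of w], of star] arg_cong[OF anti(2)[of w], of star]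
    by (simp_all add: star_mult star_star star_minus)
  have "b * E \<mu> \<nu> = ((-1) ^ ?k) *\<^sub>C (E \<mu> \<nu> * b)"
    unfolding E_word by (rule matrix_unit_word_anticommute) (auto simp: b_def anti anti' simp del: of_nat_Suc)
  then have "R (b * E \<mu> \<nu>) = R (((-1) ^ ?k) *\<^sub>C (E \<mu> \<nu> * b))" by simp
  moreover have "E \<mu> \<nu> * b \<in> car_right a"
    using b(1) E_right car_right_subalgebra by (simp add: cstar_subalgebra_def)
  ultimately have 1: "s * e \<mu> \<nu> = ((-1) ^ ?k) *\<^sub>C (e \<mu> \<nu> * s)"
    using b E_right by (simp add: R_simps e_def)
  have "\<Theta> b = - b"
    using \<Theta>_hom \<Theta>_site[of "int (Suc n)" v] by (simp add: b_def star_hom_def star_minus)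
  then have "\<Gamma> * s * \<Gamma> = - s" using R_\<Theta>[OF b(1)] R_minus[OF b(1)] b(2) by simp
  then have "\<Gamma> * s * \<Gamma> * \<Gamma> = - s * \<Gamma>" by simp
  then have g: "\<Gamma> * s = - (s * \<Gamma>)" by (simp add: mult.assoc \<Gamma>)
  have 2: "\<Gamma> ^ k * s = ((-1) ^ k) *\<^sub>C (s * \<Gamma> ^ k)" for k
    using power_commute_sign[of \<Gamma> s 1 k] g by (simp add: scaleC_minus_left)
  have "e \<mu> \<nu> * \<Gamma> ^ ?k * s = ((-1) ^ ?k) *\<^sub>C (e \<mu> \<nu> * s * \<Gamma> ^ ?k)"
    by (simp add: mult.assoc 2 scaleC_mult_right)
  also have "\<dots> = s * e \<mu> \<nu> * \<Gamma> ^ ?k" unfolding 1 by (simp add: scaleC_mult_left)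
  finally show ?thesis by (simp add: mult.assoc)
qed

text \<open>
  The twisted matrix unit lies in \<open>\<iota> ` M\<close> and commutes with the translated algebra.  Pulling it back
  along the automorphism \<open>\<tau>\<omega>\<close> of the bounded operators gives an element of the commutant of \<open>M\<close>, so
  no weak continuity is needed to pass from the C*-algebra to all of \<open>M\<close>.
\<close>

lemma e_\<rho>: "e \<mu> \<nu> * \<Gamma> ^ (parity \<mu> + parity \<nu>) * \<rho> y = \<rho> y * (e \<mu> \<nu> * \<Gamma> ^ (parity \<mu> + parity \<nu>))"
proof -
  let ?x = "e \<mu> \<nu> * \<Gamma> ^ (parity \<mu> + parity \<nu>)"
  have jx: "j ?x * \<pi> (\<tau> 1 A) = \<pi> (\<tau> 1 A) * j ?x" if A: "A \<in> car_right a" for A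
  proof (rule car_hom_commute[OF car _ _ _ A])
    show "star_hom False (car_right a) (\<lambda>A. \<pi> (\<tau> 1 A))" using \<pi>_\<tau>_hom by (simp add: star_hom_def)
    fix n v
    let ?b = "a (site (int (Suc n)) v)"
    have jb: "j (R ?b) = \<pi> (\<tau> 1 (a (site (int n) v)))"
      using j_R[OF site_right[of "Suc n" v]] by (simp add: \<tau>_site add.commute)
    show "j ?x * \<pi> (\<tau> 1 (a (site (int n) v))) = \<pi> (\<tau> 1 (a (site (int n) v))) * j ?x"
      using arg_cong[OF e_site_commute[of "R ?b" n v \<mu> \<nu>], of j] by (simp add: j_simps jb del: of_nat_Suc)
    show "j ?x * (\<pi> (\<tau> 1 (a (site (int n) v))))\<^sup>\<dagger> = (\<pi> (\<tau> 1 (a (site (int n) v))))\<^sup>\<dagger> * j ?x"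
      using arg_cong[OF e_site_commute[of "(R ?b)\<^sup>\<dagger>" n v \<mu> \<nu>], of j] by (simp add: j_simps jb del: of_nat_Suc)
  qed
  obtain x' where x': "j ?x = \<tau>\<omega> x'" "x' \<in> commutant (\<pi> ` car_right a)"
    using \<tau>\<omega>_commutant[OF jx] by blast
  have "j ?x * \<tau>\<omega> (j y) = \<tau>\<omega> (j y) * j ?x"
    using commutant_M[OF x'(2) j_M[of y]] by (simp add: x'(1) flip: \<tau>\<omega>_simps(1))
  then have "\<iota> (j ?x * \<tau>\<omega> (j y)) = \<iota> (\<tau>\<omega> (j y) * j ?x)" by simp
  then show ?thesis by (simp add: \<iota>_simps(3) j_M \<tau>\<omega>_M \<iota>_j \<rho>_def')
qed

sublocale graded_translation \<rho> \<Gamma> e S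
proof
  show "e \<mu> \<nu> * e \<kappa> \<eta> = (if \<nu> = \<kappa> then e \<mu> \<eta> else 0)" for \<mu> \<nu> \<kappa> \<eta>
  proof -
    have "e \<mu> \<nu> * e \<kappa> \<eta> = R (j0 (butterfly (fock_basis \<mu>) (fock_basis \<nu>) * butterfly (fock_basis \<kappa>) (fock_basis \<eta>)))"
      by (simp add: e_def j0(3) j0_simps R_simps j0_right)
    then show ?thesis
      by (simp add: butterfly_butterfly cinner_fock_basis_basis R_j0_scaleC R_j0_butterfly)
  qed
  show "(e \<mu> \<nu>)\<^sup>\<dagger> = e \<nu> \<mu>" for \<mu> \<nu>
    by (simp add: e_def j0(3) star_butterfly j0_right flip: R_simps(3) j0_simps(4))
  have "(\<Sum>\<mu>\<in>UNIV. e \<mu> \<mu>) = R (j0 (\<Sum>\<mu>\<in>UNIV. butterfly (fock_basis \<mu>) (fock_basis \<mu>)))"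
    by (simp add: R_j0_sum R_j0_butterfly)
  then show "(\<Sum>\<mu>\<in>UNIV. e \<mu> \<mu>) = 1" by (simp add: fock_basis_identity j0_simps R_simps)
  show "\<Gamma> * e \<mu> \<nu> * \<Gamma> = (-1) ^ (parity \<mu> + parity \<nu>) *\<^sub>C e \<mu> \<nu>" for \<mu> \<nu>
  proof -
    have "\<Gamma> * e \<mu> \<nu> * \<Gamma> = R (\<Theta> (E \<mu> \<nu>))" by (simp add: e_def R_\<Theta> E_right)
    also have "\<Theta> (E \<mu> \<nu>) = (-1) ^ (parity \<mu> + parity \<nu>) *\<^sub>C E \<mu> \<nu>"
      by (simp add: E_word star_hom_matrix_unit_word[OF \<Theta>_hom] \<Theta>_site matrix_unit_word_minus)
    finally show ?thesis by (simp add: R_simps E_right e_def)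
  qed
  show "\<Gamma> * s * \<Gamma> = - s" if s: "s \<in> S n" for s n
  proof -
    have 1: "\<Gamma> * R (a (site (int n) v)) * \<Gamma> = - R (a (site (int n) v))" for v
      by (simp add: R_\<Theta> site_right \<Theta>_site R_minus)
    have 2: "\<Gamma> * (R (a (site (int n) v)))\<^sup>\<dagger> * \<Gamma> = - (R (a (site (int n) v)))\<^sup>\<dagger>" for v
      using arg_cong[OF 1[of v], of star] by (simp add: star_mult star_minus \<Gamma> mult.assoc)
    show ?thesis using s 1 2 by (auto simp: S_def)
  qed
  show "S (Suc n) = \<rho> ` S n" for n
    unfolding S_def image_UN by (simp only: image_insert image_empty \<rho>_star \<rho>_site)
  show "\<exists>c. s = (\<Sum>\<mu>\<in>UNIV. \<Sum>\<nu>\<in>UNIV. c \<mu> \<nu> *\<^sub>C e \<mu> \<nu>)" if s: "s \<in> S 0" for s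
  proof -
    have "\<exists>X. s = R (j0 X)"
    proof -
      obtain v where "s = R (a (site 0 v)) \<or> s = (R (a (site 0 v)))\<^sup>\<dagger>" using s by (auto simp: S_def)
      moreover have "R (a (site 0 v)) = R (j0 (fock_annihilate v))"
        "(R (a (site 0 v)))\<^sup>\<dagger> = R (j0 (fock_create v))"
        by (simp_all add: j0(2)[symmetric] j0_right flip: R_simps(3) j0_simps(4) fock_annihilate_star)
      ultimately show ?thesis by blast
    qed
    then obtain X where "s = R (j0 X)" by blast
    then show ?thesis unfolding R_j0_expansion[of X]
      by (rule exI[of _ "\<lambda>\<mu> \<nu>. cinner (fock_basis \<mu>) (X \<cdot> fock_basis \<nu>)"])
  qed
qed (rule \<Gamma> \<rho>_hom \<rho>_inj e_\<rho> R_irreducible; assumption)+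

definition \<phi> where "\<phi> y = cinner \<Omega> (j y \<cdot> \<Omega>)"

lemma \<phi>_simps: "\<phi> (x + y) = \<phi> x + \<phi> y" "\<phi> (c *\<^sub>C 1) = c"
  using gns_unit[OF pure gns] by (simp_all add: \<phi>_def j_simps bop_simps cinner_simps cinner_self)

lemma \<phi>_\<Gamma>: "\<phi> (\<Gamma> * y * \<Gamma>) = \<phi> y"
proof -
  have "\<Gamma>\<omega> \<cdot> \<Omega> = \<Omega>" using \<Gamma>\<omega>[of 1] \<Theta>_hom by (simp add: star_hom_def \<pi>_simps bop_simps)
  moreover have "\<iota> (Ad \<Gamma>\<omega> (j y)) = \<Gamma> * y * \<Gamma>" 
    unfolding \<iota>_\<Gamma>[OF j_M] \<iota>_j by (simp add: Ad_def \<Gamma>)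
  moreover have "Ad \<Gamma>\<omega> (j y) \<in> M" using \<Gamma>\<omega>_M j_M by (auto simp: star_iso_def bij_betw_def)
  ultimately have "\<Gamma>\<omega> \<cdot> \<Omega> = \<Omega>" "j (\<Gamma> * y * \<Gamma>) = \<Gamma>\<omega> * j y * \<Gamma>\<omega>"
    using j_\<iota>[of "Ad \<Gamma>\<omega> (j y)"] by (simp_all add: Ad_def \<Gamma>\<omega>_star)
  then show ?thesis using cinner_star_left[of \<Gamma>\<omega> \<Omega> "j y \<cdot> \<Omega>"] by (simp add: \<phi>_def bop_simps \<Gamma>\<omega>_star)
qed

text \<open>Invariance of \<omega> concerns the C*-algebra, while \<open>j y\<close> ranges over its
  weak closure; \<open>pure_automorphism_invariant\<close> bridges the two.\<close>

lemma \<phi>_\<rho>: "\<phi> (\<rho> y) = \<phi> y"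
proof -
  have "j (\<rho> y) = \<tau>\<omega> (j y)" by (simp add: \<rho>_def' j_\<iota> \<tau>\<omega>_M j_M)
  moreover have "surj (\<tau> 1)" using \<tau>[of 1] by (simp add: bogoliubov_def star_iso_def bij_betw_def)
  ultimately show ?thesis
    unfolding \<phi>_def
    using pure_automorphism_invariant[OF pure gns \<tau>\<omega>[unfolded bicommutant_range], of "\<tau> 1" "j y"]
    by (simp add: \<tau>\<omega>_\<pi> translation_invariant)
qed

lemma \<phi>_normal: "0 < r \<Longrightarrow> \<exists>f. wot_functional f \<and> (\<forall>x. cmod (\<phi> x - f x) \<le> r * norm x)"
  unfolding \<phi>_def by (rule star_iso_normal[OF j_iso M_vN])

section \<open>Transformation of the generators and matrix units under a symmetry\<close>

context
  fixes al :: bool and V :: "(complex, 'd) vec \<Rightarrow> (complex, 'd) vec" and \<beta> :: "'a \<Rightarrow> 'a"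
    and \<theta> :: "'b bop \<Rightarrow> 'b bop"
  assumes V: "unitary_map al V" and \<beta>: "bogoliubov a al (sitewise V) \<beta>"
    and \<theta>: "star_hom al UNIV \<theta>" and \<theta>_R: "\<And>A. A \<in> car_right a \<Longrightarrow> \<theta> (R A) = R (\<beta> A)"
begin

lemma \<beta>_hom: "star_hom al UNIV \<beta>"
  using \<beta> by (simp add: bogoliubov_def star_iso_def)

lemma \<beta>_site: "\<beta> (a (site x v)) = a (site x (V v))"
proof -
  have "V (0 *\<^sub>C 0) = (if al then cnj 0 else 0) *\<^sub>C V 0" using V unfolding unitary_map_def by blast
  then have "V 0 = 0" by (cases al) simp_all
  moreover have "\<beta> (a (site x v)) = a (sitewise V (site x v))"
    using \<beta> site_l2Z unfolding bogoliubov_def by blast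
  ultimately show ?thesis by (simp add: sitewise_site)
qed

lemma \<theta>_star: "\<theta> (x\<^sup>\<dagger>) = (\<theta> x)\<^sup>\<dagger>"
  using \<theta> by (simp add: star_hom_def)

text \<open>The one-particle map is surjective and acts on each site separately, so a generator has
  a preimage at its own site, with the same vector after translation.\<close>

lemma \<theta>_S: "s \<in> S n \<Longrightarrow> \<exists>s'\<in>S n. \<theta> s' = s \<and> \<theta> (\<rho> s') = \<rho> s"
proof -
  assume "s \<in> S n"
  then obtain v where v: "s = R (a (site (int n) v)) \<or> s = (R (a (site (int n) v)))\<^sup>\<dagger>" by (auto simp: S_def)
  have "surj V" using V by (simp add: unitary_map_def)
  then obtain w where w: "v = V w" by (rule surjE)
  let ?r = "R (a (site (int n) w))"
  have r: "\<theta> ?r = R (a (site (int n) v))" "\<theta> (\<rho> ?r) = \<rho> (R (a (site (int n) v)))"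
    by (simp_all only: \<rho>_site \<theta>_R site_right \<beta>_site w)
  have "?r \<in> S n" "?r\<^sup>\<dagger> \<in> S n" by (auto simp: S_def)
  then show ?thesis using v r by (metis \<theta>_star \<rho>_star)
qed

text \<open>The automorphism replaces the basis vectors in the word of \<open>E \<mu> \<nu>\<close>
  by their images under \<open>V\<close>. The result is the rank-one operator of two second
  quantized basis vectors, with coefficients given by \<open>D\<close>, conjugated for the second
  vector.\<close>

lemma \<theta>_e:
  defines "D \<equiv> \<lambda>\<mu> \<nu>. cinner (fock_basis \<mu>) (second_quantization al V (fock_basis \<nu>))"
  shows "\<theta> (e \<mu> \<nu>) = (\<Sum>\<kappa>\<in>UNIV. \<Sum>\<eta>\<in>UNIV. (D \<kappa> \<mu> * cnj (D \<eta> \<nu>)) *\<^sub>C e \<kappa> \<eta>)"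
proof -
  define W where "W \<nu> = second_quantization al V (fock_basis \<nu>)" for \<nu>
  have "\<theta> (e \<mu> \<nu>) = R (\<beta> (E \<mu> \<nu>))" by (simp add: e_def \<theta>_R E_right)
  also have "\<beta> (E \<mu> \<nu>) = j0 (butterfly (W \<mu>) (W \<nu>))"
  proof -
    have "\<beta> (E \<mu> \<nu>) = \<beta> (matrix_unit_word (\<lambda>i. a (site 0 (axis i 1))) \<mu> \<nu>)"
      by (rule arg_cong[OF E_word])
    then show ?thesis
      by (simp add: star_hom_matrix_unit_word[OF \<beta>_hom] \<beta>_site frame_matrix_unit_word[OF V]
          W_def second_quantization_basis)
  qed
  also have "R \<dots> = (\<Sum>\<kappa>\<in>UNIV. \<Sum>\<eta>\<in>UNIV. (D \<kappa> \<mu> * cnj (D \<eta> \<nu>)) *\<^sub>C e \<kappa> \<eta>)"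
    unfolding R_j0_expansion
    by (simp add: butterfly_apply cinner_simps D_def W_def mult.commute cinner_commute[of "second_quantization _ _ _"])
  finally show ?thesis .
qed

end

end

theorem theorem5p3:
  fixes G :: "('g, 'm) monoid_scheme"
    and p :: "'g \<Rightarrow> int"
    and a :: "(int \<Rightarrow> complex ^ 'd::{finite,linorder}) \<Rightarrow> 'a::cstar_algebra"
    and U :: "'g \<Rightarrow> (complex, 'd) vec \<Rightarrow> (complex, 'd) vec"
    and \<alpha> :: "'g \<Rightarrow> 'a \<Rightarrow> 'a"
    and \<tau> :: "int \<Rightarrow> 'a \<Rightarrow> 'a"
    and \<Theta> :: "'a \<Rightarrow> 'a"
    and E :: "'d set \<Rightarrow> 'd set \<Rightarrow> 'a"
    and \<omega> :: "'a \<Rightarrow> complex"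
    and \<pi>\<^sub>R :: "'a \<Rightarrow> 'r::chilbert bop" and \<Omega>\<^sub>R :: 'r
    and \<pi> :: "'a \<Rightarrow> 'h::chilbert bop" and \<Omega> :: 'h
    and M :: "'h bop set"
    and \<Gamma>\<omega> :: "'h bop"
    and \<alpha>\<omega> :: "'g \<Rightarrow> 'h bop \<Rightarrow> 'h bop"
    and \<tau>\<omega> :: "'h bop \<Rightarrow> 'h bop"
    and V :: "'g \<Rightarrow> 'k::chilbert \<times> 'k \<Rightarrow> 'k \<times> 'k"
    and \<iota> :: "'h bop \<Rightarrow> ('k \<times> 'k) bop"
    and \<rho> :: "('k \<times> 'k) bop \<Rightarrow> ('k \<times> 'k) bop"
  assumes G: "group G" "finite (carrier G)"
    and p: "p \<in> hom G Z2"
    and car: "car_algebra a"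
    and U: "projective_rep G p U"
    and \<alpha>: "\<forall>g\<in>carrier G. bogoliubov a (p g = 1) (sitewise (U g)) (\<alpha> g)"
    and \<alpha>_action: "\<forall>g\<in>carrier G. \<forall>h\<in>carrier G. \<alpha> g \<circ> \<alpha> h = \<alpha> (g \<otimes>\<^bsub>G\<^esub> h)"
    and \<tau>: "\<forall>x. bogoliubov a False (shift x) (\<tau> x)"
    and \<Theta>: "bogoliubov a False (\<lambda>f x. - f x) \<Theta>"
    and E: "site_matrix_units a E"
    and pure: "pure_state \<omega>"
    and split: "split_state a \<omega> \<pi>\<^sub>R \<Omega>\<^sub>R"
    and \<alpha>_invariant: "state_invariant G p \<alpha> \<omega>"
    and translation_invariant: "\<forall>x. \<omega> \<circ> \<tau> x = \<omega>"
    and gns: "gns UNIV \<omega> \<pi> \<Omega>"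
    and M: "M = bicommutant (\<pi> ` car_right a)"
    and \<Gamma>\<omega>: "\<forall>A. \<Gamma>\<omega> \<cdot> \<pi> A \<cdot> \<Omega> = \<pi> (\<Theta> A) \<cdot> \<Omega>"
    and \<alpha>\<omega>: "\<forall>g\<in>carrier G. \<forall>A\<in>car_right a. \<alpha>\<omega> g (\<pi> A) = \<pi> (\<alpha> g A)"
    and system: "graded_Wstar_system G p M (Ad \<Gamma>\<omega>) \<alpha>\<omega>"
    and \<tau>\<omega>: "star_iso False (bicommutant (range \<pi>)) (bicommutant (range \<pi>)) \<tau>\<omega>"
      "\<tau>\<omega> \<circ> \<pi> = \<pi> \<circ> \<tau> 1"
    and S0: "S0_rep G p V"
    and equivalent: "graded_equivalence G \<iota> M (Ad \<Gamma>\<omega>) \<alpha>\<omega> UNIV (Ad grading) (\<lambda>g. Ad_map (V g))"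
    and \<rho>: "\<rho> = \<iota> \<circ> \<tau>\<omega> \<circ> inv_into M \<iota>"
  shows "\<exists>B :: 'd set \<Rightarrow> ('k \<times> 'k) bop.
    (\<forall>\<mu> \<nu>. (B \<nu>)\<^sup>\<dagger> * B \<mu> = (if \<mu> = \<nu> then 1 else 0)) \<and>
    (\<forall>A\<in>car_right a.
       \<rho> (\<iota> (\<pi> A)) = (\<Sum>\<mu>\<in>UNIV. Ad (B \<mu> * grading ^ parity \<mu>) (\<iota> (\<pi> A))) \<and>
       \<rho> (\<iota> (\<pi> A)) = (\<Sum>\<mu>\<in>UNIV. Ad (grading ^ parity \<mu> * B \<mu>) (\<iota> (\<pi> A)))) \<and>
    (\<forall>N (\<mu> :: nat \<Rightarrow> 'd set) (\<nu> :: nat \<Rightarrow> 'd set).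
       \<iota> (\<pi> (prod_list (map (\<lambda>x. \<tau> (int x) (E (\<mu> x) (\<nu> x))) [0..<Suc N]))) =
         (-1) ^ (\<Sum>k=1..N. (parity (\<mu> k) + parity (\<nu> k)) * (\<Sum>j<k. parity (\<nu> j))) *
         prod_list (map (\<lambda>x. B (\<mu> x)) [0..<Suc N]) *
         prod_list (map (\<lambda>x. (B (\<nu> x))\<^sup>\<dagger>) (rev [0..<Suc N]))) \<and>
    (\<exists>\<sigma>\<^sub>0 \<in> {0, 1::nat}. \<forall>\<mu>. Ad grading (B \<mu>) = (-1) ^ (parity \<mu> + \<sigma>\<^sub>0) * B \<mu>) \<and>
    (\<forall>x\<in>M. sigma_weak_limit (\<lambda>N. ((\<lambda>y. \<Sum>\<mu>\<in>UNIV. B \<mu> * y * (B \<mu>)\<^sup>\<dagger>) ^^ N) (\<iota> x))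
       (cinner \<Omega> (x \<cdot> \<Omega>) *\<^sub>C 1)) \<and>
    (\<forall>g\<in>carrier G. \<exists>c. cmod c = 1 \<and>
       (\<forall>\<nu>. (\<Sum>\<mu>\<in>UNIV. cinner (fock_basis \<mu>)
                (second_quantization (p g = 1) (U g) (fock_basis \<nu>)) *\<^sub>C B \<mu>) =
            c *\<^sub>C Ad_map (V g) (B \<nu>)))"
proof -
  interpret half_line_system a \<tau> \<Theta> E \<omega> \<pi> \<Omega> M \<Gamma>\<omega> \<tau>\<omega> grading \<iota> \<rho>
  proof
    show "\<omega> (\<tau> x A) = \<omega> A" for x A using translation_invariant by (auto simp: fun_eq_iff)
    show "\<tau>\<omega> (\<pi> A) = \<pi> (\<tau> 1 A)" for A using \<tau>\<omega>(2) by (auto simp: fun_eq_iff)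
    show "star_iso False M M (Ad \<Gamma>\<omega>)" "bicommutant M = M"
      using system by (auto simp: graded_Wstar_system_def von_neumann_algebra_def)
    show "star_iso False M UNIV \<iota>" "\<And>x. x \<in> M \<Longrightarrow> \<iota> (Ad \<Gamma>\<omega> x) = Ad grading (\<iota> x)"
      using equivalent by (auto simp: graded_equivalence_def)
    show "grading\<^sup>\<dagger> = (grading :: ('k \<times> 'k) bop)" "grading * grading = (1 :: ('k \<times> 'k) bop)"
      by (rule grading_star grading_square)+
    show "\<Gamma>\<omega> \<cdot> \<pi> A \<cdot> \<Omega> = \<pi> (\<Theta> A) \<cdot> \<Omega>" for A using \<Gamma>\<omega> by blast
    show "bogoliubov a False (shift x) (\<tau> x)" for x using \<tau> by blast
  qed (fact car \<Theta> E pure gns M \<tau>\<omega>(1) \<rho>)+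
  obtain B\<^sub>0 where "B\<^sub>0\<^sup>\<dagger> * B\<^sub>0 = 1" "\<And>y. B\<^sub>0 * y = \<rho> y * B\<^sub>0" "e {} {} * B\<^sub>0 = B\<^sub>0"
    using exists_vacuum_isometry by blast
  then interpret cuntz_isometries \<rho> grading e S B\<^sub>0 by unfold_locales auto
  show ?thesis
  proof (rule exI[of _ B], intro conjI allI ballI)
    show "(B \<nu>)\<^sup>\<dagger> * B \<mu> = (if \<mu> = \<nu> then 1 else 0)" for \<mu> \<nu> by (rule B_orthogonal)
    show "\<rho> (\<iota> (\<pi> A)) = (\<Sum>\<mu>\<in>UNIV. Ad (B \<mu> * grading ^ parity \<mu>) (\<iota> (\<pi> A)))" for A by (rule \<rho>_eq)
    show "\<rho> (\<iota> (\<pi> A)) = (\<Sum>\<mu>\<in>UNIV. Ad (grading ^ parity \<mu> * B \<mu>) (\<iota> (\<pi> A)))" for A by (rule \<rho>_eq')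
    show "\<iota> (\<pi> (prod_list (map (\<lambda>x. \<tau> (int x) (E (\<mu> x) (\<nu> x))) [0..<Suc N]))) =
         (-1) ^ (\<Sum>k=1..N. (parity (\<mu> k) + parity (\<nu> k)) * (\<Sum>j<k. parity (\<nu> j))) *
         prod_list (map (\<lambda>x. B (\<mu> x)) [0..<Suc N]) *
         prod_list (map (\<lambda>x. (B (\<nu> x))\<^sup>\<dagger>) (rev [0..<Suc N]))" for N \<mu> \<nu>
    proof -
      have "R (prod_list (map (\<lambda>x. \<tau> (int x) (E (\<mu> x) (\<nu> x))) xs)) =
          prod_list (map (\<lambda>x. (\<rho> ^^ x) (e (\<mu> x) (\<nu> x))) xs)" for xs
      proof (induction xs)
        case (Cons x xs)
        have "prod_list (map (\<lambda>x. \<tau> (int x) (E (\<mu> x) (\<nu> x))) xs) \<in> car_right a"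
          by (rule prod_list_subalgebra[OF car_right_subalgebra \<tau>_E_right])
        then show ?case using Cons by (simp add: R_simps \<tau>_E_right \<rho>_\<tau>_E)
      qed (simp add: R_simps)
      from this[of "[0..<Suc N]"] show ?thesis
        unfolding R_def matrix_unit_product
        by (simp only: minus_one_power_scaleC scaleC_mult_left mult.assoc)
    qed
    obtain \<sigma> where \<sigma>: "\<sigma> \<in> {0, 1}" "\<And>\<mu>. homogeneous (parity \<mu> + \<sigma>) (B \<mu>)" using exists_parity by blast
    show "\<exists>\<sigma>\<^sub>0\<in>{0, 1::nat}. \<forall>\<mu>. Ad grading (B \<mu>) = (-1) ^ (parity \<mu> + \<sigma>\<^sub>0) * B \<mu>"
      using \<sigma> unfolding homogeneous_conj minus_one_power_scaleC Ad_def \<Gamma>_star by blast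
    show "sigma_weak_limit (\<lambda>N. ((\<lambda>y. \<Sum>\<mu>\<in>UNIV. B \<mu> * y * (B \<mu>)\<^sup>\<dagger>) ^^ N) (\<iota> x))
       (cinner \<Omega> (x \<cdot> \<Omega>) *\<^sub>C 1)" if x: "x \<in> M" for x
      using T_mixing[OF \<phi>_simps \<phi>_\<Gamma> \<phi>_\<rho> \<phi>_normal, of "\<iota> x"]
      unfolding T_def[abs_def] by (simp add: \<phi>_def j_\<iota> x)
    show "\<exists>c. cmod c = 1 \<and>
       (\<forall>\<nu>. (\<Sum>\<mu>\<in>UNIV. cinner (fock_basis \<mu>)
                (second_quantization (p g = 1) (U g) (fock_basis \<nu>)) *\<^sub>C B \<mu>) =
            c *\<^sub>C Ad_map (V g) (B \<nu>))" if g: "g \<in> carrier G" for g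
    proof -
      have V: "unitary_map (p g = 1) (U g)" using U g by (simp add: projective_rep_def)
      have \<beta>: "bogoliubov a (p g = 1) (sitewise (U g)) (\<alpha> g)" using \<alpha> g by blast
      have eq: "\<iota> (\<alpha>\<omega> g x) = Ad_map (V g) (\<iota> x)" if "x \<in> M" for x
        using equivalent g that by (simp add: graded_equivalence_def)
      have "star_iso (p g = 1) M M (\<alpha>\<omega> g)" using system g by (simp add: graded_Wstar_system_def)
      then have \<alpha>M: "star_hom (p g = 1) M (\<alpha>\<omega> g)" "\<And>x. x \<in> M \<Longrightarrow> \<alpha>\<omega> g x \<in> M"
        by (auto simp: star_iso_def bij_betw_def)
      \<comment> \<open>The homomorphism property of \<open>Ad_map (V g)\<close> is read off from
        the equivalence: it equals \<open>\<iota> (\<alpha>\<omega> g (j y))\<close>, a composition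
        that is anti-linear exactly when \<open>p g = 1\<close>.\<close>
      have "star_hom (p g = 1) UNIV (\<lambda>y. \<iota> (\<alpha>\<omega> g (j y)))"
        using star_hom_compose[OF star_hom_compose[OF _ \<alpha>M(1)], of False UNIV j False M \<iota>]
          j_iso \<iota> j_M \<alpha>M(2) by (simp add: star_iso_def)
      then have \<theta>: "star_hom (p g = 1) UNIV (Ad_map (V g))"
        by (simp add: eq j_M \<iota>_j)
      have \<theta>_R: "Ad_map (V g) (R A) = R (\<alpha> g A)" if "A \<in> car_right a" for A
        using eq[OF \<pi>_M[OF that]] \<alpha>\<omega> g that by (simp add: R_def)
      show ?thesis
        by (rule covariance[OF \<theta> \<theta>_S[OF V \<beta> \<theta> \<theta>_R] \<theta>_e[OF V \<beta> \<theta> \<theta>_R] second_quantization_vacuum])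
    qed
  qed
qed

end
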